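(* Let $d,\beta>0$ and let $m=m(n)$ be any sequence of integers with $\lim_{n\to\infty}2m/n=d$. Assume that either $d\le1$, or $d>1$ and $\beta<\beta_{\mathrm f}(d)$, where $\beta_{\mathrm f}(d)=\operatorname{artanh}(1/d)$. Let $(Y_\ell)_{\ell\ge3}$ be independent random variables with $Y_\ell\sim\mathrm{Po}(d^\ell/(2\ell))$. Then, as $n\to\infty$, $$\log Z_{\mathbb G}(\beta,0)-\Bigl[n\log2+m\log\cosh\beta-\tfrac12\log(1-d\tanh\beta)\Bigr]$$ converges in distribution to $$\sum_{\ell\ge3}\Bigl(Y_\ell\log\bigl(1+\tanh^\ell\beta\bigr)-\frac{d^\ell}{2\ell}\tanh^\ell\beta\Bigr)-\frac d2\tanh\beta-\frac{d^2}4\tanh^2\beta .$$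
   Context: $\mathbb G=\mathbb G(n,m)$ is a uniformly random simple graph with vertex set $V_n=\{v_1,\dots,v_n\}$ and exactly $m$ edges. For a finite graph $G$, $Z_G(\beta,0)=\sum_{\sigma\in\{\pm1\}^{V(G)}}\exp\bigl(\beta\sum_{vw\in E(G)}\sigma(v)\sigma(w)\bigr)$ is the Ising partition function without external field. $\tanh^\ell\beta=(\tanh\beta)^\ell$. *)

theory Defs
  imports "HOL-Probability.Probability"
begin

text \<open>A graph is a pair of a vertex set and a set of edges. The edges of a simple graph are
  two-element sets of vertices, so loops and multiple edges are excluded.\<close>

type_synonym 'a graph = "'a set \<times> 'a set set"

definition simple_graph :: "'a graph \<Rightarrow> bool" where
  "simple_graph G \<longleftrightarrow> (\<forall>e\<in>snd G. e \<subseteq> fst G \<and> card e = 2)"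

definition graphs_nm :: "nat \<Rightarrow> nat \<Rightarrow> nat graph set" where
  "graphs_nm n m = {G. simple_graph G \<and> fst G = {1..n} \<and> card (snd G) = m}"

text \<open>The set \<open>graphs_nm n m\<close> is finite, and nonempty iff \<open>m \<le> n choose 2\<close>; outside this range
  the distribution below is unspecified.\<close>

definition random_graph :: "nat \<Rightarrow> nat \<Rightarrow> nat graph pmf" where
  "random_graph n m = pmf_of_set (graphs_nm n m)"

text \<open>For an edge \<open>e = {v, w}\<close> the product \<open>\<Prod>u\<in>e. \<sigma> u\<close> is \<open>\<sigma> v * \<sigma> w\<close>.
  Extensional functions \<open>\<rightarrow>\<^sub>E\<close> ensure that every spin configuration on the vertex set is counted
  exactly once.\<close>

definition ising_Z :: "'a graph \<Rightarrow> real \<Rightarrow> real" where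
  "ising_Z G \<beta> =
     (\<Sum>\<sigma> \<in> fst G \<rightarrow>\<^sub>E {-1, 1::real}. exp (\<beta> * (\<Sum>e\<in>snd G. \<Prod>u\<in>e. \<sigma> u)))"

definition beta_f :: "real \<Rightarrow> real" where
  "beta_f d = artanh (1 / d)"

end

theory Submission
  imports Defs
begin

text \<open>Put \<open>t = tanh \<beta>\<close>. The high-temperature expansion gives
  \<open>Z G \<beta> = 2 ^ n * (cosh \<beta>) ^ m * S G\<close>, where \<open>S G\<close> sums \<open>t ^ card A\<close> over the even edge sets
  \<open>A\<close> of \<open>G\<close>. All terms are nonnegative, so no second moment is needed. Bounding \<open>S\<close> from below by
  the contribution of vertex-disjoint unions of cycles of length at most \<open>L\<close>, and comparing
  first moments: the expectation of \<open>S\<close> is at most that of the even sum of the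
  complete graph at weight \<open>t * m / (n choose 2)\<close>, a Curie--Weiss partition function with limit
  \<open>exp (\<Sum>l\<ge>3. (d t) ^ l / (2 l))\<close>, while the disjoint unions of short cycles contribute
  \<open>exp (\<Sum>l=3..L. (d t) ^ l / (2 l))\<close> in the limit. Hence the remainder is small in expectation as
  \<open>L \<rightarrow> \<infinity>\<close>. As short cycles are vertex-disjoint with high probability, \<open>ln (S G)\<close> is close to
  \<open>\<Sum> ln (1 + t ^ l)\<close> over the short cycles of \<open>G\<close>, whose characteristic function converges to the
  compound Poisson one by a truncated inclusion-exclusion.\<close>

section \<open>Cycles as edge sets\<close>

text \<open>With x = d t, the Curie--Weiss bound tends to exp (- x / 2 - x^2 / 4) / sqrt (1 - x),
  and - ln (1 - x) / 2 is the sum of x^l / (2 l) over l \<ge> 1. The exponential removes exactly l =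
  1 and l = 2, the loops and double edges that a simple graph lacks; this is also where the last two
  terms of the limit law come from. The hypothesis on d and \<beta> says x < 1, the convergence
  condition both of the series and of the Gaussian integral behind the bound. The upper bound must
  be sharp up to a factor 1 + o(1), while enumerating even subgraphs of all sizes would be
  laborious; on the complete graph the spin sum depends on the magnetisation alone and no
  enumeration remains. The gap between the even sum and its disjoint-cycle part is nonnegative
  pointwise, so a small expectation means smallness in L1. This passes to logarithms because the
  disjoint-cycle sum is at least 1, the contribution of the empty family. The length bound L is
  fixed before the number r of cycles per family, and both before n.\<close>

definition cycle_edges :: "'a list \<Rightarrow> 'a set set" where
  "cycle_edges xs = (\<lambda>i. {xs ! i, xs ! (Suc i mod length xs)}) ` {..<length xs}"

text \<open>A cycle is its edge set, so the 2 * l vertex lists that trace it, one for each start and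
  direction, become one element, and containment in a graph is plain inclusion.\<close>

definition cycles :: "'a set \<Rightarrow> nat \<Rightarrow> 'a set set set" where
  "cycles V l = cycle_edges ` {xs. length xs = l \<and> distinct xs \<and> set xs \<subseteq> V}"

lemma finite_cycle_edges [simp]: "finite (cycle_edges xs)"
  by (simp add: cycle_edges_def)

lemma Union_cycle_edges: "\<Union>(cycle_edges xs) = set xs"
proof
  show "\<Union>(cycle_edges xs) \<subseteq> set xs"
    by (auto simp: cycle_edges_def intro!: nth_mem mod_less_divisor)
  show "set xs \<subseteq> \<Union>(cycle_edges xs)"
    by (auto simp: cycle_edges_def in_set_conv_nth)
qed

text \<open>Two different positions with the same edge would each be the cyclic successor of the
  other, which forces a length of at most 2; hence the bound 3.\<close>

lemma inj_on_cycle_edge: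
  assumes "distinct xs" "length xs \<ge> 3"
  shows "inj_on (\<lambda>i. {xs ! i, xs ! (Suc i mod length xs)}) {..<length xs}"
proof (rule inj_onI)
  fix i j assume ij: "i \<in> {..<length xs}" "j \<in> {..<length xs}"
    and eq: "{xs ! i, xs ! (Suc i mod length xs)} = {xs ! j, xs ! (Suc j mod length xs)}"
  have l: "Suc i mod length xs < length xs" "Suc j mod length xs < length xs"
    using assms by (auto intro!: mod_less_divisor)
  show "i = j"
  proof (rule ccontr)
    assume "i \<noteq> j"
    then have "xs ! i = xs ! (Suc j mod length xs)" "xs ! j = xs ! (Suc i mod length xs)"
      using eq ij assms by (auto simp: doubleton_eq_iff nth_eq_iff_index_eq)
    then have i: "i = Suc j mod length xs" and j: "j = Suc i mod length xs"
      using ij l nth_eq_iff_index_eq[OF assms(1)] by blast+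
    have lt: "i < length xs" "j < length xs" using ij by auto
    show False
    proof (cases "Suc j = length xs")
      case True
      then have "i = 0" using i by simp
      then have "j = 1" using j assms(2) by simp
      with True assms(2) show False by simp
    next
      case False
      with i lt have i': "i = Suc j" by simp
      show False
      proof (cases "Suc i = length xs")
        case True
        then have "j = 0" using j by simp
        with i' True assms(2) show False by simp
      next
        case False
        with j lt have "j = Suc i" by simp
        with i' show False by simp
      qed
    qed
  qed
qed

lemma card_cycle_edges:
  assumes "distinct xs" "length xs \<ge> 3"
  shows "card (cycle_edges xs) = length xs"
  using card_image[OF inj_on_cycle_edge[OF assms]] by (simp add: cycle_edges_def)

lemma card_edge_of_cycle:
  assumes "distinct xs" "length xs \<ge> 3" "e \<in> cycle_edges xs"
  shows "card e = 2"
proof -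
  obtain i where i: "i < length xs" "e = {xs ! i, xs ! (Suc i mod length xs)}"
    using assms(3) by (auto simp: cycle_edges_def)
  have l: "Suc i mod length xs < length xs" "i \<noteq> Suc i mod length xs"
    using assms i by (auto intro!: mod_less_divisor simp: mod_Suc)
  then have "xs ! i \<noteq> xs ! (Suc i mod length xs)"
    using assms(1) i(1) nth_eq_iff_index_eq by blast
  then show ?thesis using i by simp
qed

lemma cycle_edges_rotate:
  assumes "distinct xs" "length xs \<ge> 3"
  shows "cycle_edges (rotate k xs) = cycle_edges xs"
proof (rule card_subset_eq)
  show "cycle_edges (rotate k xs) \<subseteq> cycle_edges xs"
  proof
    fix e assume "e \<in> cycle_edges (rotate k xs)"
    then obtain i where i: "i < length xs"
      "e = {rotate k xs ! i, rotate k xs ! (Suc i mod length xs)}"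
      by (auto simp: cycle_edges_def)
    have "Suc i mod length xs < length xs" using i(1) by (auto intro!: mod_less_divisor)
    then have "e = {xs ! ((k + i) mod length xs), xs ! (Suc ((k + i) mod length xs) mod length xs)}"
      using i by (simp add: nth_rotate mod_simps)
    moreover have "(k + i) mod length xs < length xs"
      using i(1) by (auto intro!: mod_less_divisor)
    ultimately show "e \<in> cycle_edges xs" by (auto simp: cycle_edges_def)
  qed
  show "card (cycle_edges (rotate k xs)) = card (cycle_edges xs)"
    using assms by (simp add: card_cycle_edges)
qed simp

lemma cycle_edges_rev:
  assumes "distinct xs" "length xs \<ge> 3"
  shows "cycle_edges (rev xs) = cycle_edges xs"
proof (rule card_subset_eq)
  show "cycle_edges (rev xs) \<subseteq> cycle_edges xs"
  proof
    fix e assume "e \<in> cycle_edges (rev xs)"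
    then obtain i where i: "i < length xs"
      "e = {rev xs ! i, rev xs ! (Suc i mod length xs)}"
      by (auto simp: cycle_edges_def)
    show "e \<in> cycle_edges xs"
    proof (cases "Suc i = length xs")
      case True
      have "rev xs ! 0 = xs ! i" "rev xs ! i = xs ! 0"
        using rev_nth[of 0 xs] rev_nth[of i xs] i(1) True[symmetric] by auto
      with True i(2) have "e = {xs ! i, xs ! (Suc i mod length xs)}"
        by (simp add: insert_commute)
      then show ?thesis using i by (auto simp: cycle_edges_def)
    next
      case False
      define j where "j = length xs - Suc (Suc i)"
      have "Suc i < length xs" using False i by simp
      then have "e = {xs ! j, xs ! (Suc j mod length xs)}" "j < length xs"
        using i by (auto simp: rev_nth j_def Suc_diff_Suc)
      then show ?thesis by (auto simp: cycle_edges_def)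
    qed
  qed
  show "card (cycle_edges (rev xs)) = card (cycle_edges xs)"
    using assms by (simp add: card_cycle_edges)
qed simp

section \<open>The vertex list of a cycle is unique up to rotation and reversal\<close>

lemma neighbour_in_cycle:
  assumes "distinct xs" "1 \<le> i" "Suc i < length xs" "{xs ! i, b} \<in> cycle_edges xs"
  shows "b = xs ! (i - 1) \<or> b = xs ! Suc i"
proof -
  obtain j where j: "j < length xs" "{xs ! i, b} = {xs ! j, xs ! (Suc j mod length xs)}"
    using assms(4) by (auto simp: cycle_edges_def)
  have l: "Suc j mod length xs < length xs" using j(1) by (auto intro!: mod_less_divisor)
  from j(2) consider "xs ! i = xs ! j" "b = xs ! (Suc j mod length xs)"
    | "xs ! i = xs ! (Suc j mod length xs)" "b = xs ! j"
    by (auto simp: doubleton_eq_iff)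
  then show ?thesis
  proof cases
    case 1
    then have "i = j" using assms(1,3) j(1) by (simp add: nth_eq_iff_index_eq)
    then show ?thesis using 1 assms by simp
  next
    case 2
    then have "i = Suc j mod length xs" using assms(1,3) l by (simp add: nth_eq_iff_index_eq)
    then have "j = i - 1" using assms(2) j(1) by (auto simp: mod_Suc split: if_splits)
    then show ?thesis using 2 by simp
  qed
qed

lemma cycle_edges_Suc_mem:
  assumes "Suc i < length xs" shows "{xs ! i, xs ! Suc i} \<in> cycle_edges xs"
  using assms by (auto simp: cycle_edges_def intro!: image_eqI[of _ _ i])

text \<open>A walk along \<open>xs\<close> has no choice after its first two vertices: an inner
  vertex has only two neighbours in the cycle, and distinctness of \<open>ys\<close> forbids going
  back. Since \<open>ys\<close> may be shorter, this serves the containment of one cycle in another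
  as well as uniqueness.\<close>

lemma cycle_prefix_unique:
  assumes "distinct xs" "distinct ys" "length ys \<le> length xs" "length ys \<ge> 3"
    and sub: "cycle_edges ys \<subseteq> cycle_edges xs"
    and start: "ys ! 0 = xs ! 0" "ys ! 1 = xs ! 1"
  shows "i < length ys \<Longrightarrow> ys ! i = xs ! i"
proof (induction i rule: less_induct)
  case (less i)
  consider "i = 0" | "i = 1" | j where "i = Suc (Suc j)"
    by (metis One_nat_def not0_implies_Suc)
  then show ?case
  proof cases
    case 3
    have "{ys ! Suc j, ys ! i} \<in> cycle_edges xs"
      using cycle_edges_Suc_mem[of "Suc j" ys] sub less.prems 3 by auto
    moreover have IH: "ys ! Suc j = xs ! Suc j" "ys ! j = xs ! j"
      using less 3 by auto
    ultimately have "ys ! i = xs ! j \<or> ys ! i = xs ! i"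
      using neighbour_in_cycle[of xs "Suc j" "ys ! i"] 3 less.prems assms(1,3) by auto
    moreover have "ys ! i \<noteq> ys ! j"
      using 3 less.prems assms(2) by (simp add: nth_eq_iff_index_eq)
    ultimately show ?thesis using IH by auto
  qed (use start in auto)
qed

lemma rotate_cycle_to_edge:
  assumes "distinct xs" "length xs \<ge> 3" "{a, b} \<in> cycle_edges xs"
  obtains zs where "distinct zs" "length zs = length xs" "set zs = set xs"
    "cycle_edges zs = cycle_edges xs" "zs ! 0 = a" "zs ! 1 = b"
proof -
  note result = that
  have *: thesis if d: "distinct ws" and l: "length ws = length xs" and s: "set ws = set xs"
      and e: "cycle_edges ws = cycle_edges xs"
      and i: "i < length ws" "a = ws ! i" "b = ws ! (Suc i mod length ws)" for ws i
  proof (rule result[of "rotate i ws"])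
    have "length ws \<ge> 3" using l assms by simp
    then show "cycle_edges (rotate i ws) = cycle_edges xs"
      using e d by (simp add: cycle_edges_rotate)
    have "0 < length ws" "1 < length ws" using \<open>length ws \<ge> 3\<close> by auto
    from nth_rotate[OF this(1)] nth_rotate[OF this(2)]
    show "rotate i ws ! 0 = a" "rotate i ws ! 1 = b"
      using i by auto
  qed (use d l s in auto)
  obtain i where i: "i < length xs" "{a, b} = {xs ! i, xs ! (Suc i mod length xs)}"
    using assms(3) by (auto simp: cycle_edges_def)
  then consider "a = xs ! i" "b = xs ! (Suc i mod length xs)"
    | "b = xs ! i" "a = xs ! (Suc i mod length xs)"
    by (auto simp: doubleton_eq_iff)
  then show thesis
  proof cases
    case 1
    then show ?thesis using *[of xs i] i assms by simp
  next
    case 2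
    \<comment> \<open>In \<open>rev xs\<close> the index \<open>j\<close> holds \<open>a\<close> and
      its cyclic successor holds \<open>b\<close>: reversal exchanges the direction in which the
      edge is traversed.\<close>
    define j where "j = length xs - Suc (Suc i mod length xs)"
    have lt: "Suc i mod length xs < length xs" using i(1) by (auto intro!: mod_less_divisor)
    have j: "j < length xs" using lt by (auto simp: j_def)
    have 3: "rev xs ! j = a" using 2 lt j by (auto simp: rev_nth j_def Suc_diff_Suc)
    have "length xs - Suc (Suc j mod length xs) = i"
    proof (cases "Suc i = length xs")
      case True
      then have "Suc j = length xs" using assms(2) by (simp add: j_def)
      with True show ?thesis by simp
    next
      case False
      then have "Suc i < length xs" using i by simp
      then have "j = length xs - Suc (Suc i)" by (simp add: j_def)
      with \<open>Suc i < length xs\<close> show ?thesis by auto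
    qed
    moreover have "Suc j mod length xs < length xs" using j by (auto intro!: mod_less_divisor)
    ultimately have "rev xs ! (Suc j mod length xs) = b" using 2 by (simp add: rev_nth)
    then show ?thesis using *[of "rev xs" j] 3 j assms by (simp add: cycle_edges_rev)
  qed
qed

lemma cycle_edges_first: "length ys \<ge> 3 \<Longrightarrow> {ys ! 0, ys ! 1} \<in> cycle_edges ys"
  using cycle_edges_Suc_mem[of 0 ys] by simp

text \<open>Started along a common edge, both lists agree as long as \<open>ys\<close> lasts. If
  \<open>ys\<close> ended early, its closing edge would be a chord of the longer cycle: it joins
  vertex 0 to the vertex with index \<open>length ys - 1\<close>, at least 2, whose neighbours there
  have the two adjacent indices, neither of them 0.\<close>

lemma cycle_subset_cycle_eq:
  assumes "distinct xs" "length xs \<ge> 3" "distinct ys" "length ys \<ge> 3"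
    and sub: "cycle_edges ys \<subseteq> cycle_edges xs"
  shows "cycle_edges ys = cycle_edges xs"
proof -
  have le: "length ys \<le> length xs"
    using card_mono[OF finite_cycle_edges sub] assms by (simp add: card_cycle_edges)
  have "{ys ! 0, ys ! 1} \<in> cycle_edges xs"
    using cycle_edges_first assms(4) sub by blast
  then obtain zs where zs: "distinct zs" "length zs = length xs"
    "cycle_edges zs = cycle_edges xs" "zs ! 0 = ys ! 0" "zs ! 1 = ys ! 1"
    using rotate_cycle_to_edge[OF assms(1,2)] by metis
  have eq: "ys ! i = zs ! i" if "i < length ys" for i
    using cycle_prefix_unique[of zs ys i] zs assms le that by auto
  show ?thesis
  proof (cases "length ys = length xs")
    case True
    then have "ys = zs" using eq zs by (intro nth_equalityI) auto
    then show ?thesis using zs by simp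
  next
    case False
    define k where "k = length ys - 1"
    have k: "k < length ys" "Suc k < length zs" "k \<ge> 1" "k \<ge> 2" "Suc k = length ys"
      using le False zs assms(4) by (auto simp: k_def)
    have "{ys ! k, ys ! (Suc k mod length ys)} \<in> cycle_edges ys"
      using k(1) by (auto simp: cycle_edges_def)
    then have "{zs ! k, zs ! 0} \<in> cycle_edges zs"
      using sub zs k eq by auto
    then have "zs ! 0 = zs ! (k - 1) \<or> zs ! 0 = zs ! Suc k"
      using neighbour_in_cycle[of zs k "zs ! 0"] zs k by auto
    then have "0 = k - 1 \<or> 0 = Suc k"
      using nth_eq_iff_index_eq[OF zs(1)] k by (metis diff_less_Suc less_trans Suc_lessD zero_less_Suc)
    then show ?thesis using k by auto
  qed
qed

text \<open>Reading off the first two entries is a bijection from the lists of the cycle to its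
  oriented edges, and each of the \<open>length xs\<close> edges has two orientations.\<close>

lemma card_cycle_representations:
  assumes "distinct xs" "length xs \<ge> 3"
  shows "card {ys. length ys = length xs \<and> distinct ys \<and> cycle_edges ys = cycle_edges xs} = 2 * length xs"
proof -
  let ?F = "{ys. length ys = length xs \<and> distinct ys \<and> cycle_edges ys = cycle_edges xs}"
  let ?P = "{(a, b). {a, b} \<in> cycle_edges xs}"
  have "bij_betw (\<lambda>ys. (ys ! 0, ys ! 1)) ?F ?P"
    unfolding bij_betw_def
  proof (intro conjI inj_onI equalityI subsetI)
    fix ys zs assume "ys \<in> ?F" "zs \<in> ?F" and eq: "(ys ! 0, ys ! 1) = (zs ! 0, zs ! 1)"
    then show "ys = zs"
      using cycle_prefix_unique[of zs ys] assms by (intro nth_equalityI) auto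
  next
    fix p assume "p \<in> (\<lambda>ys. (ys ! 0, ys ! 1)) ` ?F"
    then obtain ys where "ys \<in> ?F" "p = (ys ! 0, ys ! 1)" by auto
    with cycle_edges_first[of ys] assms show "p \<in> ?P" by auto
  next
    fix p assume "p \<in> ?P"
    then obtain a b where "p = (a, b)" "{a, b} \<in> cycle_edges xs" by auto
    then show "p \<in> (\<lambda>ys. (ys ! 0, ys ! 1)) ` ?F"
      using rotate_cycle_to_edge[OF assms, of a b] by (smt (verit) image_eqI mem_Collect_eq)
  qed
  then have "card ?F = card ?P" by (rule bij_betw_same_card)
  also have "?P = (\<Union>e\<in>cycle_edges xs. {(a, b). {a, b} = e})" by auto
  also have "card \<dots> = (\<Sum>e\<in>cycle_edges xs. card {(a, b). {a, b} = e})"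
  proof (rule card_UN_disjoint)
    show "\<forall>e\<in>cycle_edges xs. finite {(a, b). {a, b} = e}"
    proof
      fix e assume "e \<in> cycle_edges xs"
      then have "finite e" by (auto simp: cycle_edges_def)
      then show "finite {(a, b). {a, b} = e}"
        by (rule_tac finite_subset[of _ "e \<times> e"]) auto
    qed
  qed auto
  also have "\<dots> = (\<Sum>e\<in>cycle_edges xs. 2)"
  proof (rule sum.cong)
    fix e assume "e \<in> cycle_edges xs"
    then have "card e = 2" using assms card_edge_of_cycle by blast
    then obtain a b where ab: "e = {a, b}" "a \<noteq> b" by (auto simp: card_2_iff)
    then have "{(x, y). {x, y} = e} = {(a, b), (b, a)}" by (auto simp: doubleton_eq_iff)
    then show "card {(a, b). {a, b} = e} = 2" using ab by simp
  qed simp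
  finally show ?thesis using assms by (simp add: card_cycle_edges)
qed

lemma finite_lists_distinct: "finite V \<Longrightarrow> finite {xs. length xs = l \<and> distinct xs \<and> set xs \<subseteq> V}"
  by (rule finite_subset[OF _ finite_lists_length_eq[of V l]]) auto

lemma finite_cycles: "finite V \<Longrightarrow> finite (cycles V l)"
  by (simp add: cycles_def finite_lists_distinct)

lemma cyclesE:
  assumes "c \<in> cycles V l" "l \<ge> 3"
  obtains xs where "distinct xs" "length xs = l" "set xs \<subseteq> V" "c = cycle_edges xs"
    "\<Union>c = set xs" "card c = l"
  using assms by (auto simp: cycles_def Union_cycle_edges card_cycle_edges)

text \<open>Double counting: the right-hand side is the number of distinct vertex lists of length
  \<open>l\<close>, and every cycle is traced by 2 * l of them.\<close>

lemma card_cycles: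
  assumes "finite V" "l \<ge> 3" "l \<le> card V"
  shows "2 * l * card (cycles V l) = \<Prod>{card V - l + 1 .. card V}"
proof -
  let ?X = "{xs. length xs = l \<and> distinct xs \<and> set xs \<subseteq> V}"
  have "card ?X = card (\<Union>c\<in>cycles V l. {xs \<in> ?X. cycle_edges xs = c})"
    by (rule arg_cong[where f=card]) (auto simp: cycles_def)
  also have "\<dots> = (\<Sum>c\<in>cycles V l. card {xs \<in> ?X. cycle_edges xs = c})"
    using assms by (intro card_UN_disjoint)
      (auto simp: finite_cycles intro!: finite_subset[OF _ finite_lists_distinct[of V l]])
  also have "\<dots> = (\<Sum>c\<in>cycles V l. 2 * l)"
  proof (rule sum.cong)
    fix c assume "c \<in> cycles V l"
    then obtain xs where xs: "distinct xs" "length xs = l" "set xs \<subseteq> V" "c = cycle_edges xs"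
      using assms by (auto elim: cyclesE)
    have "set ys \<subseteq> V" if "cycle_edges ys = cycle_edges xs" for ys
      using that xs(3) Union_cycle_edges[of xs] Union_cycle_edges[of ys] by simp
    then have "{ys \<in> ?X. cycle_edges ys = c} =
        {ys. length ys = length xs \<and> distinct ys \<and> cycle_edges ys = cycle_edges xs}"
      using xs(2,4) by auto
    then show "card {ys \<in> ?X. cycle_edges ys = c} = 2 * l"
      using card_cycle_representations[OF xs(1)] xs assms by simp
  qed simp
  finally show ?thesis
    using card_lists_distinct_length_eq[OF assms(1,3)] by (simp add: mult.commute)
qed

lemma prod_spins_cycle:
  fixes \<sigma> :: "'a \<Rightarrow> real"
  assumes "distinct xs" "length xs \<ge> 3" "\<And>x. x \<in> set xs \<Longrightarrow> \<sigma> x \<in> {-1, 1}"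
  shows "(\<Prod>e\<in>cycle_edges xs. \<Prod>u\<in>e. \<sigma> u) = 1"
proof -
  let ?l = "length xs"
  have "(\<Prod>e\<in>cycle_edges xs. \<Prod>u\<in>e. \<sigma> u) = (\<Prod>i<?l. \<Prod>u\<in>{xs ! i, xs ! (Suc i mod ?l)}. \<sigma> u)"
    unfolding cycle_edges_def using inj_on_cycle_edge[OF assms(1,2)] by (simp add: prod.reindex)
  also have "\<dots> = (\<Prod>i<?l. \<sigma> (xs ! i) * \<sigma> (xs ! (Suc i mod ?l)))"
  proof (rule prod.cong)
    fix i assume "i \<in> {..<?l}"
    then have "{xs ! i, xs ! (Suc i mod ?l)} \<in> cycle_edges xs" by (auto simp: cycle_edges_def)
    then have "card {xs ! i, xs ! (Suc i mod ?l)} = 2" by (rule card_edge_of_cycle[OF assms(1,2)])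
    then have "xs ! i \<noteq> xs ! (Suc i mod ?l)" by (intro notI) simp
    then show "(\<Prod>u\<in>{xs ! i, xs ! (Suc i mod ?l)}. \<sigma> u) = \<sigma> (xs ! i) * \<sigma> (xs ! (Suc i mod ?l))"
      by simp
  qed simp
  also have "\<dots> = (\<Prod>i<?l. \<sigma> (xs ! i)) * (\<Prod>i<?l. \<sigma> (xs ! (Suc i mod ?l)))"
    by (rule prod.distrib)
  \<comment> \<open>The second endpoints are the vertices in rotated order, so every vertex occurs
    once as a first and once as a second endpoint and its spin is squared.\<close>
  also have "(\<Prod>i<?l. \<sigma> (xs ! (Suc i mod ?l))) = (\<Prod>i<?l. \<sigma> (rotate1 xs ! i))"
    by (rule prod.cong) (auto simp: nth_rotate1)
  also have "\<dots> = prod \<sigma> (set xs)"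
    using assms(1) by (intro prod.reindex_bij_betw bij_betw_nth) auto
  also have "(\<Prod>i<?l. \<sigma> (xs ! i)) = prod \<sigma> (set xs)"
    using assms(1) by (intro prod.reindex_bij_betw bij_betw_nth) auto
  also have "prod \<sigma> (set xs) * prod \<sigma> (set xs) = (\<Prod>x\<in>set xs. \<sigma> x * \<sigma> x)"
    by (rule prod.distrib[symmetric])
  also have "\<dots> = 1"
    by (intro prod.neutral ballI) (use assms(3) in force)
  finally show ?thesis .
qed

text \<open>Sending each vertex of \<open>U\<close> to the edge that leaves it in cyclic direction
  is injective. If \<open>U\<close> is a nonempty proper part of the cycle, the cycle enters
  \<open>U\<close> somewhere; the entering edge leaves a vertex outside \<open>U\<close> and is one
  more. This surplus of edges over vertices is where later factors \<open>p\<close> are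
  gained.\<close>

lemma card_vertices_le_edges:
  assumes "distinct xs" "length xs \<ge> 3" "U \<subseteq> set xs"
  shows "card U \<le> card {e \<in> cycle_edges xs. e \<inter> U \<noteq> {}}"
    and "U \<noteq> {} \<Longrightarrow> U \<noteq> set xs \<Longrightarrow> Suc (card U) \<le> card {e \<in> cycle_edges xs. e \<inter> U \<noteq> {}}"
proof -
  let ?l = "length xs"
  let ?e = "\<lambda>i. {xs ! i, xs ! (Suc i mod ?l)}"
  define J where "J = {i. i < ?l \<and> xs ! i \<in> U}"
  have U: "U = (!) xs ` J"
  proof
    show "U \<subseteq> (!) xs ` J"
    proof
      fix x assume "x \<in> U"
      then obtain i where "i < ?l" "x = xs ! i" using assms(3) by (metis in_set_conv_nth subsetD)
      with \<open>x \<in> U\<close> show "x \<in> (!) xs ` J" by (auto simp: J_def)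
    qed
  qed (auto simp: J_def)
  have cU: "card U = card J"
    unfolding U by (rule card_image) (auto simp: inj_on_def J_def nth_eq_iff_index_eq assms(1))
  have inj: "inj_on ?e {..<?l}" by (rule inj_on_cycle_edge[OF assms(1,2)])
  have fin: "finite {e \<in> cycle_edges xs. e \<inter> U \<noteq> {}}" by simp
  have "card J = card (?e ` J)"
    by (rule card_image[symmetric], rule inj_on_subset[OF inj]) (auto simp: J_def)
  also have "\<dots> \<le> card {e \<in> cycle_edges xs. e \<inter> U \<noteq> {}}"
    by (rule card_mono[OF fin]) (auto simp: J_def cycle_edges_def)
  finally show "card U \<le> card {e \<in> cycle_edges xs. e \<inter> U \<noteq> {}}" using cU by simp
  assume ne: "U \<noteq> {}" "U \<noteq> set xs"
  \<comment> \<open>Otherwise a walk started outside \<open>U\<close> would stay outside forever,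
    although it visits the whole cycle.\<close>
  have "\<exists>i<?l. xs ! i \<notin> U \<and> xs ! (Suc i mod ?l) \<in> U"
  proof (rule ccontr)
    assume "\<not> ?thesis"
    then have step: "xs ! i \<notin> U \<Longrightarrow> i < ?l \<Longrightarrow> xs ! (Suc i mod ?l) \<notin> U" for i by blast
    obtain k where k: "k < ?l" "xs ! k \<notin> U"
      using ne(2) assms(3) by (metis in_set_conv_nth subsetI subset_antisym)
    have all: "xs ! ((k + j) mod ?l) \<notin> U" for j
    proof (induction j)
      case (Suc j)
      have "(k + j) mod ?l < ?l" using k(1) by (intro mod_less_divisor) auto
      from step[OF Suc this] show ?case by (simp add: mod_simps)
    qed (use k in auto)
    obtain i where i: "i < ?l" "xs ! i \<in> U" 
      using ne(1) assms(3) by (metis in_set_conv_nth subsetD ex_in_conv)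
    have "k + (?l - k + i) = i + ?l" using k(1) by simp
    then have "(k + (?l - k + i)) mod ?l = i" using i(1) by (metis mod_add_self2 mod_less)
    with all[of "?l - k + i"] have "xs ! i \<notin> U" by (simp only: not_False_eq_True)
    with i(2) show False by contradiction
  qed
  then obtain i where i: "i < ?l" "xs ! i \<notin> U" "xs ! (Suc i mod ?l) \<in> U" by blast
  have fJ: "finite J" "i \<notin> J" using i by (auto simp: J_def)
  then have "Suc (card J) = card (insert i J)" by simp
  also have "\<dots> = card (?e ` insert i J)"
    by (rule card_image[symmetric], rule inj_on_subset[OF inj]) (use i in \<open>auto simp: J_def\<close>)
  also have "\<dots> \<le> card {e \<in> cycle_edges xs. e \<inter> U \<noteq> {}}"
  proof (rule card_mono[OF fin], rule image_subsetI)
    fix j assume "j \<in> insert i J"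
    then have "j < ?l" "xs ! j \<in> U \<or> xs ! (Suc j mod ?l) \<in> U"
      using i by (auto simp: J_def)
    then show "?e j \<in> {e \<in> cycle_edges xs. e \<inter> U \<noteq> {}}"
      unfolding cycle_edges_def by blast
  qed
  finally show "Suc (card U) \<le> card {e \<in> cycle_edges xs. e \<inter> U \<noteq> {}}" using cU by simp
qed

text \<open>Consecutive edges share a vertex, and a vertex is covered by at most one member of
  \<open>F\<close>; so the member containing the current edge cannot change along the cycle.\<close>

lemma cycle_subset_disjoint_family:
  assumes "length xs \<ge> 3" "cycle_edges xs \<subseteq> \<Union>F"
    and disj: "\<And>a b. a \<in> F \<Longrightarrow> b \<in> F \<Longrightarrow> a \<noteq> b \<Longrightarrow> \<Union>a \<inter> \<Union>b = {}"
  shows "\<exists>a\<in>F. cycle_edges xs \<subseteq> a"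
proof -
  let ?l = "length xs"
  have "?l > 0" using assms(1) by linarith
  have edge: "{xs ! i, xs ! (Suc i mod ?l)} \<in> \<Union>F" if "i < ?l" for i
    using assms(2) that by (auto simp: cycle_edges_def)
  obtain a where a: "a \<in> F" "{xs ! 0, xs ! (Suc 0 mod ?l)} \<in> a"
    using edge[OF \<open>?l > 0\<close>] by auto
  have "{xs ! i, xs ! (Suc i mod ?l)} \<in> a" if "i < ?l" for i
    using that
  proof (induction i)
    case (Suc i)
    then have *: "{xs ! i, xs ! Suc i} \<in> a" by simp
    obtain b where b: "b \<in> F" "{xs ! Suc i, xs ! (Suc (Suc i) mod ?l)} \<in> b"
      using edge[OF Suc.prems] by auto
    have "xs ! Suc i \<in> \<Union>a \<inter> \<Union>b" using * b by blast
    then have "a = b" using disj a b by blast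
    then show ?case using b by simp
  qed (use a in auto)
  then show ?thesis using a by (auto simp: cycle_edges_def)
qed

section \<open>Elementary symmetric sums\<close>

text \<open>The elementary symmetric polynomial of degree \<open>k\<close>. With \<open>f\<close>
  constantly 1 on the cycles of a graph it is the number of \<open>k\<close>-element sets of cycles,
  so its expectation is a factorial moment divided by k!.\<close>

definition esum :: "nat \<Rightarrow> ('b \<Rightarrow> 'c::comm_semiring_1) \<Rightarrow> 'b set \<Rightarrow> 'c" where
  "esum k f A = (\<Sum>F | F \<subseteq> A \<and> card F = k. prod f F)"

lemma finite_subsets_card: "finite A \<Longrightarrow> finite {F. F \<subseteq> A \<and> card F = k}"
  by (rule finite_subset[of _ "Pow A"]) auto

lemma esum_0: "finite A \<Longrightarrow> esum 0 f A = 1"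
proof -
  assume "finite A"
  then have "{F. F \<subseteq> A \<and> card F = 0} = {{}}" by (auto simp: card_eq_0_iff dest: finite_subset)
  then show ?thesis by (simp only: esum_def) simp
qed

lemma subsets_card_insert:
  assumes "finite A" "x \<notin> A"
  shows "{F. F \<subseteq> insert x A \<and> card F = Suc k} =
    {F. F \<subseteq> A \<and> card F = Suc k} \<union> insert x ` {F. F \<subseteq> A \<and> card F = k}"
proof (intro equalityI subsetI)
  fix F assume F: "F \<in> {F. F \<subseteq> insert x A \<and> card F = Suc k}"
  show "F \<in> {F. F \<subseteq> A \<and> card F = Suc k} \<union> insert x ` {F. F \<subseteq> A \<and> card F = k}"
  proof (cases "x \<in> F")
    case True
    then have "F = insert x (F - {x})" "F - {x} \<subseteq> A" "card (F - {x}) = k"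
      using F by auto
    then show ?thesis by blast
  qed (use F in auto)
next
  fix F assume "F \<in> {F. F \<subseteq> A \<and> card F = Suc k} \<union> insert x ` {F. F \<subseteq> A \<and> card F = k}"
  then show "F \<in> {F. F \<subseteq> insert x A \<and> card F = Suc k}"
  proof
    assume "F \<in> insert x ` {F. F \<subseteq> A \<and> card F = k}"
    then obtain F' where "F = insert x F'" "F' \<subseteq> A" "card F' = k" by blast
    moreover have "finite F'" "x \<notin> F'" using assms calculation finite_subset by blast+
    ultimately show ?thesis by auto
  qed auto
qed

lemma sum_subsets_card_insert:
  fixes g :: "'b set \<Rightarrow> 'c::comm_monoid_add"
  assumes "finite A" "x \<notin> A"
  shows "(\<Sum>F | F \<subseteq> insert x A \<and> card F = Suc k. g F) =
    (\<Sum>F | F \<subseteq> A \<and> card F = Suc k. g F) + (\<Sum>F | F \<subseteq> A \<and> card F = k. g (insert x F))"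
proof -
  have "inj_on (insert x) {F. F \<subseteq> A \<and> card F = k}"
  proof (rule inj_onI)
    fix F G assume "F \<in> {F. F \<subseteq> A \<and> card F = k}" "G \<in> {F. F \<subseteq> A \<and> card F = k}"
      and eq: "insert x F = insert x G"
    then have "x \<notin> F" "x \<notin> G" using assms(2) by auto
    then show "F = G" using eq by (simp add: insert_ident)
  qed
  then show ?thesis
    unfolding subsets_card_insert[OF assms] using assms
    by (subst sum.union_disjoint) (auto simp: finite_subsets_card sum.reindex)
qed

lemma esum_insert:
  assumes "finite A" "x \<notin> A"
  shows "esum (Suc k) f (insert x A) = esum (Suc k) f A + f x * esum k f A"
proof -
  have "prod f (insert x F) = f x * prod f F" if "F \<subseteq> A" for F
    using assms that by (subst prod.insert) (auto dest: finite_subset)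
  then show ?thesis
    unfolding esum_def sum_subsets_card_insert[OF assms] sum_distrib_left
    by (intro arg_cong2[where f="(+)"] sum.cong) auto
qed

lemma esum_empty: "esum (Suc k) f {} = 0"
  unfolding esum_def by (intro sum.neutral) auto

lemma esum_1: "finite A \<Longrightarrow> esum (Suc 0) f A = sum f A"
  by (induction A rule: finite_induct) (auto simp: esum_empty esum_insert esum_0 add.commute)

text \<open>A Bonferroni inequality for factors in the unit disc, meant for complex numbers of
  modulus 1. With \<open>R r A\<close> for the remainder, adding \<open>x\<close> gives
  \<open>R (Suc j) (insert x A) = R (Suc j) A + f x * R j A\<close>, the recursion of
  \<open>esum\<close> itself, so norms can be taken throughout; the unit disc enters at
  \<open>r = 0\<close>.\<close>

lemma prod_trunc_le_esum:
  fixes f :: "'b \<Rightarrow> 'c::{real_normed_field}"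
  assumes "finite A" "\<And>x. x \<in> A \<Longrightarrow> norm (1 + f x) \<le> 1"
  shows "norm ((\<Prod>x\<in>A. 1 + f x) - (\<Sum>k<r. esum k f A)) \<le> esum r (\<lambda>x. norm (f x)) A"
  using assms
proof (induction A arbitrary: r rule: finite_induct)
  case empty
  then show ?case
    by (cases r) (simp_all add: sum.lessThan_Suc_shift esum_0 esum_empty del: sum.lessThan_Suc)
next
  case (insert x A)
  show ?case
  proof (cases r)
    case 0
    have "norm (\<Prod>x\<in>insert x A. 1 + f x) \<le> 1"
      unfolding prod_norm[symmetric] using insert.prems by (intro prod_le_1) auto
    then show ?thesis using 0 insert.hyps by (simp add: esum_0)
  next
    case (Suc j)
    let ?P = "\<Prod>x\<in>A. 1 + f x"
    have "(\<Sum>k<Suc j. esum k f (insert x A)) = 1 + (\<Sum>k<j. esum (Suc k) f A + f x * esum k f A)"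
      using insert.hyps by (simp add: sum.lessThan_Suc_shift esum_0 esum_insert del: sum.lessThan_Suc)
    also have "\<dots> = (\<Sum>k<Suc j. esum k f A) + f x * (\<Sum>k<j. esum k f A)"
      using insert.hyps by (simp add: sum.lessThan_Suc_shift esum_0 sum.distrib sum_distrib_left del: sum.lessThan_Suc)
    finally have "(\<Prod>x\<in>insert x A. 1 + f x) - (\<Sum>k<r. esum k f (insert x A)) =
        (?P - (\<Sum>k<Suc j. esum k f A)) + f x * (?P - (\<Sum>k<j. esum k f A))"
      using insert.hyps Suc by (simp add: algebra_simps)
    also have "norm \<dots> \<le> norm (?P - (\<Sum>k<Suc j. esum k f A)) + norm (f x) * norm (?P - (\<Sum>k<j. esum k f A))"
      by (rule order_trans[OF norm_triangle_ineq]) (simp only: norm_mult order_refl)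
    also have "\<dots> \<le> esum (Suc j) (\<lambda>x. norm (f x)) A + norm (f x) * esum j (\<lambda>x. norm (f x)) A"
      by (intro add_mono mult_left_mono insert.IH) (use insert.prems in auto)
    finally show ?thesis using Suc insert.hyps by (simp add: esum_insert)
  qed
qed

text \<open>Second-order Taylor remainder of a power, controlled by the recursion D(n + 1) = (s + z)
  * D(n) + (n + 2) * z^2 * s^(n + 1). The crude factor \<open>fact (n + 2)\<close> is harmless: it
  cancels when the power is divided by the same factorial.\<close>

lemma norm_power_second_order:
  fixes s z :: "'c::real_normed_field"
  shows "norm ((s + z) ^ (n + 2) - s ^ (n + 2) - of_nat (n + 2) * z * s ^ (n + 1))
    \<le> fact (n + 2) * (norm z)\<^sup>2 * (norm s + norm z) ^ n"
proof (induction n)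
  case 0
  have "(s + z) ^ (0 + 2) - s ^ (0 + 2) - of_nat (0 + 2) * z * s ^ (0 + 1) = z\<^sup>2"
    by (simp add: power2_eq_square algebra_simps)
  then show ?case by (simp only:) (simp add: norm_power)
next
  case (Suc n)
  let ?D = "(s + z) ^ (n + 2) - s ^ (n + 2) - of_nat (n + 2) * z * s ^ (n + 1)"
  let ?w = "norm s + norm z"
  have "(s + z) ^ (Suc n + 2) - s ^ (Suc n + 2) - of_nat (Suc n + 2) * z * s ^ (Suc n + 1)
      = (s + z) * ?D + of_nat (n + 2) * z\<^sup>2 * s ^ Suc n"
    by (simp add: power2_eq_square algebra_simps)
  also have "norm \<dots> \<le> norm (s + z) * norm ?D + real (n + 2) * (norm z)\<^sup>2 * norm s ^ Suc n"
    by (rule order_trans[OF norm_triangle_ineq])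
      (simp only: norm_mult norm_of_nat norm_power order_refl)
  also have "\<dots> \<le> ?w * (fact (n + 2) * (norm z)\<^sup>2 * ?w ^ n) + real (n + 2) * (norm z)\<^sup>2 * ?w ^ Suc n"
    using Suc by (intro add_mono mult_mono norm_triangle_ineq power_mono) auto
  also have "\<dots> = (fact (n + 2) + real (n + 2)) * ((norm z)\<^sup>2 * ?w ^ Suc n)"
    by (simp add: algebra_simps)
  also have "\<dots> \<le> fact (Suc n + 2) * ((norm z)\<^sup>2 * ?w ^ Suc n)"
  proof (intro mult_right_mono)
    have "(1::real) \<le> fact (n + 2)" by (rule fact_ge_1)
    then have "real (n + 2) * 1 \<le> real (n + 2) * fact (n + 2)" by (intro mult_left_mono) auto
    moreover have "fact (Suc n + 2) = (real (n + 2) + 1) * fact (n + 2)"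
      using fact_Suc[of "n + 2", where 'a = real] by (simp del: fact_Suc)
    ultimately show "fact (n + 2) + real (n + 2) \<le> fact (Suc n + 2)"
      by (simp add: distrib_right del: fact_Suc of_nat_add)
  qed auto
  finally show ?case by (simp add: algebra_simps)
qed

text \<open>Expanding the power, every product of \<open>k\<close> distinct entries occurs k! times,
  so the difference consists of products with a repeated entry, from which one squared norm is split
  off. For \<open>k\<close> at most 1 the difference is zero, so the truncated exponent
  \<open>k - 2\<close> does no harm.\<close>

lemma esum_approx_power:
  fixes f :: "'b \<Rightarrow> 'c::real_normed_field"
  assumes "finite A"
  shows "norm (esum k f A - sum f A ^ k / fact k)
    \<le> (\<Sum>x\<in>A. (norm (f x))\<^sup>2) * (\<Sum>x\<in>A. norm (f x)) ^ (k - 2)"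
  using assms
proof (induction A arbitrary: k rule: finite_induct)
  case empty
  then show ?case by (cases k) (auto simp: esum_0 esum_empty)
next
  case (insert x A)
  consider "k = 0" | "k = 1" | j where "k = j + 2"
    by (metis add_2_eq_Suc' One_nat_def old.nat.exhaust)
  then show ?case
  proof cases
    case 1
    then show ?thesis using insert.hyps by (simp add: esum_0 sum_nonneg)
  next
    case 2
    then show ?thesis using insert.hyps by (simp add: esum_1 sum_nonneg del: One_nat_def)
        (simp add: esum_1 sum_nonneg)
  next
    case 3
    let ?s = "sum f A" and ?z = "f x"
    let ?Q = "\<Sum>x\<in>A. (norm (f x))\<^sup>2" and ?S = "\<Sum>x\<in>A. norm (f x)"
    have nn: "?Q \<ge> 0" "?S \<ge> 0" by (auto intro: sum_nonneg)
    have sS: "norm ?s \<le> ?S" by (rule norm_sum)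
    let ?R = "(?s + ?z) ^ (j + 2) - ?s ^ (j + 2) - of_nat (j + 2) * ?z * ?s ^ (j + 1)"
    have f2: "fact (j + 2) = of_nat (j + 2) * (fact (j + 1) :: 'c)" by simp
    have ne: "(fact (j + 1) :: 'c) \<noteq> 0" "(of_nat (j + 2) :: 'c) \<noteq> 0"
      by (simp_all del: of_nat_add of_nat_Suc fact_Suc)
    \<comment> \<open>Adding \<open>x\<close> turns the error of order \<open>j + 2\<close> into
      \<open>a + ?z * b - r\<close>: the errors of orders \<open>j + 2\<close> and
      \<open>j + 1\<close> on \<open>A\<close>, and the Taylor remainder of the power.\<close>
    define a where "a = esum (j + 2) f A - ?s ^ (j + 2) / fact (j + 2)"
    define b where "b = esum (j + 1) f A - ?s ^ (j + 1) / fact (j + 1)"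
    define r where "r = ?R / fact (j + 2)"
    have "?z * ?s ^ (j + 1) / fact (j + 1) = of_nat (j + 2) * ?z * ?s ^ (j + 1) / fact (j + 2)"
      unfolding f2 using ne by (simp del: of_nat_add of_nat_Suc fact_Suc)
    then have eq: "esum (j + 2) f (insert x A) - (?s + ?z) ^ (j + 2) / fact (j + 2) = a + ?z * b - r"
      using esum_insert[OF insert.hyps(1,2), of "j + 1" f]
      by (simp add: a_def b_def r_def diff_divide_distrib right_diff_distrib
          del: fact_Suc power_Suc of_nat_add of_nat_Suc)
    have ab: "norm a + norm ?z * norm b \<le> ?Q * (?S + norm ?z) ^ j"
    proof (cases j)
      case 0
      then show ?thesis using insert.IH[of "Suc (Suc 0)"] insert.hyps by (simp add: a_def b_def esum_1)
    next
      case (Suc i)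
      have a: "norm a \<le> ?Q * ?S ^ j" and b: "norm b \<le> ?Q * ?S ^ i"
        using insert.IH[of "j + 2"] insert.IH[of "j + 1"] Suc
        by (simp_all add: a_def b_def del: fact_Suc power_Suc)
      have "norm a + norm ?z * norm b \<le> ?Q * ?S ^ j + norm ?z * (?Q * ?S ^ i)"
        by (intro add_mono mult_left_mono a b) auto
      also have "\<dots> = ?Q * (?S ^ i * (?S + norm ?z))" by (simp add: Suc algebra_simps)
      also have "\<dots> \<le> ?Q * ((?S + norm ?z) ^ i * (?S + norm ?z))"
        using nn by (intro mult_left_mono mult_right_mono power_mono) auto
      finally show ?thesis by (simp add: Suc mult.commute)
    qed
    have "norm ?R \<le> fact (j + 2) * (norm ?z)\<^sup>2 * (norm ?s + norm ?z) ^ j"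
      by (rule norm_power_second_order)
    also have "\<dots> \<le> fact (j + 2) * (norm ?z)\<^sup>2 * (?S + norm ?z) ^ j"
      using sS by (intro mult_left_mono power_mono add_mono) auto
    finally have "norm ?R \<le> fact (j + 2) * ((norm ?z)\<^sup>2 * (?S + norm ?z) ^ j)"
      by (simp only: mult.assoc)
    moreover have "norm r = norm ?R / fact (j + 2)"
      unfolding r_def norm_divide by (simp only: norm_fact)
    ultimately have r: "norm r \<le> (norm ?z)\<^sup>2 * (?S + norm ?z) ^ j"
      by (simp add: pos_divide_le_eq mult.commute del: fact_Suc)
    have "norm (a + ?z * b - r) \<le> norm a + norm ?z * norm b + norm r"
      by (metis (no_types) add_right_mono norm_mult norm_triangle_ineq norm_triangle_ineq4 order_trans)
    also have "\<dots> \<le> ?Q * (?S + norm ?z) ^ j + (norm ?z)\<^sup>2 * (?S + norm ?z) ^ j"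
      by (rule add_mono[OF ab r])
    finally have "norm (a + ?z * b - r) \<le> (?Q + (norm ?z)\<^sup>2) * (?S + norm ?z) ^ j"
      by (simp only: distrib_right)
    then show ?thesis
      unfolding eq[symmetric] using 3 insert.hyps
      by (simp add: add.commute del: fact_Suc power_Suc)
  qed
qed

section \<open>The uniform random graph\<close>

definition all_edges :: "nat \<Rightarrow> nat set set" where
  "all_edges n = {e. e \<subseteq> {1..n} \<and> card e = 2}"

lemma finite_all_edges [simp]: "finite (all_edges n)"
  by (rule finite_subset[of _ "Pow {1..n}"]) (auto simp: all_edges_def)

lemma card_all_edges: "card (all_edges n) = n choose 2"
  using n_subsets[of "{1..n}" 2] by (simp add: all_edges_def)

lemma graphs_nm_eq: "graphs_nm n m = Pair {1..n} ` {E. E \<subseteq> all_edges n \<and> card E = m}"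
proof (intro equalityI subsetI)
  fix G assume "G \<in> graphs_nm n m"
  then have G: "\<forall>e\<in>snd G. e \<subseteq> fst G \<and> card e = 2" "fst G = {1..n}" "card (snd G) = m"
    unfolding graphs_nm_def simple_graph_def by blast+
  then have "snd G \<subseteq> all_edges n" unfolding all_edges_def by blast
  moreover have "G = ({1..n}, snd G)" using G(2) by (metis prod.collapse)
  ultimately show "G \<in> Pair {1..n} ` {E. E \<subseteq> all_edges n \<and> card E = m}" using G(3) by blast
next
  fix G assume "G \<in> Pair {1..n} ` {E. E \<subseteq> all_edges n \<and> card E = m}"
  then obtain E where E: "G = ({1..n}, E)" "E \<subseteq> all_edges n" "card E = m" by blast
  have "e \<subseteq> {1..n} \<and> card e = 2" if "e \<in> E" for e
    using subsetD[OF E(2) that] by (simp only: all_edges_def mem_Collect_eq)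
  then show "G \<in> graphs_nm n m"
    using E(1,3) by (simp add: graphs_nm_def simple_graph_def)
qed

lemma finite_graphs_nm: "finite (graphs_nm n m)"
  unfolding graphs_nm_eq
  by (rule finite_imageI, rule finite_subset[of _ "Pow (all_edges n)"]) auto

lemma card_graphs_nm: "card (graphs_nm n m) = (n choose 2) choose m"
proof -
  have "inj_on (Pair {1..n}) {E. E \<subseteq> all_edges n \<and> card E = m}" by (rule inj_onI) simp
  then show ?thesis
    unfolding graphs_nm_eq by (simp only: card_image n_subsets[OF finite_all_edges] card_all_edges)
qed

lemma graphs_nm_nonempty: "m \<le> n choose 2 \<Longrightarrow> graphs_nm n m \<noteq> {}"
  by (metis card.empty card_graphs_nm binomial_eq_0_iff linorder_not_less)

lemma set_pmf_random_graph: "m \<le> n choose 2 \<Longrightarrow> set_pmf (random_graph n m) = graphs_nm n m"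
  unfolding random_graph_def by (simp add: finite_graphs_nm graphs_nm_nonempty)

text \<open>The probability that a uniform \<open>m\<close>-subset of an \<open>N\<close>-set
  contains \<open>j\<close> given elements, as a quotient of falling factorials. For
  \<open>j > m\<close> the factor with \<open>i = m\<close> is zero, so the formula covers this case
  too.\<close>

definition incl_prob :: "nat \<Rightarrow> nat \<Rightarrow> nat \<Rightarrow> real" where
  "incl_prob N m j = (\<Prod>i<j. (real m - real i) / (real N - real i))"

lemma card_supersets:
  assumes "finite K" "A \<subseteq> K" "card A \<le> m"
  shows "card {E. E \<subseteq> K \<and> card E = m \<and> A \<subseteq> E} = (card K - card A) choose (m - card A)"
proof -
  have fA: "finite A" using assms finite_subset by blast
  have "bij_betw (\<lambda>E. E - A) {E. E \<subseteq> K \<and> card E = m \<and> A \<subseteq> E} {D. D \<subseteq> K - A \<and> card D = m - card A}"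
  proof (rule bij_betw_byWitness[where f'="\<lambda>D. D \<union> A"])
    show "(\<lambda>E. E - A) ` {E. E \<subseteq> K \<and> card E = m \<and> A \<subseteq> E} \<subseteq> {D. D \<subseteq> K - A \<and> card D = m - card A}"
      using fA by (auto simp: card_Diff_subset)
    show "(\<lambda>D. D \<union> A) ` {D. D \<subseteq> K - A \<and> card D = m - card A} \<subseteq> {E. E \<subseteq> K \<and> card E = m \<and> A \<subseteq> E}"
    proof (rule image_subsetI)
      fix D assume D: "D \<in> {D. D \<subseteq> K - A \<and> card D = m - card A}"
      then have "finite D" "D \<inter> A = {}" using assms(1) by (auto dest: finite_subset)
      then have "card (D \<union> A) = m" using D assms(3) fA by (simp add: card_Un_disjoint)
      then show "D \<union> A \<in> {E. E \<subseteq> K \<and> card E = m \<and> A \<subseteq> E}" using D assms(2) by auto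
    qed
  qed auto
  then show ?thesis
    using assms fA by (simp add: bij_betw_same_card n_subsets card_Diff_subset)
qed

lemma binomial_ratio:
  assumes "m \<le> N" "j \<le> m"
  shows "real ((N - j) choose (m - j)) = incl_prob N m j * real (N choose m)"
  using assms(2)
proof (induction j)
  case (Suc j)
  then have j: "j < m" by simp
  \<comment> \<open>Absorption, k * C(n, k) = n * C(n - 1, k - 1), supplies the next factor of the
    quotient.\<close>
  have "real (Suc (m - Suc j)) * real (Suc (N - Suc j) choose Suc (m - Suc j)) =
      real (Suc (N - Suc j)) * real ((N - Suc j) choose (m - Suc j))"
    by (metis Suc_times_binomial of_nat_mult)
  then have "(real m - real j) * real ((N - j) choose (m - j)) =
      (real N - real j) * real ((N - Suc j) choose (m - Suc j))"
    using j assms(1) by (simp add: Suc_diff_Suc of_nat_diff)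
  moreover have "real N - real j > 0" using j assms(1) by simp
  ultimately have "real ((N - Suc j) choose (m - Suc j)) =
      (real m - real j) / (real N - real j) * real ((N - j) choose (m - j))"
    by (simp add: field_simps)
  then show ?case using Suc by (simp add: incl_prob_def)
qed (simp add: incl_prob_def)

lemma incl_prob_eq_0: "m < j \<Longrightarrow> incl_prob N m j = 0"
  unfolding incl_prob_def by (auto intro!: prod_zero)

lemma prob_subset_random_graph:
  assumes "m \<le> n choose 2" "A \<subseteq> all_edges n"
  shows "measure_pmf.prob (random_graph n m) {G. A \<subseteq> snd G} = incl_prob (n choose 2) m (card A)"
proof -
  have fA: "finite A" using assms(2) finite_subset finite_all_edges by blast
  have "graphs_nm n m \<inter> {G. A \<subseteq> snd G} = Pair {1..n} ` {E. E \<subseteq> all_edges n \<and> card E = m \<and> A \<subseteq> E}"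
    by (auto simp: graphs_nm_eq)
  then have "card (graphs_nm n m \<inter> {G. A \<subseteq> snd G}) = card {E. E \<subseteq> all_edges n \<and> card E = m \<and> A \<subseteq> E}"
    by (simp add: card_image inj_on_def)
  then have *: "measure_pmf.prob (random_graph n m) {G. A \<subseteq> snd G} =
      card {E. E \<subseteq> all_edges n \<and> card E = m \<and> A \<subseteq> E} / real ((n choose 2) choose m)"
    unfolding random_graph_def
    by (simp add: measure_pmf_of_set finite_graphs_nm graphs_nm_nonempty assms(1) card_graphs_nm)
  show ?thesis
  proof (cases "card A \<le> m")
    case True
    have "real ((n choose 2) choose m) > 0" using assms(1) by simp
    then show ?thesis
      unfolding * card_supersets[OF finite_all_edges assms(2) True] card_all_edges
        binomial_ratio[OF assms(1) True] by simp
  next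
    case False
    have "{E. E \<subseteq> all_edges n \<and> card E = m \<and> A \<subseteq> E} = {}"
    proof (rule ccontr)
      assume "\<not> ?thesis"
      then obtain E where "E \<subseteq> all_edges n" "card E = m" "A \<subseteq> E" by blast
      then show False using False card_mono[of E A] finite_subset[OF _ finite_all_edges] by auto
    qed
    then show ?thesis using False by (simp add: * incl_prob_eq_0)
  qed
qed

text \<open>Sampling without replacement is dominated by independent sampling factor by factor,
  since m \<le> N gives (m - i) / (N - i) \<le> m / N. For \<open>j > m\<close> single factors may
  be negative, but the product is zero.\<close>

lemma incl_prob_bounds:
  assumes "m \<le> N"
  shows "0 \<le> incl_prob N m j" "incl_prob N m j \<le> (real m / real N) ^ j"
proof -
  have "0 \<le> incl_prob N m j \<and> incl_prob N m j \<le> (real m / real N) ^ j"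
  proof (cases "j \<le> m")
    case True
    have b: "0 \<le> (real m - real i) / (real N - real i)"
      "(real m - real i) / (real N - real i) \<le> real m / real N" if "i < j" for i
    proof -
      have "real i < real m" "real m \<le> real N" using that True assms by auto
      moreover have "real i * real m \<le> real i * real N" using assms by (intro mult_left_mono) auto
      ultimately show "0 \<le> (real m - real i) / (real N - real i)"
        "(real m - real i) / (real N - real i) \<le> real m / real N"
        by (simp_all add: field_simps)
    qed
    have "incl_prob N m j \<le> (\<Prod>i<j. real m / real N)"
      unfolding incl_prob_def using b by (intro prod_mono) auto
    moreover have "0 \<le> incl_prob N m j"
      unfolding incl_prob_def using b by (intro prod_nonneg) auto
    ultimately show ?thesis by simp
  next
    case False
    then show ?thesis by (simp add: incl_prob_eq_0)
  qed
  then show "0 \<le> incl_prob N m j" "incl_prob N m j \<le> (real m / real N) ^ j" by auto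
qed

text \<open>For fixed \<open>j\<close> the two ways of sampling agree asymptotically: dividing out
  the densities leaves factors (1 - i / m) / (1 - i / N), which tend to 1.\<close>

lemma tendsto_incl_prob_ratio:
  fixes N m :: "nat \<Rightarrow> nat"
  assumes "filterlim (\<lambda>n. real (m n)) at_top sequentially" "filterlim (\<lambda>n. real (N n)) at_top sequentially"
  shows "(\<lambda>n. incl_prob (N n) (m n) j / (real (m n) / real (N n)) ^ j) \<longlonglongrightarrow> 1"
proof -
  have z: "(\<lambda>n. real i / real (N n)) \<longlonglongrightarrow> 0" "(\<lambda>n. real i / real (m n)) \<longlonglongrightarrow> 0" for i
    using assms by (auto intro!: tendsto_divide_0 tendsto_const filterlim_at_top_imp_at_infinity)
  have "(\<lambda>n. \<Prod>i<j. (1 - real i / real (m n)) / (1 - real i / real (N n))) \<longlonglongrightarrow> (\<Prod>i<j. (1 - 0) / (1 - 0))"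
    using z by (intro tendsto_prod tendsto_divide tendsto_diff tendsto_const) auto
  moreover have "eventually (\<lambda>n. real (m n) > real j \<and> real (N n) > real j) sequentially"
    using assms unfolding filterlim_at_top_dense by (intro eventually_conj) blast+
  then have "eventually (\<lambda>n. (\<Prod>i<j. (1 - real i / real (m n)) / (1 - real i / real (N n))) =
      incl_prob (N n) (m n) j / (real (m n) / real (N n)) ^ j) sequentially"
  proof eventually_elim
    case (elim n)
    have "(1 - real i / real (m n)) / (1 - real i / real (N n)) =
       ((real (m n) - real i) / (real (N n) - real i)) / (real (m n) / real (N n))" if "i < j" for i
      using elim that by (simp add: field_simps)
    then have "(\<Prod>i<j. (1 - real i / real (m n)) / (1 - real i / real (N n))) =
       (\<Prod>i<j. ((real (m n) - real i) / (real (N n) - real i)) / (real (m n) / real (N n)))"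
      by (intro prod.cong) auto
    also have "\<dots> = incl_prob (N n) (m n) j / (\<Prod>i<j. real (m n) / real (N n))"
      by (simp only: incl_prob_def prod_dividef)
    finally show ?case by (simp only: prod_constant card_lessThan)
  qed
  ultimately show ?thesis by (auto intro: Lim_transform_eventually)
qed

section \<open>Families of short cycles\<close>

definition short_cycles :: "'a set \<Rightarrow> nat \<Rightarrow> 'a set set set" where
  "short_cycles V L = (\<Union>l\<in>{3..L}. cycles V l)"

lemma finite_short_cycles: "finite V \<Longrightarrow> finite (short_cycles V L)"
  by (simp add: short_cycles_def finite_cycles)

lemma short_cyclesE:
  assumes "c \<in> short_cycles V L"
  obtains xs where "distinct xs" "length xs \<ge> 3" "length xs \<le> L" "set xs \<subseteq> V" "c = cycle_edges xs"
    "\<Union>c = set xs" "card c = length xs"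
  using assms by (auto simp: short_cycles_def elim!: cyclesE)

lemma short_cycle_facts:
  assumes "c \<in> short_cycles V L"
  shows "finite c" "card c \<ge> 3" "card c \<le> L" "card (\<Union>c) = card c" "\<Union>c \<subseteq> V" "finite (\<Union>c)"
    "\<And>e. e \<in> c \<Longrightarrow> card e = 2"
proof -
  obtain xs where xs: "distinct xs" "length xs \<ge> 3" "length xs \<le> L" "set xs \<subseteq> V" "c = cycle_edges xs"
    "\<Union>c = set xs" "card c = length xs"
    using assms by (rule short_cyclesE)
  then show "finite c" "card c \<ge> 3" "card c \<le> L" "\<Union>c \<subseteq> V" "finite (\<Union>c)" by simp_all
  show "card (\<Union>c) = card c" using xs by (simp add: distinct_card)
  show "\<And>e. e \<in> c \<Longrightarrow> card e = 2" using xs card_edge_of_cycle by blast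
qed

lemma sum_short_cycles:
  assumes "finite V"
  shows "(\<Sum>c\<in>short_cycles V L. g c) = (\<Sum>l=3..L. \<Sum>c\<in>cycles V l. g c)"
  unfolding short_cycles_def
proof (rule sum.UNION_disjoint)
  show "\<forall>l\<in>{3..L}. \<forall>l'\<in>{3..L}. l \<noteq> l' \<longrightarrow> cycles V l \<inter> cycles V l' = {}"
  proof (intro ballI impI)
    fix l l' assume l: "l \<in> {3..L}" "l' \<in> {3..L}" "l \<noteq> l'"
    have "card c = l" if "c \<in> cycles V l" for c using that l by (auto elim: cyclesE)
    moreover have "card c = l'" if "c \<in> cycles V l'" for c using that l by (auto elim: cyclesE)
    ultimately show "cycles V l \<inter> cycles V l' = {}" using l(3) by blast
  qed
qed (use assms in \<open>auto simp: finite_cycles\<close>)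

lemma sum_prod_lists:
  fixes w :: "'a \<Rightarrow> real"
  assumes "finite V"
  shows "(\<Sum>xs | set xs \<subseteq> V \<and> length xs = l. prod_list (map w xs)) = sum w V ^ l"
proof (induction l)
  case 0
  have "{xs. set xs \<subseteq> V \<and> length xs = 0} = {[]}" by auto
  then show ?case by (simp only:) simp
next
  case (Suc l)
  let ?X = "{xs. set xs \<subseteq> V \<and> length xs = l}"
  have "inj_on (\<lambda>(xs, n). n # xs) (?X \<times> V)" by (auto intro!: inj_onI)
  then have "(\<Sum>xs | set xs \<subseteq> V \<and> length xs = Suc l. prod_list (map w xs)) =
     (\<Sum>(xs, n)\<in>?X \<times> V. prod_list (map w xs) * w n)"
    unfolding lists_length_Suc_eq
    by (subst sum.reindex) (auto intro!: sum.cong simp: mult.commute)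
  also have "\<dots> = (\<Sum>xs\<in>?X. prod_list (map w xs)) * sum w V"
    by (simp add: sum_product sum.cartesian_product)
  finally show ?case using Suc by (simp add: mult.commute)
qed

text \<open>The additional edge in the second part costs a factor \<open>p\<close>; this is why families with two
  meeting cycles are negligible.\<close>

lemma cycle_new_edges:
  assumes "distinct xs" "length xs \<ge> 3"
  shows "card (set xs - \<Union>H) \<le> card (cycle_edges xs - H)"
    and "set xs \<inter> \<Union>H \<noteq> {} \<Longrightarrow> \<not> set xs \<subseteq> \<Union>H \<Longrightarrow> Suc (card (set xs - \<Union>H)) \<le> card (cycle_edges xs - H)"
proof -
  let ?U = "set xs - \<Union>H"
  have sub: "{e \<in> cycle_edges xs. e \<inter> ?U \<noteq> {}} \<subseteq> cycle_edges xs - H" by blast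
  have le: "card {e \<in> cycle_edges xs. e \<inter> ?U \<noteq> {}} \<le> card (cycle_edges xs - H)"
    by (rule card_mono[OF _ sub]) simp
  show "card ?U \<le> card (cycle_edges xs - H)"
    using card_vertices_le_edges(1)[OF assms, of ?U] le by auto
  assume "set xs \<inter> \<Union>H \<noteq> {}" "\<not> set xs \<subseteq> \<Union>H"
  then have "?U \<noteq> {}" "?U \<noteq> set xs" by blast+
  then show "Suc (card ?U) \<le> card (cycle_edges xs - H)"
    using card_vertices_le_edges(2)[OF assms, of ?U] le by auto
qed

text \<open>Distinct entries make \<open>p ^ card (set xs - W)\<close> a product of one weight per
  entry, 1 on \<open>W\<close> and \<open>p\<close> elsewhere. Enlarging the sum to all lists then
  makes it a pure power of the total weight.\<close>

lemma sum_lists_avoiding: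
  assumes "finite V" "finite W" "0 \<le> p" "real (card W) \<le> K"
  shows "(\<Sum>xs | length xs = l \<and> distinct xs \<and> set xs \<subseteq> V. p ^ card (set xs - W))
    \<le> (K + real (card V) * p) ^ l"
proof -
  let ?w = "\<lambda>x. if x \<in> W then 1 else p"
  have *: "p ^ card (set xs - W) = prod_list (map ?w xs)" if "distinct xs" for xs
    using that
  proof (induction xs)
    case (Cons x xs)
    have "set (x # xs) - W = (if x \<in> W then set xs - W else insert x (set xs - W))" by auto
    then show ?case using Cons by auto
  qed simp
  have "(\<Sum>xs | length xs = l \<and> distinct xs \<and> set xs \<subseteq> V. p ^ card (set xs - W))
      = (\<Sum>xs | length xs = l \<and> distinct xs \<and> set xs \<subseteq> V. prod_list (map ?w xs))"
    using * by (intro sum.cong) auto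
  also have "\<dots> \<le> (\<Sum>xs | set xs \<subseteq> V \<and> length xs = l. prod_list (map ?w xs))"
    using assms finite_lists_length_eq[OF assms(1)]
    by (intro sum_mono2) (auto intro!: prod_list_nonneg)
  also have "\<dots> = sum ?w V ^ l" by (rule sum_prod_lists[OF assms(1)])
  also have "\<dots> \<le> (K + real (card V) * p) ^ l"
  proof (rule power_mono)
    have "sum ?w V = real (card (V \<inter> W)) + real (card (V - W)) * p"
      using assms(1) by (simp add: sum.If_cases Diff_eq)
    also have "\<dots> \<le> K + real (card V) * p"
      using assms by (intro add_mono mult_right_mono order_trans[OF _ assms(4)])
        (auto intro!: card_mono)
    finally show "sum ?w V \<le> K + real (card V) * p" .
  qed (use assms in \<open>auto intro!: sum_nonneg\<close>)
  finally show ?thesis .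
qed

text \<open>Giving the vertices covered by \<open>H\<close> weight \<open>1\<close> and all others weight \<open>p\<close> dominates the sum
  over cycles by a power of the total vertex weight.\<close>

lemma sum_cycles_outside:
  assumes "finite V" "l \<ge> 3" "0 \<le> p" "p \<le> 1" "finite (\<Union>H)" "real (card (\<Union>H)) \<le> K"
  shows "(\<Sum>c\<in>cycles V l. p ^ card (c - H)) \<le> (K + real (card V) * p) ^ l"
proof -
  let ?X = "{xs. length xs = l \<and> distinct xs \<and> set xs \<subseteq> V}"
  have "(\<Sum>c\<in>cycles V l. p ^ card (c - H)) \<le> (\<Sum>xs\<in>?X. p ^ card (cycle_edges xs - H))"
    unfolding cycles_def using assms
    by (intro order_trans[OF sum_image_le]) (auto simp: finite_lists_distinct o_def)
  also have "\<dots> \<le> (\<Sum>xs\<in>?X. p ^ card (set xs - \<Union>H))"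
    using assms by (intro sum_mono power_decreasing cycle_new_edges) auto
  also have "\<dots> \<le> (K + real (card V) * p) ^ l"
    using assms by (intro sum_lists_avoiding)
  finally show ?thesis .
qed

text \<open>The extra factor \<open>p\<close> is one new edge beyond the number of new vertices. If
  the cycle has a vertex off \<open>c0\<close>, this edge comes from passing between the old and the
  new part; if all its vertices lie on \<open>c0\<close>, it comes from the fact that no cycle
  contains a different one.\<close>

lemma sum_cycles_meeting:
  assumes "finite V" "l \<ge> 3" "0 \<le> p" "p \<le> 1" and c0: "c0 \<in> short_cycles V L"
  shows "(\<Sum>c | c \<in> cycles V l \<and> c \<noteq> c0 \<and> \<Union>c0 \<inter> \<Union>c \<noteq> {}. p ^ card (c - c0))
    \<le> p * (real L + real (card V) * p) ^ l"
proof -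
  let ?X = "{xs. length xs = l \<and> distinct xs \<and> set xs \<subseteq> V}"
  let ?Y = "{xs \<in> ?X. cycle_edges xs \<noteq> c0 \<and> \<Union>c0 \<inter> \<Union>(cycle_edges xs) \<noteq> {}}"
  obtain ys where ys: "distinct ys" "length ys \<ge> 3" "c0 = cycle_edges ys"
    using c0 by (rule short_cyclesE)
  have fY: "finite ?Y" using finite_lists_distinct[OF assms(1), of l] by (rule rev_finite_subset) blast
  have "{c. c \<in> cycles V l \<and> c \<noteq> c0 \<and> \<Union>c0 \<inter> \<Union>c \<noteq> {}} = cycle_edges ` ?Y"
    by (auto simp: cycles_def)
  then have "(\<Sum>c | c \<in> cycles V l \<and> c \<noteq> c0 \<and> \<Union>c0 \<inter> \<Union>c \<noteq> {}. p ^ card (c - c0))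
      \<le> (\<Sum>xs\<in>?Y. p ^ card (cycle_edges xs - c0))"
    using assms sum_image_le[OF fY, of "\<lambda>c. p ^ card (c - c0)" cycle_edges]
    by (simp only: o_def) simp
  also have "\<dots> \<le> (\<Sum>xs\<in>?Y. p * p ^ card (set xs - \<Union>c0))"
  proof (rule sum_mono)
    fix xs assume xs: "xs \<in> ?Y"
    then have d: "distinct xs" "length xs \<ge> 3" using assms(2) by auto
    have "Suc (card (set xs - \<Union>c0)) \<le> card (cycle_edges xs - c0)"
    proof (cases "set xs \<subseteq> \<Union>c0")
      case True
      have "\<not> cycle_edges xs \<subseteq> c0"
        using cycle_subset_cycle_eq[OF ys(1,2) d] xs ys(3) by auto
      then have "card (cycle_edges xs - c0) > 0" by (simp add: card_gt_0_iff)
      moreover have "card (set xs - \<Union>c0) = 0" using True by (metis Diff_eq_empty_iff card.empty)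
      ultimately show ?thesis by linarith
    next
      case False
      then show ?thesis using xs by (intro cycle_new_edges(2)[OF d]) (auto simp: Union_cycle_edges)
    qed
    then have "p ^ card (cycle_edges xs - c0) \<le> p ^ Suc (card (set xs - \<Union>c0))"
      using assms by (intro power_decreasing)
    then show "p ^ card (cycle_edges xs - c0) \<le> p * p ^ card (set xs - \<Union>c0)" by simp
  qed
  also have "\<dots> \<le> (\<Sum>xs\<in>?X. p * p ^ card (set xs - \<Union>c0))"
    using assms finite_lists_distinct[OF assms(1), of l] by (intro sum_mono2) auto
  also have "\<dots> = p * (\<Sum>xs\<in>?X. p ^ card (set xs - \<Union>c0))" by (rule sum_distrib_left[symmetric])
  also have "\<dots> \<le> p * (real L + real (card V) * p) ^ l"
    using assms short_cycle_facts[OF c0] by (intro mult_left_mono sum_lists_avoiding) auto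
  finally show ?thesis .
qed

text \<open>Bounds the weight of all ways to add one short cycle to \<open>k\<close> given ones,
  which cover at most \<open>k * L\<close> vertices; \<open>b\<close> stands for the number of
  vertices times \<open>p\<close>, which stays bounded in the sparse regime.\<close>

definition ext_bound :: "nat \<Rightarrow> real \<Rightarrow> nat \<Rightarrow> real" where
  "ext_bound L b k = (\<Sum>l=3..L. (real (k * L) + b) ^ l)"

lemma ext_bound_nonneg: "b \<ge> 0 \<Longrightarrow> ext_bound L b k \<ge> 0"
  unfolding ext_bound_def by (intro sum_nonneg) auto

lemma ext_bound_mono: "0 \<le> b \<Longrightarrow> b \<le> b' \<Longrightarrow> j \<le> k \<Longrightarrow> ext_bound L b j \<le> ext_bound L b' k"
  unfolding ext_bound_def by (intro sum_mono power_mono add_mono) (auto simp del: of_nat_mult)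

lemma sum_short_cycles_outside:
  assumes "finite V" "0 \<le> p" "p \<le> 1" "finite (\<Union>H)" "card (\<Union>H) \<le> k * L"
  shows "(\<Sum>c\<in>short_cycles V L. p ^ card (c - H)) \<le> ext_bound L (real (card V) * p) k"
proof -
  have "(\<Sum>c\<in>short_cycles V L. p ^ card (c - H)) = (\<Sum>l=3..L. \<Sum>c\<in>cycles V l. p ^ card (c - H))"
    by (rule sum_short_cycles[OF assms(1)])
  also have "\<dots> \<le> ext_bound L (real (card V) * p) k"
    unfolding ext_bound_def using assms
    by (intro sum_mono sum_cycles_outside) (auto simp del: of_nat_mult)
  finally show ?thesis .
qed

lemma sum_short_cycles_meeting:
  assumes "finite V" "0 \<le> p" "p \<le> 1" and c0: "c0 \<in> short_cycles V L"
  shows "(\<Sum>c | c \<in> short_cycles V L \<and> c \<noteq> c0 \<and> \<Union>c0 \<inter> \<Union>c \<noteq> {}. p ^ card (c - c0))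
    \<le> p * ext_bound L (real (card V) * p) 1"
proof -
  let ?P = "\<lambda>c. c \<noteq> c0 \<and> \<Union>c0 \<inter> \<Union>c \<noteq> {}"
  let ?g = "\<lambda>c. if ?P c then p ^ card (c - c0) else 0"
  have eq: "(\<Sum>c | c \<in> X \<and> ?P c. p ^ card (c - c0)) = sum ?g X" if "finite X" for X
    using that by (simp add: sum.inter_filter[symmetric])
  have "(\<Sum>c | c \<in> short_cycles V L \<and> ?P c. p ^ card (c - c0)) = (\<Sum>l=3..L. sum ?g (cycles V l))"
    unfolding eq[OF finite_short_cycles[OF assms(1)]] by (rule sum_short_cycles[OF assms(1)])
  also have "\<dots> = (\<Sum>l=3..L. \<Sum>c | c \<in> cycles V l \<and> ?P c. p ^ card (c - c0))"
    unfolding eq[OF finite_cycles[OF assms(1)]] ..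
  also have "\<dots> \<le> (\<Sum>l=3..L. p * (real L + real (card V) * p) ^ l)"
    using assms by (intro sum_mono sum_cycles_meeting) auto
  finally show ?thesis by (simp add: ext_bound_def sum_distrib_left)
qed

lemma card_Union_family_le:
  assumes "F \<subseteq> short_cycles V L" "finite F"
  shows "finite (\<Union>F)" "card (\<Union>F) \<le> card F * L" "finite (\<Union>(\<Union>F))" "card (\<Union>(\<Union>F)) \<le> card F * L"
proof -
  have f: "finite c" "card c \<le> L" "finite (\<Union>c)" "card (\<Union>c) \<le> L" if "c \<in> F" for c
    using short_cycle_facts[of c V L] assms(1) that by auto
  show "finite (\<Union>F)" using f assms(2) by auto
  have eq: "\<Union>(\<Union>F) = (\<Union>c\<in>F. \<Union>c)" by blast
  show "finite (\<Union>(\<Union>F))" unfolding eq using f assms(2) by blast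
  have "card (\<Union>F) = card (\<Union>c\<in>F. c)" by simp
  also have "\<dots> \<le> (\<Sum>c\<in>F. card c)" by (rule card_UN_le[OF assms(2)])
  also have "\<dots> \<le> (\<Sum>c\<in>F. L)" using f by (intro sum_mono) auto
  finally show "card (\<Union>F) \<le> card F * L" by simp
  have "card (\<Union>(\<Union>F)) \<le> (\<Sum>c\<in>F. card (\<Union>c))" unfolding eq by (rule card_UN_le[OF assms(2)])
  also have "\<dots> \<le> (\<Sum>c\<in>F. L)" using f by (intro sum_mono) auto
  finally show "card (\<Union>(\<Union>F)) \<le> card F * L" by simp
qed

lemma insert_image_memI:
  "F = insert c G \<Longrightarrow> G \<in> X \<Longrightarrow> c \<in> C \<Longrightarrow> F \<in> (\<lambda>(F, c). insert c F) ` (X \<times> C)"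
  by (rule image_eqI[of _ _ "(G, c)"]) simp_all

lemma sum_insert_image_le:
  fixes g :: "'b set \<Rightarrow> real"
  assumes "finite X" "finite C" "\<And>F. g F \<ge> 0" "Z \<subseteq> (\<lambda>(F, c). insert c F) ` (X \<times> C)"
  shows "sum g Z \<le> (\<Sum>F\<in>X. \<Sum>c\<in>C. g (insert c F))"
proof -
  have "sum g Z \<le> sum g ((\<lambda>(F, c). insert c F) ` (X \<times> C))"
    using assms by (intro sum_mono2) auto
  also have "\<dots> \<le> sum (g \<circ> (\<lambda>(F, c). insert c F)) (X \<times> C)"
    using assms by (intro sum_image_le) auto
  also have "\<dots> = (\<Sum>F\<in>X. \<Sum>c\<in>C. g (insert c F))"
    by (simp add: sum.cartesian_product o_def case_prod_unfold)
  finally show ?thesis .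
qed

lemma extend_family:
  assumes "finite V" "0 \<le> p" "p \<le> 1" "F \<subseteq> short_cycles V L" "card F = k"
  shows "(\<Sum>c\<in>short_cycles V L. p ^ card (\<Union>(insert c F))) \<le>
    p ^ card (\<Union>F) * ext_bound L (real (card V) * p) k"
proof -
  have fF: "finite F" using assms(1,4) finite_subset finite_short_cycles by metis
  note u = card_Union_family_le[OF assms(4) fF]
  have "p ^ card (\<Union>(insert c F)) = p ^ card (\<Union>F) * p ^ card (c - \<Union>F)" if "c \<in> short_cycles V L" for c
  proof -
    have "\<Union>(insert c F) = \<Union>F \<union> (c - \<Union>F)" by blast
    moreover have "card \<dots> = card (\<Union>F) + card (c - \<Union>F)"
      using u(1) short_cycle_facts(1)[OF that] by (intro card_Un_disjoint) auto
    ultimately show ?thesis by (simp add: power_add)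
  qed
  then have "(\<Sum>c\<in>short_cycles V L. p ^ card (\<Union>(insert c F))) =
      p ^ card (\<Union>F) * (\<Sum>c\<in>short_cycles V L. p ^ card (c - \<Union>F))"
    by (simp add: sum_distrib_left)
  also have "\<dots> \<le> p ^ card (\<Union>F) * ext_bound L (real (card V) * p) k"
    using assms u by (intro mult_left_mono sum_short_cycles_outside) auto
  finally show ?thesis .
qed

text \<open>A family is built by inserting one cycle at a time, paying only for new edges. The
  different orders of insertion are all counted; the lost factor k! does not matter for a bound that
  merely has to stay finite as the graph grows.\<close>

lemma sum_families_le:
  assumes "finite V" "0 \<le> p" "p \<le> 1"
  shows "(\<Sum>F | F \<subseteq> short_cycles V L \<and> card F = k. p ^ card (\<Union>F))
    \<le> ext_bound L (real (card V) * p) k ^ k"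
proof (induction k)
  case 0
  have "{F. F \<subseteq> short_cycles V L \<and> card F = 0} = {{}}"
    using finite_short_cycles[OF assms(1), of L] by (auto simp: card_eq_0_iff dest: finite_subset)
  then show ?case by (simp only:) simp
next
  case (Suc k)
  let ?C = "short_cycles V L" and ?b = "real (card V) * p"
  let ?X = "{F. F \<subseteq> ?C \<and> card F = k}"
  have b: "?b \<ge> 0" using assms by simp
  have fC: "finite ?C" by (rule finite_short_cycles[OF assms(1)])
  have "{F. F \<subseteq> ?C \<and> card F = Suc k} \<subseteq> (\<lambda>(F, c). insert c F) ` (?X \<times> ?C)"
  proof
    fix F assume F: "F \<in> {F. F \<subseteq> ?C \<and> card F = Suc k}"
    then have "F \<noteq> {}" by auto
    then obtain c where c: "c \<in> F" by blast
    then have "card (F - {c}) = k" using F by simp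
    then have "F = insert c (F - {c})" "F - {c} \<in> ?X" "c \<in> ?C" using F c by blast+
    then show "F \<in> (\<lambda>(F, c). insert c F) ` (?X \<times> ?C)" by (rule insert_image_memI)
  qed
  then have "(\<Sum>F | F \<subseteq> ?C \<and> card F = Suc k. p ^ card (\<Union>F)) \<le>
      (\<Sum>F\<in>?X. \<Sum>c\<in>?C. p ^ card (\<Union>(insert c F)))"
    using assms fC by (intro sum_insert_image_le finite_subsets_card) auto
  also have "\<dots> \<le> (\<Sum>F\<in>?X. p ^ card (\<Union>F) * ext_bound L ?b k)"
    using assms by (intro sum_mono extend_family) auto
  also have "\<dots> = (\<Sum>F\<in>?X. p ^ card (\<Union>F)) * ext_bound L ?b k"
    by (rule sum_distrib_right[symmetric])
  also have "\<dots> \<le> ext_bound L ?b k ^ k * ext_bound L ?b k"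
    using Suc ext_bound_nonneg[OF b] by (intro mult_right_mono) auto
  also have "\<dots> = ext_bound L ?b k ^ Suc k" by simp
  also have "\<dots> \<le> ext_bound L ?b (Suc k) ^ Suc k"
    using b by (intro power_mono ext_bound_mono ext_bound_nonneg) auto
  finally show ?case .
qed

text \<open>The factor \<open>p\<close> comes from one meeting pair. In a family of three or more
  cycles a member outside that pair can be removed, so the induction descends to families of
  two.\<close>

lemma sum_meeting_families_le:
  assumes "finite V" "0 \<le> p" "p \<le> 1"
  shows "(\<Sum>F | F \<subseteq> short_cycles V L \<and> card F = k \<and> \<not> disjoint_family_on Union F. p ^ card (\<Union>F))
    \<le> p * ext_bound L (real (card V) * p) k ^ k"
proof (induction k)
  case 0
  have "{F. F \<subseteq> short_cycles V L \<and> card F = 0 \<and> \<not> disjoint_family_on Union F} = {}"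
    using finite_short_cycles[OF assms(1), of L]
    by (auto simp: card_eq_0_iff disjoint_family_on_def dest: finite_subset)
  then show ?case using assms by (simp only:) simp
next
  case (Suc k)
  let ?C = "short_cycles V L" and ?b = "real (card V) * p"
  let ?Z = "{F. F \<subseteq> ?C \<and> card F = Suc k \<and> \<not> disjoint_family_on Union F}"
  have b: "?b \<ge> 0" using assms by simp
  have fC: "finite ?C" by (rule finite_short_cycles[OF assms(1)])
  have pairE: "\<exists>c d. c \<in> F \<and> d \<in> F \<and> c \<noteq> d \<and> \<Union>c \<inter> \<Union>d \<noteq> {}" if "F \<in> ?Z" for F
    using that unfolding disjoint_family_on_def by blast
  show ?case
  proof (cases "k \<le> 1")
    case True
    let ?P = "\<lambda>c0. {c. c \<in> ?C \<and> c \<noteq> c0 \<and> \<Union>c0 \<inter> \<Union>c \<noteq> {}}"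
    have "?Z \<subseteq> (\<lambda>(c, d). {c, d}) ` (SIGMA c0:?C. ?P c0)"
    proof
      fix F assume F: "F \<in> ?Z"
      then obtain c d where cd: "c \<in> F" "d \<in> F" "c \<noteq> d" "\<Union>c \<inter> \<Union>d \<noteq> {}" using pairE[OF F] by blast
      have "finite F" using F fC finite_subset by blast
      have "card F \<le> card {c, d}" using F True cd(3) by simp
      then have "{c, d} = F"
        using cd(1,2) \<open>finite F\<close> by (intro card_seteq) blast+
      moreover have "(c, d) \<in> (SIGMA c0:?C. ?P c0)" using cd F by blast
      ultimately show "F \<in> (\<lambda>(c, d). {c, d}) ` (SIGMA c0:?C. ?P c0)" by force
    qed
    moreover have fS: "finite (SIGMA c0:?C. ?P c0)" using fC by auto
    ultimately have "(\<Sum>F\<in>?Z. p ^ card (\<Union>F)) \<le>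
        (\<Sum>F\<in>(\<lambda>(c, d). {c, d}) ` (SIGMA c0:?C. ?P c0). p ^ card (\<Union>F))"
      using assms by (intro sum_mono2) auto
    also have "\<dots> \<le> (\<Sum>(c, d)\<in>(SIGMA c0:?C. ?P c0). p ^ card (\<Union>{c, d}))"
      using assms fS by (intro order_trans[OF sum_image_le]) (auto simp: case_prod_unfold o_def)
    also have "\<dots> = (\<Sum>c\<in>?C. \<Sum>d\<in>?P c. p ^ card (\<Union>{c, d}))"
      using fC by (subst sum.Sigma) auto
    \<comment> \<open>Writing \<open>c - {}\<close> lets the first cycle be bounded as one outside
      the empty edge set.\<close>
    also have "\<dots> = (\<Sum>c\<in>?C. p ^ card (c - {}) * (\<Sum>d\<in>?P c. p ^ card (d - c)))"
    proof -
      have "card (c \<union> d) = card c + card (d - c)" if "c \<in> ?C" "d \<in> ?C" for c d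
      proof -
        have "card (c \<union> (d - c)) = card c + card (d - c)"
          using short_cycle_facts(1)[OF that(1)] short_cycle_facts(1)[OF that(2)]
          by (intro card_Un_disjoint) auto
        then show ?thesis by simp
      qed
      then show ?thesis by (simp add: sum_distrib_left power_add)
    qed
    also have "\<dots> \<le> (\<Sum>c\<in>?C. p ^ card (c - {}) * (p * ext_bound L ?b 1))"
      using assms by (intro sum_mono mult_left_mono sum_short_cycles_meeting) auto
    also have "\<dots> = (\<Sum>c\<in>?C. p ^ card (c - {})) * (p * ext_bound L ?b 1)"
      by (rule sum_distrib_right[symmetric])
    also have "\<dots> \<le> ext_bound L ?b 0 * (p * ext_bound L ?b 1)"
      using assms ext_bound_nonneg[OF b]
      by (intro mult_right_mono sum_short_cycles_outside mult_nonneg_nonneg) auto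
    finally have *: "(\<Sum>F\<in>?Z. p ^ card (\<Union>F)) \<le> ext_bound L ?b 0 * (p * ext_bound L ?b 1)" .
    show ?thesis
    proof (cases "k = 1")
      case True
      have "ext_bound L ?b 0 * (p * ext_bound L ?b 1) \<le> ext_bound L ?b 2 * (p * ext_bound L ?b 2)"
        using assms b by (intro mult_mono ext_bound_mono ext_bound_nonneg mult_nonneg_nonneg) auto
      then show ?thesis using * True by (simp add: power2_eq_square mult_ac numeral_2_eq_2)
    next
      case False
      with True have "k = 0" by simp
      have "?Z = {}"
      proof (rule ccontr)
        assume "?Z \<noteq> {}"
        then obtain F where F: "F \<in> ?Z" by blast
        then obtain c d where "c \<in> F" "d \<in> F" "c \<noteq> d" using pairE[OF F] by blast
        moreover have "card F = 1" using F \<open>k = 0\<close> by auto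
        ultimately show False by (auto simp: card_1_singleton_iff)
      qed
      then show ?thesis using assms ext_bound_nonneg[OF b] by (simp only:) simp
    qed
  next
    case False
    let ?X = "{F. F \<subseteq> ?C \<and> card F = k \<and> \<not> disjoint_family_on Union F}"
    have "?Z \<subseteq> (\<lambda>(F, c). insert c F) ` (?X \<times> ?C)"
    proof
      fix F assume F: "F \<in> ?Z"
      then obtain c d where cd: "c \<in> F" "d \<in> F" "c \<noteq> d" "\<Union>c \<inter> \<Union>d \<noteq> {}" using pairE[OF F] by blast
      have "finite F" using F fC finite_subset by blast
      have "card {c, d} < card F" using F False cd(3) by simp
      then have "\<not> F \<subseteq> {c, d}" using card_mono[of "{c, d}" F] by fastforce
      then obtain e where e: "e \<in> F" "e \<notin> {c, d}" by blast
      have "\<not> disjoint_family_on Union (F - {e})"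
        using cd e unfolding disjoint_family_on_def by blast
      then have "F = insert e (F - {e})" "F - {e} \<in> ?X" "e \<in> ?C"
        using F e(1) card_Diff_singleton[OF e(1)] by auto
      then show "F \<in> (\<lambda>(F, c). insert c F) ` (?X \<times> ?C)" by (rule insert_image_memI)
    qed
    moreover have "finite ?X" by (rule finite_subset[OF _ finite_subsets_card[OF fC, of k]]) auto
    ultimately have "(\<Sum>F\<in>?Z. p ^ card (\<Union>F)) \<le> (\<Sum>F\<in>?X. \<Sum>c\<in>?C. p ^ card (\<Union>(insert c F)))"
      using assms fC by (intro sum_insert_image_le) auto
    also have "\<dots> \<le> (\<Sum>F\<in>?X. p ^ card (\<Union>F) * ext_bound L ?b k)"
      using assms by (intro sum_mono extend_family) auto
    also have "\<dots> = (\<Sum>F\<in>?X. p ^ card (\<Union>F)) * ext_bound L ?b k"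
      by (rule sum_distrib_right[symmetric])
    also have "\<dots> \<le> (p * ext_bound L ?b k ^ k) * ext_bound L ?b k"
      using Suc ext_bound_nonneg[OF b] by (intro mult_right_mono) auto
    also have "\<dots> = p * ext_bound L ?b k ^ Suc k" by simp
    also have "\<dots> \<le> p * ext_bound L ?b (Suc k) ^ Suc k"
      using b assms by (intro mult_left_mono power_mono ext_bound_mono ext_bound_nonneg) auto
    finally show ?thesis .
  qed
qed

lemma short_cycles_edge_disjoint:
  assumes "F \<subseteq> short_cycles V L" "disjoint_family_on Union F" "c \<in> F" "c' \<in> F" "c \<noteq> c'"
  shows "c \<inter> c' = {}"
proof (rule ccontr)
  assume "c \<inter> c' \<noteq> {}"
  then obtain e where e: "e \<in> c" "e \<in> c'" by blast
  then have "card e = 2" using short_cycle_facts(7) assms(1,3) by blast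
  then have "e \<noteq> {}" by auto
  then obtain v where "v \<in> e" by blast
  then have "v \<in> \<Union>c \<inter> \<Union>c'" using e by blast
  then show False using assms(2-5) unfolding disjoint_family_on_def by blast
qed

lemma card_Union_disjoint_family:
  assumes "F \<subseteq> short_cycles V L" "finite F"
  shows "card (\<Union>F) \<le> (\<Sum>c\<in>F. card c)"
    and "disjoint_family_on Union F \<Longrightarrow> card (\<Union>F) = (\<Sum>c\<in>F. card c)"
proof -
  show "card (\<Union>F) \<le> (\<Sum>c\<in>F. card c)" using card_UN_le[OF assms(2), of "\<lambda>c. c"] by simp
  assume d: "disjoint_family_on Union F"
  note short_cycles_edge_disjoint[OF assms(1) d]
  moreover have "finite c" if "c \<in> F" for c using short_cycle_facts(1) subsetD[OF assms(1) that] .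
  ultimately have "card (\<Union>c\<in>F. c) = (\<Sum>c\<in>F. card c)"
    by (intro card_UN_disjoint assms(2) ballI impI) simp_all
  then show "card (\<Union>F) = (\<Sum>c\<in>F. card c)" by simp
qed

text \<open>The elementary symmetric sum gives each family the weight \<open>p\<close> to the power
  of its total length. On disjoint families this agrees with \<open>q\<close> up to the relative
  error \<open>\<delta>\<close>; the meeting families occur in \<open>esum\<close> only and cost a
  factor \<open>p\<close>.\<close>

lemma disjoint_families_approx:
  fixes u :: "nat \<Rightarrow> 'c::real_normed_field" and q :: "nat \<Rightarrow> real"
  assumes "finite V" "0 \<le> p" "p \<le> 1" "\<delta> \<ge> 0" "U \<ge> 0"
    and q: "\<And>j. j \<le> k * L \<Longrightarrow> \<bar>q j - p ^ j\<bar> \<le> \<delta> * p ^ j"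
    and u: "\<And>l. norm (u l) \<le> U"
  shows "norm ((\<Sum>F | F \<subseteq> short_cycles V L \<and> card F = k \<and> disjoint_family_on Union F.
        (\<Prod>c\<in>F. u (card c)) * of_real (q (card (\<Union>F))))
      - esum k (\<lambda>c. u (card c) * of_real (p ^ card c)) (short_cycles V L))
    \<le> U ^ k * (\<delta> + p) * ext_bound L (real (card V) * p) k ^ k"
proof -
  let ?C = "short_cycles V L"
  let ?A = "{F. F \<subseteq> ?C \<and> card F = k}"
  let ?D = "{F. F \<subseteq> ?C \<and> card F = k \<and> disjoint_family_on Union F}"
  let ?N = "{F. F \<subseteq> ?C \<and> card F = k \<and> \<not> disjoint_family_on Union F}"
  let ?E = "ext_bound L (real (card V) * p) k ^ k"
  have fC: "finite ?C" by (rule finite_short_cycles[OF assms(1)])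
  have fA: "finite ?A" by (rule finite_subsets_card[OF fC])
  have fDN: "finite ?D" "finite ?N" by (rule finite_subset[OF _ fA], auto)+
  have AU: "?A = ?D \<union> ?N" "?D \<inter> ?N = {}" by auto
  have fF: "finite F" if "F \<in> ?A" for F using that fC finite_subset by blast
  have nu: "norm (\<Prod>c\<in>F. u (card c)) \<le> U ^ k" if "F \<in> ?A" for F
  proof -
    have "norm (\<Prod>c\<in>F. u (card c)) \<le> (\<Prod>c\<in>F. U)"
      unfolding prod_norm[symmetric] using u by (intro prod_mono) auto
    then show ?thesis using that by simp
  qed
  have pr: "(\<Prod>c\<in>F. u (card c) * of_real (p ^ card c)) = (\<Prod>c\<in>F. u (card c)) * of_real (p ^ (\<Sum>c\<in>F. card c))" for F
    by (simp add: prod.distrib power_sum)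
  have "esum k (\<lambda>c. u (card c) * of_real (p ^ card c)) ?C =
      (\<Sum>F\<in>?D. (\<Prod>c\<in>F. u (card c)) * of_real (p ^ (\<Sum>c\<in>F. card c)))
      + (\<Sum>F\<in>?N. (\<Prod>c\<in>F. u (card c)) * of_real (p ^ (\<Sum>c\<in>F. card c)))"
    unfolding esum_def pr AU(1) by (rule sum.union_disjoint[OF fDN AU(2)])
  then have eq: "(\<Sum>F\<in>?D. (\<Prod>c\<in>F. u (card c)) * of_real (q (card (\<Union>F))))
      - esum k (\<lambda>c. u (card c) * of_real (p ^ card c)) ?C
    = (\<Sum>F\<in>?D. (\<Prod>c\<in>F. u (card c)) * of_real (q (card (\<Union>F)) - p ^ (\<Sum>c\<in>F. card c)))
      - (\<Sum>F\<in>?N. (\<Prod>c\<in>F. u (card c)) * of_real (p ^ (\<Sum>c\<in>F. card c)))"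
    by (simp add: sum_subtractf right_diff_distrib)
  have "norm ((\<Sum>F\<in>?D. (\<Prod>c\<in>F. u (card c)) * of_real (q (card (\<Union>F)) - p ^ (\<Sum>c\<in>F. card c)))
      - (\<Sum>F\<in>?N. (\<Prod>c\<in>F. u (card c)) * of_real (p ^ (\<Sum>c\<in>F. card c))))
    \<le> (\<Sum>F\<in>?D. U ^ k * (\<delta> * p ^ card (\<Union>F))) + (\<Sum>F\<in>?N. U ^ k * p ^ card (\<Union>F))"
  proof (rule order_trans[OF norm_triangle_ineq4 add_mono]; rule sum_norm_le)
    fix F assume F: "F \<in> ?D"
    then have FC: "F \<subseteq> ?C" "F \<in> ?A" by auto
    have cU: "card (\<Union>F) = (\<Sum>c\<in>F. card c)" "card (\<Union>F) \<le> k * L"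
      using card_Union_disjoint_family(2)[OF FC(1) fF[OF FC(2)]] card_Union_family_le(2)[OF FC(1) fF[OF FC(2)]] F
      by auto
    show "norm ((\<Prod>c\<in>F. u (card c)) * of_real (q (card (\<Union>F)) - p ^ (\<Sum>c\<in>F. card c)))
        \<le> U ^ k * (\<delta> * p ^ card (\<Union>F))"
      unfolding norm_mult norm_of_real cU(1)[symmetric]
      using nu[OF FC(2)] q[OF cU(2)] assms by (intro mult_mono) auto
  next
    fix F assume F: "F \<in> ?N"
    then have FC: "F \<subseteq> ?C" "F \<in> ?A" by auto
    \<comment> \<open>Shared edges are counted repeatedly in the sum of the lengths, so it is at
      least the size of the union, and p \<le> 1 reverses the comparison.\<close>
    have "p ^ (\<Sum>c\<in>F. card c) \<le> p ^ card (\<Union>F)"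
      using card_Union_disjoint_family(1)[OF FC(1) fF[OF FC(2)]] assms by (intro power_decreasing) auto
    then show "norm ((\<Prod>c\<in>F. u (card c)) * of_real (p ^ (\<Sum>c\<in>F. card c))) \<le> U ^ k * p ^ card (\<Union>F)"
      unfolding norm_mult norm_of_real using nu[OF FC(2)] assms by (intro mult_mono) auto
  qed
  also have "\<dots> = U ^ k * (\<delta> * (\<Sum>F\<in>?D. p ^ card (\<Union>F)) + (\<Sum>F\<in>?N. p ^ card (\<Union>F)))"
    by (simp add: sum_distrib_left distrib_left)
  also have "\<dots> \<le> U ^ k * (\<delta> * ?E + p * ?E)"
  proof (intro mult_left_mono add_mono)
    have "(\<Sum>F\<in>?D. p ^ card (\<Union>F)) \<le> (\<Sum>F\<in>?A. p ^ card (\<Union>F))"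
      using assms fA by (intro sum_mono2) auto
    also have "\<dots> \<le> ?E" using assms by (intro sum_families_le) auto
    finally show "(\<Sum>F\<in>?D. p ^ card (\<Union>F)) \<le> ?E" .
    show "(\<Sum>F\<in>?N. p ^ card (\<Union>F)) \<le> p * ?E"
      using assms by (intro sum_meeting_families_le) auto
  qed (use assms in auto)
  finally show ?thesis unfolding eq by (simp add: algebra_simps)
qed

section \<open>Even subgraphs and the Ising partition function\<close>

text \<open>For finitely many edges inside a finite \<open>V\<close> this is 1 if all degrees of
  \<open>A\<close> are even and 0 otherwise: the indicator of an even edge set, written as a Fourier
  coefficient so that it arises directly from the spin sum.\<close>

definition spin_avg :: "'a set \<Rightarrow> 'a set set \<Rightarrow> real" where
  "spin_avg V A = (\<Sum>\<sigma>\<in>V \<rightarrow>\<^sub>E {-1, 1}. \<Prod>e\<in>A. \<Prod>u\<in>e. \<sigma> u) / 2 ^ card V"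

definition even_sum :: "'a set \<Rightarrow> 'a set set \<Rightarrow> real \<Rightarrow> real" where
  "even_sum V E t = (\<Sum>A\<in>Pow E. t ^ card A * spin_avg V A)"

lemma spin_values: "\<sigma> \<in> V \<rightarrow>\<^sub>E {-1, 1::real} \<Longrightarrow> v \<in> V \<Longrightarrow> \<sigma> v = 1 \<or> \<sigma> v = -1"
  by (auto simp: PiE_iff)

lemma edge_spin_values:
  assumes "\<sigma> \<in> V \<rightarrow>\<^sub>E {-1, 1::real}" "e \<subseteq> V"
  shows "(\<Prod>u\<in>e. \<sigma> u) = 1 \<or> (\<Prod>u\<in>e. \<sigma> u) = -1"
proof -
  have "\<bar>\<Prod>u\<in>e. \<sigma> u\<bar> = (\<Prod>u\<in>e. \<bar>\<sigma> u\<bar>)" by (rule abs_prod)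
  also have "\<dots> = 1" using spin_values[OF assms(1)] assms(2) by (intro prod.neutral ballI) force
  finally show ?thesis by linarith
qed

lemma prod_one_plus:
  fixes f :: "'b \<Rightarrow> 'c::comm_semiring_1"
  assumes "finite A"
  shows "(\<Prod>x\<in>A. 1 + f x) = (\<Sum>X\<in>Pow A. \<Prod>x\<in>X. f x)"
  using prod_add[OF assms, of f "\<lambda>_. 1"] by (simp add: add.commute)

text \<open>On the two points 1 and -1 every function is affine, here with coefficients
  \<open>cosh \<beta>\<close> and \<open>sinh \<beta>\<close>. This makes the Boltzmann weight a
  product that can be expanded over edge sets.\<close>

lemma exp_spin:
  assumes "s = 1 \<or> s = (-1::real)"
  shows "exp (\<beta> * s) = cosh \<beta> * (1 + tanh \<beta> * s)"
proof -
  have "cosh \<beta> * (1 + tanh \<beta> * s) = cosh \<beta> + sinh \<beta> * s"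
    by (simp add: tanh_def distrib_left)
  also have "\<dots> = exp (\<beta> * s)"
    using assms by (auto simp: cosh_plus_sinh cosh_minus_sinh simp flip: diff_conv_add_uminus)
  finally show ?thesis ..
qed

lemma sum_spins_prod:
  assumes "finite E"
  shows "(\<Sum>\<sigma>\<in>V \<rightarrow>\<^sub>E {-1, 1::real}. \<Prod>e\<in>E. 1 + t * (\<Prod>u\<in>e. \<sigma> u)) = 2 ^ card V * even_sum V E t"
proof -
  have "(\<Sum>\<sigma>\<in>V \<rightarrow>\<^sub>E {-1, 1::real}. \<Prod>e\<in>E. 1 + t * (\<Prod>u\<in>e. \<sigma> u))
      = (\<Sum>\<sigma>\<in>V \<rightarrow>\<^sub>E {-1, 1}. \<Sum>A\<in>Pow E. t ^ card A * (\<Prod>e\<in>A. \<Prod>u\<in>e. \<sigma> u))"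
    using assms by (simp add: prod_one_plus prod.distrib)
  also have "\<dots> = (\<Sum>A\<in>Pow E. \<Sum>\<sigma>\<in>V \<rightarrow>\<^sub>E {-1, 1}. t ^ card A * (\<Prod>e\<in>A. \<Prod>u\<in>e. \<sigma> u))"
    by (rule sum.swap)
  also have "\<dots> = 2 ^ card V * even_sum V E t"
  proof -
    have "even_sum V E t = (\<Sum>A\<in>Pow E. t ^ card A * (\<Sum>\<sigma>\<in>V \<rightarrow>\<^sub>E {-1, 1}. \<Prod>e\<in>A. \<Prod>u\<in>e. \<sigma> u)) / 2 ^ card V"
      by (simp only: even_sum_def spin_avg_def times_divide_eq_right sum_divide_distrib[symmetric])
    then show ?thesis by (simp add: sum_distrib_left[symmetric])
  qed
  finally show ?thesis .
qed

lemma ising_Z_eq_even_sum: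
  assumes "finite E" "\<And>e. e \<in> E \<Longrightarrow> e \<subseteq> V"
  shows "ising_Z (V, E) \<beta> = 2 ^ card V * cosh \<beta> ^ card E * even_sum V E (tanh \<beta>)"
proof -
  have "exp (\<beta> * (\<Sum>e\<in>E. \<Prod>u\<in>e. \<sigma> u)) = cosh \<beta> ^ card E * (\<Prod>e\<in>E. 1 + tanh \<beta> * (\<Prod>u\<in>e. \<sigma> u))"
    if "\<sigma> \<in> V \<rightarrow>\<^sub>E {-1, 1}" for \<sigma>
  proof -
    have "exp (\<beta> * (\<Sum>e\<in>E. \<Prod>u\<in>e. \<sigma> u)) = (\<Prod>e\<in>E. exp (\<beta> * (\<Prod>u\<in>e. \<sigma> u)))"
      using assms(1) by (simp add: sum_distrib_left exp_sum)
    also have "\<dots> = (\<Prod>e\<in>E. cosh \<beta> * (1 + tanh \<beta> * (\<Prod>u\<in>e. \<sigma> u)))"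
      using edge_spin_values[OF that] assms(2) by (intro prod.cong exp_spin) auto
    finally show ?thesis by (simp add: prod.distrib)
  qed
  then show ?thesis
    using sum_spins_prod[OF assms(1), where V = V and t = "tanh \<beta>"]
    by (simp add: ising_Z_def sum_distrib_left[symmetric] mult.commute mult.left_commute)
qed

text \<open>Regrouped by vertices, the spin sum factorises, and a vertex of degree k contributes 1 +
  (-1)^k, which is 0 or 2.\<close>

lemma spin_avg_nonneg:
  assumes "finite V" "finite A" "\<And>e. e \<in> A \<Longrightarrow> e \<subseteq> V"
  shows "spin_avg V A \<ge> 0"
proof -
  let ?deg = "\<lambda>v. card {e \<in> A. v \<in> e}"
  have "(\<Prod>e\<in>A. \<Prod>u\<in>e. \<sigma> u) = (\<Prod>v\<in>V. \<sigma> v ^ ?deg v)" for \<sigma> :: "'a \<Rightarrow> real"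
  proof -
    have "(\<Prod>e\<in>A. \<Prod>u\<in>e. \<sigma> u) = (\<Prod>e\<in>A. \<Prod>v\<in>V. if v \<in> e then \<sigma> v else 1)"
    proof (rule prod.cong)
      fix e assume "e \<in> A"
      then have "V \<inter> {v. v \<in> e} = e" using assms(3) by blast
      then show "(\<Prod>u\<in>e. \<sigma> u) = (\<Prod>v\<in>V. if v \<in> e then \<sigma> v else 1)"
        using assms(1) by (simp add: prod.If_cases)
    qed simp
    also have "\<dots> = (\<Prod>v\<in>V. \<Prod>e\<in>A. if v \<in> e then \<sigma> v else 1)" by (rule prod.swap)
    also have "\<dots> = (\<Prod>v\<in>V. \<sigma> v ^ ?deg v)"
      using assms(2) by (intro prod.cong refl) (simp add: prod.If_cases Int_def)
    finally show ?thesis .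
  qed
  then have "(\<Sum>\<sigma>\<in>V \<rightarrow>\<^sub>E {-1, 1::real}. \<Prod>e\<in>A. \<Prod>u\<in>e. \<sigma> u) = (\<Prod>v\<in>V. \<Sum>s\<in>{-1, 1::real}. s ^ ?deg v)"
    using prod_sum_PiE[OF assms(1), of "\<lambda>_. {-1, 1::real}" "\<lambda>v s. s ^ ?deg v"] by simp
  also have "\<dots> \<ge> 0"
  proof (intro prod_nonneg ballI)
    fix v
    show "0 \<le> (\<Sum>s\<in>{-1, 1::real}. s ^ ?deg v)" by (cases "even (?deg v)") auto
  qed
  finally show ?thesis by (simp add: spin_avg_def)
qed

lemma spin_avg_disjoint_cycles:
  assumes "finite V" "F \<subseteq> short_cycles V L" "disjoint_family_on Union F"
  shows "spin_avg V (\<Union>F) = 1"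
proof -
  have "finite F" using assms(1,2) finite_subset finite_short_cycles by metis
  have "(\<Prod>e\<in>\<Union>F. \<Prod>u\<in>e. \<sigma> u) = 1" if \<sigma>: "\<sigma> \<in> V \<rightarrow>\<^sub>E {-1, 1::real}" for \<sigma>
  proof -
    note ne = short_cycles_edge_disjoint[OF assms(2,3)]
    have "finite c" if "c \<in> F" for c using short_cycle_facts(1) subsetD[OF assms(2) that] .
    then have "(\<Prod>e\<in>\<Union>F. \<Prod>u\<in>e. \<sigma> u) = (\<Prod>c\<in>F. \<Prod>e\<in>c. \<Prod>u\<in>e. \<sigma> u)"
      using ne by (subst prod.Union_disjoint) auto
    also have "\<dots> = 1"
    proof (rule prod.neutral, rule ballI)
      fix c assume "c \<in> F"
      then obtain xs where xs: "distinct xs" "length xs \<ge> 3" "set xs \<subseteq> V" "c = cycle_edges xs"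
        using assms(2) by (metis short_cyclesE subsetD)
      show "(\<Prod>e\<in>c. \<Prod>u\<in>e. \<sigma> u) = 1"
        unfolding xs(4) using xs spin_values[OF \<sigma>] by (intro prod_spins_cycle) auto
    qed
    finally show ?thesis .
  qed
  then have "(\<Sum>\<sigma>\<in>V \<rightarrow>\<^sub>E {-1, 1::real}. \<Prod>e\<in>\<Union>F. \<Prod>u\<in>e. \<sigma> u) = real (card (V \<rightarrow>\<^sub>E {-1, 1::real}))"
    by simp
  also have "card (V \<rightarrow>\<^sub>E {-1, 1::real}) = 2 ^ card V"
    using assms(1) by (simp add: card_PiE numeral_2_eq_2)
  finally show ?thesis by (simp add: spin_avg_def)
qed

text \<open>A cycle inside a union of vertex-disjoint cycles lies in one of them and therefore
  equals it, so the union determines the family.\<close>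

lemma inj_on_Union_disjoint_cycles:
  "inj_on Union {F. F \<subseteq> short_cycles V L \<and> disjoint_family_on Union F}"
proof -
  have sub: "F \<subseteq> G" if F: "F \<subseteq> short_cycles V L" and G: "G \<subseteq> short_cycles V L" "disjoint_family_on Union G"
    and eq: "\<Union>F = \<Union>G" for F G
  proof
    fix c assume c: "c \<in> F"
    then obtain xs where xs: "distinct xs" "length xs \<ge> 3" "c = cycle_edges xs"
      using F by (metis short_cyclesE subsetD)
    have "cycle_edges xs \<subseteq> \<Union>G" using c xs eq by blast
    moreover have "\<And>a b. a \<in> G \<Longrightarrow> b \<in> G \<Longrightarrow> a \<noteq> b \<Longrightarrow> \<Union>a \<inter> \<Union>b = {}"
      using G(2) unfolding disjoint_family_on_def by blast
    ultimately obtain a where a: "a \<in> G" "cycle_edges xs \<subseteq> a"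
      using cycle_subset_disjoint_family[OF xs(2), of G] by blast
    then obtain ys where ys: "distinct ys" "length ys \<ge> 3" "a = cycle_edges ys"
      using G by (metis short_cyclesE subsetD)
    then have "c = a" using cycle_subset_cycle_eq[OF ys(1,2) xs(1,2)] a xs by simp
    then show "c \<in> G" using a by simp
  qed
  show ?thesis
    by (rule inj_onI) (use sub in \<open>simp add: subset_antisym\<close>)
qed

text \<open>Different families give different even edge sets, each with spin average 1; the edge
  sets left out contribute nonnegatively since t \<ge> 0.\<close>

lemma disjoint_cycles_le_even_sum:
  assumes "finite V" "finite E" "\<And>e. e \<in> E \<Longrightarrow> e \<subseteq> V" "t \<ge> 0"
  shows "(\<Sum>F | F \<subseteq> short_cycles V L \<and> disjoint_family_on Union F \<and> \<Union>F \<subseteq> E. t ^ card (\<Union>F))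
    \<le> even_sum V E t"
proof -
  let ?X = "{F. F \<subseteq> short_cycles V L \<and> disjoint_family_on Union F \<and> \<Union>F \<subseteq> E}"
  have inj: "inj_on Union ?X"
    by (rule inj_on_subset[OF inj_on_Union_disjoint_cycles[of V L]]) auto
  have "(\<Sum>F\<in>?X. t ^ card (\<Union>F)) = (\<Sum>F\<in>?X. t ^ card (\<Union>F) * spin_avg V (\<Union>F))"
    using assms(1) by (intro sum.cong) (auto simp: spin_avg_disjoint_cycles)
  also have "\<dots> = (\<Sum>A\<in>Union ` ?X. t ^ card A * spin_avg V A)"
    by (simp add: sum.reindex[OF inj])
  also have "\<dots> \<le> (\<Sum>A\<in>Pow E. t ^ card A * spin_avg V A)"
  proof (rule sum_mono2)
    fix A assume "A \<in> Pow E - Union ` ?X"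
    then have "A \<subseteq> E" by blast
    then have "spin_avg V A \<ge> 0"
      using assms finite_subset by (intro spin_avg_nonneg) blast+
    then show "0 \<le> t ^ card A * spin_avg V A" using assms by simp
  qed (use assms in auto)
  finally show ?thesis by (simp add: even_sum_def)
qed

text \<open>Linearity of expectation over indexed edge sets. The general codomain covers the real
  first moments and the complex sums behind the characteristic functions alike.\<close>

lemma expectation_subset_sum:
  fixes g :: "'i \<Rightarrow> 'c::{real_normed_field, banach, second_countable_topology}"
  assumes "m \<le> n choose 2" "finite I" "\<And>i. i \<in> I \<Longrightarrow> A i \<subseteq> all_edges n"
  shows "measure_pmf.expectation (random_graph n m) (\<lambda>G. \<Sum>i | i \<in> I \<and> A i \<subseteq> snd G. g i)
    = (\<Sum>i\<in>I. g i * of_real (incl_prob (n choose 2) m (card (A i))))"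
proof -
  let ?p = "measure_pmf (random_graph n m)"
  have "(\<Sum>i | i \<in> I \<and> A i \<subseteq> snd G. g i) = (\<Sum>i\<in>I. indicator {G. A i \<subseteq> snd G} G *\<^sub>R g i)" for G :: "nat graph"
    using assms(2) by (simp add: sum.inter_filter)
  then have "measure_pmf.expectation (random_graph n m) (\<lambda>G. \<Sum>i | i \<in> I \<and> A i \<subseteq> snd G. g i)
      = (\<integral>G. (\<Sum>i\<in>I. indicator {G. A i \<subseteq> snd G} G *\<^sub>R g i) \<partial>?p)"
    by (simp only:)
  also have "\<dots> = (\<Sum>i\<in>I. \<integral>G. indicator {G. A i \<subseteq> snd G} G *\<^sub>R g i \<partial>?p)"
    by (intro Bochner_Integration.integral_sum integrable_measure_pmf_finite)
      (simp add: set_pmf_random_graph assms(1) finite_graphs_nm)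
  also have "\<dots> = (\<Sum>i\<in>I. g i * of_real (incl_prob (n choose 2) m (card (A i))))"
  proof (rule sum.cong)
    fix i assume "i \<in> I"
    have "(\<integral>G. indicator {G. A i \<subseteq> snd G} G *\<^sub>R g i \<partial>?p) = measure_pmf.prob (random_graph n m) {G. A i \<subseteq> snd G} *\<^sub>R g i"
    proof -
      have "integrable ?p (indicator {G. A i \<subseteq> snd G} :: _ \<Rightarrow> real)"
        by (rule integrable_measure_pmf_finite)
          (simp add: set_pmf_random_graph assms(1) finite_graphs_nm)
      then show ?thesis by simp
    qed
    also have "\<dots> = g i * of_real (incl_prob (n choose 2) m (card (A i)))"
      unfolding prob_subset_random_graph[OF assms(1) assms(3)[OF \<open>i \<in> I\<close>]]
      by (simp add: scaleR_conv_of_real mult.commute)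
    finally show "(\<integral>G. indicator {G. A i \<subseteq> snd G} G *\<^sub>R g i \<partial>?p) = \<dots>" .
  qed simp
  finally show ?thesis .
qed

lemma all_edges_subset: "e \<in> all_edges n \<Longrightarrow> e \<subseteq> {1..n}"
  by (simp add: all_edges_def)

lemma random_graph_edges:
  assumes "m \<le> n choose 2" "G \<in> set_pmf (random_graph n m)"
  shows "fst G = {1..n}" "snd G \<subseteq> all_edges n" "card (snd G) = m" "finite (snd G)"
  using assms finite_subset[OF _ finite_all_edges[of n]]
  by (auto simp: set_pmf_random_graph graphs_nm_eq)

lemma expectation_even_sum_le:
  assumes "m \<le> n choose 2" "t \<ge> 0"
  shows "measure_pmf.expectation (random_graph n m) (\<lambda>G. even_sum {1..n} (snd G) t)
    \<le> even_sum {1..n} (all_edges n) (t * (real m / real (n choose 2)))"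
proof -
  let ?p = "random_graph n m"
  have "measure_pmf.expectation ?p (\<lambda>G. even_sum {1..n} (snd G) t)
    = measure_pmf.expectation ?p (\<lambda>G. \<Sum>A | A \<in> Pow (all_edges n) \<and> A \<subseteq> snd G. t ^ card A * spin_avg {1..n} A)"
  proof (rule Bochner_Integration.integral_cong_AE)
    show "AE G in measure_pmf ?p. even_sum {1..n} (snd G) t =
        (\<Sum>A | A \<in> Pow (all_edges n) \<and> A \<subseteq> snd G. t ^ card A * spin_avg {1..n} A)"
      unfolding AE_measure_pmf_iff
    proof
      fix G assume "G \<in> set_pmf ?p"
      from random_graph_edges(2)[OF assms(1) this]
      have "{A. A \<in> Pow (all_edges n) \<and> A \<subseteq> snd G} = Pow (snd G)" by blast
      then show "even_sum {1..n} (snd G) t =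
        (\<Sum>A | A \<in> Pow (all_edges n) \<and> A \<subseteq> snd G. t ^ card A * spin_avg {1..n} A)"
        by (simp only: even_sum_def)
    qed
  qed auto
  also have "\<dots> = (\<Sum>A\<in>Pow (all_edges n). t ^ card A * spin_avg {1..n} A * incl_prob (n choose 2) m (card A))"
    using expectation_subset_sum[OF assms(1), of "Pow (all_edges n)" "\<lambda>A. A" "\<lambda>A. t ^ card A * spin_avg {1..n} A"]
    by simp
  \<comment> \<open>Nonnegative spin averages allow the inclusion probability to be replaced
    termwise by a power of the edge density, which then merges with the power of
    \<open>t\<close>.\<close>
  also have "\<dots> \<le> (\<Sum>A\<in>Pow (all_edges n). t ^ card A * spin_avg {1..n} A * (real m / real (n choose 2)) ^ card A)"
  proof (intro sum_mono mult_left_mono incl_prob_bounds assms)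
    fix A assume "A \<in> Pow (all_edges n)"
    then have "spin_avg {1..n} A \<ge> 0"
      using all_edges_subset finite_subset[OF _ finite_all_edges[of n]] by (intro spin_avg_nonneg) blast+
    then show "0 \<le> t ^ card A * spin_avg {1..n} A" using assms(2) by simp
  qed
  also have "\<dots> = even_sum {1..n} (all_edges n) (t * (real m / real (n choose 2)))"
    unfolding even_sum_def by (intro sum.cong refl) (simp only: power_mult_distrib mult_ac)
  finally show ?thesis .
qed

section \<open>Upper bound for the complete graph by Gaussian linearisation\<close>

lemma one_plus_le_exp_cubic:
  fixes y :: real assumes "y > -1"
  shows "1 + y \<le> exp (y - y\<^sup>2 / 2 + y ^ 3 / 3)"
proof -
  define f where "f = (\<lambda>y::real. y - y\<^sup>2 / 2 + y ^ 3 / 3 - ln (1 + y))"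
  have d: "DERIV f x :> x ^ 3 / (1 + x)" if "x > -1" for x
  proof -
    have "DERIV f x :> 1 - x + x\<^sup>2 - 1 / (1 + x)"
      unfolding f_def using that by (auto intro!: derivative_eq_intros simp: power2_eq_square)
    \<comment> \<open>For x > -1 the right-hand side has the sign of \<open>x\<close>, so
      \<open>f\<close> has its minimum 0 at 0.\<close>
    moreover have "1 - x + x\<^sup>2 - 1 / (1 + x) = x ^ 3 / (1 + x)"
      using that by (simp add: field_simps power2_eq_square power3_eq_cube)
    ultimately show ?thesis by simp
  qed
  have "f 0 \<le> f y"
  proof (cases "y \<ge> 0")
    case True
    show ?thesis
    proof (rule DERIV_nonneg_imp_nondecreasing[OF True])
      fix x :: real assume x: "0 \<le> x" "x \<le> y"
      show "\<exists>y. (f has_real_derivative y) (at x) \<and> 0 \<le> y"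
        using d[of x] x by (intro exI[of _ "x ^ 3 / (1 + x)"]) auto
    qed
  next
    case False
    then have "y \<le> 0" by simp
    then show ?thesis
    proof (rule DERIV_nonpos_imp_nonincreasing)
      fix x :: real assume x: "y \<le> x" "x \<le> 0"
      have "x ^ 3 / (1 + x) \<le> 0" using x assms
        by (intro divide_nonpos_pos) (auto simp: power3_eq_cube mult_nonneg_nonpos)
      then show "\<exists>y. (f has_real_derivative y) (at x) \<and> y \<le> 0"
        using d[of x] x assms by (intro exI[of _ "x ^ 3 / (1 + x)"]) auto
    qed
  qed
  then have "ln (1 + y) \<le> y - y\<^sup>2 / 2 + y ^ 3 / 3" by (simp add: f_def)
  then have "exp (ln (1 + y)) \<le> exp (y - y\<^sup>2 / 2 + y ^ 3 / 3)" by simp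
  then show ?thesis using assms by simp
qed

text \<open>The sub-Gaussian bound for a random sign. The logarithmic derivative of
  \<open>cosh\<close> is \<open>tanh\<close>, and tanh x \<le> x on the positive axis because x -
  tanh x has derivative tanh^2; evenness does the rest.\<close>

lemma cosh_le_exp_square: "cosh y \<le> exp (y\<^sup>2 / 2)" for y :: real
proof -
  have pos: "cosh y \<le> exp (y\<^sup>2 / 2)" if "y \<ge> 0" for y :: real
  proof -
    have tanh_le: "tanh x \<le> x" if "x \<ge> 0" for x :: real
    proof -
      have "(\<lambda>x. x - tanh x) 0 \<le> (\<lambda>x. x - tanh x) x"
      proof (rule DERIV_nonneg_imp_nondecreasing[OF that])
        fix z :: real
        have "((\<lambda>x. x - tanh x) has_real_derivative (tanh z)\<^sup>2) (at z)"
          by (auto intro!: derivative_eq_intros)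
        then show "\<exists>y. ((\<lambda>x. x - tanh x) has_real_derivative y) (at z) \<and> 0 \<le> y" by auto
      qed
      then show ?thesis by simp
    qed
    have "(\<lambda>y. y\<^sup>2 / 2 - ln (cosh y)) 0 \<le> (\<lambda>y. y\<^sup>2 / 2 - ln (cosh y)) y"
    proof (rule DERIV_nonneg_imp_nondecreasing[OF that])
      fix z :: real assume z: "0 \<le> z"
      have "((\<lambda>y. y\<^sup>2 / 2 - ln (cosh y)) has_real_derivative (z - tanh z)) (at z)"
        by (auto intro!: derivative_eq_intros simp: tanh_def divide_simps)
      then show "\<exists>y. ((\<lambda>y. y\<^sup>2 / 2 - ln (cosh y)) has_real_derivative y) (at z) \<and> 0 \<le> y"
        using tanh_le[OF z] by force
    qed
    then have "ln (cosh y) \<le> y\<^sup>2 / 2" by simp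
    then have "exp (ln (cosh y)) \<le> exp (y\<^sup>2 / 2)" by (simp only: exp_le_cancel_iff)
    then show ?thesis by (simp only: exp_ln[OF cosh_real_pos])
  qed
  show ?thesis using pos[of y] pos[of "- y"] by (cases "y \<ge> 0") auto
qed

text \<open>Completing the square turns the integrand into exp (c^2 / 2) times the normal density
  with mean \<open>c\<close>.\<close>

lemma integral_normal_density_exp:
  "has_bochner_integral lborel (\<lambda>g. exp (c * g) * std_normal_density g) (exp (c\<^sup>2 / 2))"
proof -
  have eq: "exp (c * g) * std_normal_density g = exp (c\<^sup>2 / 2) * normal_density c 1 g" for g
    by (simp add: normal_density_def power2_eq_square algebra_simps flip: exp_add)
       (simp add: field_simps)
  have "has_bochner_integral lborel (normal_density c 1) 1"
    by (simp add: has_bochner_integral_iff)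
  then have "has_bochner_integral lborel (\<lambda>g. exp (c\<^sup>2 / 2) * normal_density c 1 g) (exp (c\<^sup>2 / 2) * 1)"
    by (rule has_bochner_integral_mult_right)
  then show ?thesis unfolding eq by simp
qed

text \<open>The integrand is a multiple of the centred normal density with variance 1 / (1 - a).
  With \<open>a\<close> equal to the number of vertices times the edge weight, \<open>a < 1\<close>
  is the high-temperature condition.\<close>

lemma integral_normal_density_exp_square:
  assumes "a < 1"
  shows "has_bochner_integral lborel (\<lambda>g. exp (a * g\<^sup>2 / 2) * std_normal_density g) (1 / sqrt (1 - a))"
proof -
  define s where "s = 1 / sqrt (1 - a)"
  have s: "s > 0" "s\<^sup>2 = 1 / (1 - a)" using assms by (auto simp: s_def power_divide)
  have eq: "exp (a * g\<^sup>2 / 2) * std_normal_density g = s * normal_density 0 s g" for g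
  proof -
    have "sqrt (2 * pi * s\<^sup>2) = sqrt (2 * pi) * s" 
      using s(1) by (simp only: real_sqrt_mult real_sqrt_abs abs_of_pos)
    moreover have "- (g - 0)\<^sup>2 / (2 * s\<^sup>2) = a * g\<^sup>2 / 2 + (- g\<^sup>2 / 2)"
      unfolding s using assms by (simp add: field_simps)
    ultimately show ?thesis using s(1)
      by (simp only: normal_density_def exp_add) (simp add: field_simps)
  qed
  have "has_bochner_integral lborel (normal_density 0 s) 1"
    using s by (simp add: has_bochner_integral_iff)
  then have "has_bochner_integral lborel (\<lambda>g. s * normal_density 0 s g) (s * 1)"
    by (rule has_bochner_integral_mult_right)
  then show ?thesis unfolding eq s_def[symmetric] by simp
qed

text \<open>Hubbard--Stratonovich: \<open>exp (x M\<^sup>2 / 2)\<close> is a Gaussian average of \<open>exp (sqrt x M g)\<close>, and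
  the latter factorises over the spins.\<close>

lemma curie_weiss_le:
  assumes "finite V" "0 \<le> x" "real (card V) * x < 1"
  shows "(\<Sum>\<sigma>\<in>V \<rightarrow>\<^sub>E {-1, 1::real}. exp (x * (sum \<sigma> V)\<^sup>2 / 2))
    \<le> 2 ^ card V / sqrt (1 - real (card V) * x)"
proof -
  let ?S = "V \<rightarrow>\<^sub>E {-1, 1::real}" and ?n = "card V"
  have 1: "has_bochner_integral lborel (\<lambda>g. \<Sum>\<sigma>\<in>?S. exp (sqrt x * sum \<sigma> V * g) * std_normal_density g)
      (\<Sum>\<sigma>\<in>?S. exp ((sqrt x * sum \<sigma> V)\<^sup>2 / 2))"
    by (intro has_bochner_integral_sum integral_normal_density_exp)
  have 2: "has_bochner_integral lborel (\<lambda>g. 2 ^ ?n * (exp ((?n * x) * g\<^sup>2 / 2) * std_normal_density g))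
      (2 ^ ?n * (1 / sqrt (1 - ?n * x)))"
    by (intro has_bochner_integral_mult_right integral_normal_density_exp_square assms)
  have le: "(\<Sum>\<sigma>\<in>?S. exp (sqrt x * sum \<sigma> V * g) * std_normal_density g)
      \<le> 2 ^ ?n * (exp ((?n * x) * g\<^sup>2 / 2) * std_normal_density g)" for g
  proof -
    have "(\<Sum>\<sigma>\<in>?S. exp (sqrt x * sum \<sigma> V * g)) = (\<Sum>\<sigma>\<in>?S. \<Prod>v\<in>V. exp (sqrt x * g * \<sigma> v))"
      using assms(1) by (intro sum.cong refl) (simp add: exp_sum[symmetric] sum_distrib_left mult_ac)
    also have "\<dots> = (\<Prod>v\<in>V. \<Sum>s\<in>{-1, 1::real}. exp (sqrt x * g * s))"
      using prod_sum_PiE[OF assms(1), of "\<lambda>_. {-1, 1::real}" "\<lambda>v s. exp (sqrt x * g * s)"] by simp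
    also have "\<dots> = (2 * cosh (sqrt x * g)) ^ ?n"
    proof -
      have "(\<Sum>s\<in>{-1, 1::real}. exp (sqrt x * g * s)) = 2 * cosh (sqrt x * g)"
        by (simp add: cosh_field_def)
      then show ?thesis by (simp only: prod_constant)
    qed
    \<comment> \<open>The bound on \<open>cosh\<close> is applied under the integral: all vertices
      share the same \<open>g\<close>, so the exponents add up to a quadratic one with coefficient
      \<open>?n * x\<close> below 1, integrable against the density.\<close>
    also have "\<dots> \<le> (2 * exp ((sqrt x * g)\<^sup>2 / 2)) ^ ?n"
      by (intro power_mono mult_left_mono cosh_le_exp_square) auto
    also have "\<dots> = 2 ^ ?n * exp ((?n * x) * g\<^sup>2 / 2)"
      using assms(2) by (simp add: power_mult_distrib exp_of_nat_mult[symmetric] mult_ac)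
    finally show ?thesis
      unfolding sum_distrib_right[symmetric] mult.assoc[symmetric]
      by (intro mult_right_mono) auto
  qed
  have "(\<Sum>\<sigma>\<in>?S. exp (x * (sum \<sigma> V)\<^sup>2 / 2)) = (\<Sum>\<sigma>\<in>?S. exp ((sqrt x * sum \<sigma> V)\<^sup>2 / 2))"
    using assms(2) by (simp add: power_mult_distrib)
  also have "\<dots> \<le> 2 ^ ?n * (1 / sqrt (1 - ?n * x))"
    using integral_mono[OF integrable.intros[OF 1] integrable.intros[OF 2]] le
    unfolding has_bochner_integral_integral_eq[OF 1] has_bochner_integral_integral_eq[OF 2] by blast
  finally show ?thesis by simp
qed

text \<open>Newton's identity 2 e_2 = p_1^2 - p_2, where p_2 is the number of vertices as spins
  square to 1.\<close>

lemma sum_pairs_spins: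
  assumes "finite V" "\<And>v. v \<in> V \<Longrightarrow> \<sigma> v = 1 \<or> \<sigma> v = (-1::real)"
  shows "(\<Sum>e | e \<subseteq> V \<and> card e = 2. \<Prod>u\<in>e. \<sigma> u) = ((sum \<sigma> V)\<^sup>2 - real (card V)) / 2"
proof -
  have "2 * esum (Suc (Suc 0)) \<sigma> V = (sum \<sigma> V)\<^sup>2 - (\<Sum>v\<in>V. (\<sigma> v)\<^sup>2)"
    using assms(1)
    by (induction V rule: finite_induct)
      (simp_all add: esum_empty esum_insert esum_1 power2_eq_square algebra_simps)
  also have "(\<Sum>v\<in>V. (\<sigma> v)\<^sup>2) = (\<Sum>v\<in>V. 1)"
    using assms(2) by (intro sum.cong refl) force
  finally show ?thesis by (simp add: esum_def numeral_2_eq_2)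
qed

text \<open>In the exponent, - n x / 2 comes from the diagonal of the squared magnetisation and - N
  x^2 / 2 from the second-order term of ln (1 + y), with N the number of possible edges. For x of
  order 1 / n both stay of order 1 and must be kept, whereas N x^3 tends to 0; so a cubic error term
  is good enough.\<close>

lemma even_sum_complete_le:
  assumes "0 \<le> x" "x < 1" "real n * x < 1"
  shows "even_sum {1..n} (all_edges n) x \<le>
    exp (- (real n * x) / 2 - real (n choose 2) * x\<^sup>2 / 2 + real (n choose 2) * x ^ 3 / 3) / sqrt (1 - real n * x)"
proof -
  let ?S = "{1..n} \<rightarrow>\<^sub>E {-1, 1::real}" and ?N = "real (n choose 2)"
  let ?c = "- (real n * x) / 2 - ?N * x\<^sup>2 / 2 + ?N * x ^ 3 / 3"
  have le: "(\<Prod>e\<in>all_edges n. 1 + x * (\<Prod>u\<in>e. \<sigma> u)) \<le> exp ?c * exp (x * (sum \<sigma> {1..n})\<^sup>2 / 2)"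
    if \<sigma>: "\<sigma> \<in> ?S" for \<sigma>
  proof -
    have "(\<Prod>e\<in>all_edges n. 1 + x * (\<Prod>u\<in>e. \<sigma> u))
        \<le> (\<Prod>e\<in>all_edges n. exp (x * (\<Prod>u\<in>e. \<sigma> u) - x\<^sup>2 / 2 + x ^ 3 / 3))"
    proof (rule prod_mono)
      fix e assume "e \<in> all_edges n"
      then consider "(\<Prod>u\<in>e. \<sigma> u) = 1" | "(\<Prod>u\<in>e. \<sigma> u) = -1"
        using edge_spin_values[OF \<sigma>] all_edges_subset by blast
      then show "0 \<le> 1 + x * (\<Prod>u\<in>e. \<sigma> u) \<and> 1 + x * (\<Prod>u\<in>e. \<sigma> u)
          \<le> exp (x * (\<Prod>u\<in>e. \<sigma> u) - x\<^sup>2 / 2 + x ^ 3 / 3)"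
      proof cases
        case 1
        then show ?thesis using one_plus_le_exp_cubic[of x] assms by simp
      next
        case 2
        have "1 + - x \<le> exp (- x - x\<^sup>2 / 2 + (- x) ^ 3 / 3)"
          using one_plus_le_exp_cubic[of "- x"] assms by simp
        \<comment> \<open>Giving up the favourable sign of the cubic term makes the correction the
          same for both values of the spin product.\<close>
        also have "\<dots> \<le> exp (- x - x\<^sup>2 / 2 + x ^ 3 / 3)"
          using assms(1) by (simp add: power3_eq_cube)
        finally show ?thesis using 2 assms by simp
      qed
    qed
    also have "\<dots> = exp (\<Sum>e\<in>all_edges n. x * (\<Prod>u\<in>e. \<sigma> u) - x\<^sup>2 / 2 + x ^ 3 / 3)"
      by (simp add: exp_sum)
    also have "(\<Sum>e\<in>all_edges n. x * (\<Prod>u\<in>e. \<sigma> u) - x\<^sup>2 / 2 + x ^ 3 / 3)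
        = x * (\<Sum>e\<in>all_edges n. \<Prod>u\<in>e. \<sigma> u) - ?N * x\<^sup>2 / 2 + ?N * x ^ 3 / 3"
      by (simp add: sum.distrib sum_subtractf sum_distrib_left card_all_edges)
    also have "(\<Sum>e\<in>all_edges n. \<Prod>u\<in>e. \<sigma> u) = ((sum \<sigma> {1..n})\<^sup>2 - real n) / 2"
      unfolding all_edges_def using sum_pairs_spins[of "{1..n}" \<sigma>] spin_values[OF \<sigma>] by simp
    also have "x * (((sum \<sigma> {1..n})\<^sup>2 - real n) / 2) - ?N * x\<^sup>2 / 2 + ?N * x ^ 3 / 3
        = ?c + x * (sum \<sigma> {1..n})\<^sup>2 / 2"
      by (simp add: right_diff_distrib diff_divide_distrib mult.commute)
    finally show ?thesis by (simp only: exp_add)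
  qed
  have "2 ^ n * even_sum {1..n} (all_edges n) x = (\<Sum>\<sigma>\<in>?S. \<Prod>e\<in>all_edges n. 1 + x * (\<Prod>u\<in>e. \<sigma> u))"
    using sum_spins_prod[OF finite_all_edges[of n], where V = "{1..n}" and t = x] by simp
  also have "\<dots> \<le> (\<Sum>\<sigma>\<in>?S. exp ?c * exp (x * (sum \<sigma> {1..n})\<^sup>2 / 2))"
    by (intro sum_mono le)
  also have "\<dots> = exp ?c * (\<Sum>\<sigma>\<in>?S. exp (x * (sum \<sigma> {1..n})\<^sup>2 / 2))"
    by (rule sum_distrib_left[symmetric])
  also have "\<dots> \<le> exp ?c * (2 ^ n / sqrt (1 - real n * x))"
    using curie_weiss_le[of "{1..n}" x] assms by (intro mult_left_mono) auto
  finally have "2 ^ n * even_sum {1..n} (all_edges n) x \<le> 2 ^ n * (exp ?c / sqrt (1 - real n * x))"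
    by (simp add: mult_ac)
  then show ?thesis by (simp only: mult_le_cancel_left_pos zero_less_power zero_less_numeral)
qed

section \<open>Sparse asymptotics\<close>

text \<open>Sets of cycles of the graph \<open>E\<close> become families from a fixed collection
  whose union lies in \<open>E\<close>, the form in which inclusion probabilities apply.\<close>

lemma esum_eq_families:
  "finite A \<Longrightarrow> esum k f {c \<in> A. c \<subseteq> E} = (\<Sum>F | F \<in> {F. F \<subseteq> A \<and> card F = k} \<and> \<Union>F \<subseteq> E. prod f F)"
  unfolding esum_def by (rule sum.cong) auto

lemma real_choose_two: "real (n choose 2) = real n * (real n - 1) / 2"
proof (cases n)
  case (Suc k)
  have "even (n * (n - 1))" using Suc by (cases "even k") auto
  then have "real (n * (n - 1) div 2) = real (n * (n - 1)) / 2"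
    by (simp add: real_of_nat_div)
  then show ?thesis using Suc by (simp add: choose_two algebra_simps)
qed simp

locale sparse_graph =
  fixes d :: real and m :: "nat \<Rightarrow> nat"
  assumes d_pos: "d > 0" and m_lim: "(\<lambda>n. 2 * real (m n) / real n) \<longlonglongrightarrow> d"
begin

definition p :: "nat \<Rightarrow> real" where "p n = real (m n) / real (n choose 2)"

lemma m_at_top: "filterlim (\<lambda>n. real (m n)) at_top sequentially"
proof -
  have lim: "filterlim (\<lambda>n. (2 * real (m n) / real n) * (real n * (1 / 2))) at_top sequentially"
    by (rule filterlim_tendsto_pos_mult_at_top[OF m_lim d_pos])
      (intro filterlim_at_top_mult_tendsto_pos[OF tendsto_const] filterlim_real_sequentially, simp)
  have ev: "\<forall>\<^sub>F n in sequentially. (2 * real (m n) / real n) * (real n * (1 / 2)) = real (m n)"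
    using eventually_gt_at_top[of 0] by eventually_elim simp
  show ?thesis by (rule iffD1[OF filterlim_cong[OF refl refl ev] lim])
qed

lemma n_ratio: "(\<lambda>n. real n / (real n - 1)) \<longlonglongrightarrow> 1"
  by real_asymp

lemma np_lim: "(\<lambda>n. real n * p n) \<longlonglongrightarrow> d"
proof -
  have "(\<lambda>n. (2 * real (m n) / real n) * (real n / (real n - 1))) \<longlonglongrightarrow> d * 1"
    by (intro tendsto_mult m_lim n_ratio)
  moreover have "\<forall>\<^sub>F n in sequentially. (2 * real (m n) / real n) * (real n / (real n - 1)) = real n * p n"
    using eventually_gt_at_top[of 1]
  proof eventually_elim
    case (elim n)
    then have "real n \<noteq> 0" "real n - 1 \<noteq> 0" by auto
    then show ?case by (simp add: p_def real_choose_two field_simps)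
  qed
  ultimately show ?thesis by (auto intro: Lim_transform_eventually)
qed

lemma p_lim: "p \<longlonglongrightarrow> 0"
proof -
  have "(\<lambda>n. (real n * p n) * (1 / real n)) \<longlonglongrightarrow> d * 0"
    by (intro tendsto_mult np_lim lim_1_over_n)
  moreover have "\<forall>\<^sub>F n in sequentially. (real n * p n) * (1 / real n) = p n"
    using eventually_gt_at_top[of 0] by eventually_elim simp
  ultimately show ?thesis by (auto intro: Lim_transform_eventually)
qed

lemma p_nonneg: "p n \<ge> 0" by (simp add: p_def)

lemma choose_two_at_top: "filterlim (\<lambda>n. real (n choose 2)) at_top sequentially"
  unfolding real_choose_two by real_asymp

lemma ev_good: "\<forall>\<^sub>F n in sequentially. m n \<le> n choose 2 \<and> 0 < p n \<and> p n \<le> 1 \<and> 0 < n choose 2"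
proof -
  have "\<forall>\<^sub>F n in sequentially. p n < 1" using p_lim by (rule order_tendstoD) simp
  moreover have "\<forall>\<^sub>F n in sequentially. real (m n) > 0"
    using m_at_top unfolding filterlim_at_top_dense by blast
  moreover have "\<forall>\<^sub>F n in sequentially. real (n choose 2) > 0"
    using choose_two_at_top unfolding filterlim_at_top_dense by blast
  ultimately show ?thesis
  proof eventually_elim
    case (elim n)
    have "p n > 0" using elim by (simp add: p_def)
    moreover have "real (m n) < real (n choose 2)" using elim by (simp add: p_def field_simps)
    ultimately show ?case using elim by simp
  qed
qed

lemma Np2_lim: "(\<lambda>n. real (n choose 2) * (p n)\<^sup>2) \<longlonglongrightarrow> d\<^sup>2 / 2"
proof -
  have "(\<lambda>n. (real n * p n)\<^sup>2 * ((real n - 1) / real n) / 2) \<longlonglongrightarrow> d\<^sup>2 * 1 / 2"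
    by (intro tendsto_divide tendsto_mult tendsto_power np_lim tendsto_const) (real_asymp | simp)+
  moreover have "\<forall>\<^sub>F n in sequentially. (real n * p n)\<^sup>2 * ((real n - 1) / real n) / 2 = real (n choose 2) * (p n)\<^sup>2"
    using eventually_gt_at_top[of 0]
    by eventually_elim (simp add: real_choose_two power2_eq_square field_simps)
  ultimately show ?thesis by (auto intro: Lim_transform_eventually)
qed

lemma card_cycles_lim:
  assumes "l \<ge> 3"
  shows "(\<lambda>n. real (card (cycles {1..n} l)) * p n ^ l) \<longlonglongrightarrow> d ^ l / (2 * real l)"
proof -
  have "(\<lambda>n. (real n - real i) * p n) \<longlonglongrightarrow> d" for i
  proof -
    have "(\<lambda>n. real n * p n - real i * p n) \<longlonglongrightarrow> d - real i * 0"
      by (intro tendsto_diff np_lim tendsto_mult tendsto_const p_lim)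
    then show ?thesis by (simp add: left_diff_distrib)
  qed
  then have "(\<lambda>n. (\<Prod>i<l. (real n - real i) * p n) / (2 * real l)) \<longlonglongrightarrow> (\<Prod>i<l. d) / (2 * real l)"
    using assms by (intro tendsto_divide tendsto_prod tendsto_const) auto
  moreover have "\<forall>\<^sub>F n in sequentially. (\<Prod>i<l. (real n - real i) * p n) / (2 * real l)
      = real (card (cycles {1..n} l)) * p n ^ l"
    using eventually_ge_at_top[of l]
  proof eventually_elim
    case (elim n)
    have "(\<Prod>i<l. real n - real i) = (\<Prod>i<l. real (n - i))"
      using elim by (intro prod.cong) (auto simp: of_nat_diff)
    \<comment> \<open>With \<open>j = n - i\<close> the falling factorial becomes the product over
      the top \<open>l\<close> integers that occurs in the count of cycles.\<close>
    also have "\<dots> = (\<Prod>j\<in>{n - l + 1..n}. real j)"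
      using elim by (intro prod.reindex_bij_witness[of _ "\<lambda>j. n - j" "\<lambda>i. n - i"]) auto
    also have "\<dots> = real (2 * l * card (cycles {1..n} l))"
      using card_cycles[of "{1..n}" l] assms elim by (simp only:) simp
    finally have "(\<Prod>i<l. (real n - real i) * p n) = real (2 * l * card (cycles {1..n} l)) * p n ^ l"
      by (simp only: prod.distrib prod_constant card_lessThan)
    then show ?case using assms by simp
  qed
  ultimately show ?thesis by (auto intro: Lim_transform_eventually)
qed

lemma cycle_sum_lim:
  fixes u :: "nat \<Rightarrow> 'c::real_normed_field"
  shows "(\<lambda>n. \<Sum>c\<in>short_cycles {1..n} L. u (card c) * of_real (p n ^ card c))
    \<longlonglongrightarrow> (\<Sum>l=3..L. u l * of_real (d ^ l / (2 * real l)))"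
proof -
  have "(\<Sum>c\<in>short_cycles {1..n} L. u (card c) * of_real (p n ^ card c))
      = (\<Sum>l=3..L. u l * of_real (real (card (cycles {1..n} l)) * p n ^ l))" for n
  proof -
    have "(\<Sum>c\<in>cycles {1..n} l. u (card c) * of_real (p n ^ card c))
        = (\<Sum>c\<in>cycles {1..n} l. u l * of_real (p n ^ l))" if "l \<in> {3..L}" for l
      using that by (intro sum.cong) (auto elim!: cyclesE)
    then show ?thesis
      by (simp add: sum_short_cycles mult.commute mult.left_commute)
  qed
  then show ?thesis
    by (simp only:) (intro tendsto_sum tendsto_mult tendsto_const tendsto_of_real card_cycles_lim, simp)
qed

text \<open>The error in passing to a power of the plain sum contains a squared cycle weight, and
  \<open>p ^ l * p ^ l\<close> is at most \<open>p * p ^ l\<close>. The sum over cycles converges,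
  so the error is of order \<open>p\<close>.\<close>

lemma esum_lim:
  fixes u :: "nat \<Rightarrow> 'c::real_normed_field"
  assumes u: "\<And>l. norm (u l) \<le> U"
  shows "(\<lambda>n. esum k (\<lambda>c. u (card c) * of_real (p n ^ card c)) (short_cycles {1..n} L))
    \<longlonglongrightarrow> (\<Sum>l=3..L. u l * of_real (d ^ l / (2 * real l))) ^ k / fact k"
proof -
  let ?C = "\<lambda>n. short_cycles {1..n} L"
  let ?f = "\<lambda>n c. u (card c) * of_real (p n ^ card c)"
  define S where "S n = (\<Sum>c\<in>?C n. p n ^ card c)" for n
  have U: "U \<ge> 0" using u[of 0] norm_ge_zero order_trans by blast
  obtain s where S: "S \<longlonglongrightarrow> s"
    using cycle_sum_lim[of "\<lambda>_. 1::real" L] unfolding S_def by auto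
  have le: "\<forall>\<^sub>F n in sequentially. norm (esum k (?f n) (?C n) - sum (?f n) (?C n) ^ k / fact k)
      \<le> U\<^sup>2 * (p n * S n) * (U * S n) ^ (k - 2)"
    using ev_good
  proof eventually_elim
    case (elim n)
    have fC: "finite (?C n)" by (simp add: finite_short_cycles)
    have nf: "norm (?f n c) \<le> U * p n ^ card c" for c
      using u[of "card c"] p_nonneg[of n] by (simp add: norm_mult norm_power mult_right_mono)
    have S1: "(\<Sum>c\<in>?C n. norm (?f n c)) \<le> U * S n"
      unfolding S_def sum_distrib_left by (intro sum_mono nf)
    have S2: "(\<Sum>c\<in>?C n. (norm (?f n c))\<^sup>2) \<le> U\<^sup>2 * (p n * S n)"
      unfolding S_def sum_distrib_left
    proof (rule sum_mono)
      fix c assume "c \<in> ?C n"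
      then have "card c \<ge> 1" using short_cycle_facts(2)[of c "{1..n}" L] by simp
      have "(norm (?f n c))\<^sup>2 \<le> (U * p n ^ card c)\<^sup>2"
        by (intro power_mono nf) auto
      also have "\<dots> = U\<^sup>2 * (p n ^ card c * p n ^ card c)" by (simp add: power2_eq_square mult_ac)
      also have "p n ^ card c * p n ^ card c \<le> p n ^ 1 * p n ^ card c"
        using elim \<open>card c \<ge> 1\<close> by (intro mult_right_mono power_decreasing) auto
      finally show "(norm (?f n c))\<^sup>2 \<le> U\<^sup>2 * (p n * p n ^ card c)"
        by (simp add: mult_left_mono)
    qed
    have "norm (esum k (?f n) (?C n) - sum (?f n) (?C n) ^ k / fact k)
      \<le> (\<Sum>c\<in>?C n. (norm (?f n c))\<^sup>2) * (\<Sum>c\<in>?C n. norm (?f n c)) ^ (k - 2)"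
      by (rule esum_approx_power[OF fC])
    also have "\<dots> \<le> U\<^sup>2 * (p n * S n) * (U * S n) ^ (k - 2)"
      by (intro mult_mono S2 power_mono S1 sum_nonneg zero_le_power)
        (use order_trans[OF sum_nonneg S2] in auto)
    finally show ?case .
  qed
  have "(\<lambda>n. U\<^sup>2 * (p n * S n) * (U * S n) ^ (k - 2)) \<longlonglongrightarrow> U\<^sup>2 * (0 * s) * (U * s) ^ (k - 2)"
    by (intro tendsto_mult tendsto_power tendsto_const p_lim S)
  then have "(\<lambda>n. U\<^sup>2 * (p n * S n) * (U * S n) ^ (k - 2)) \<longlonglongrightarrow> 0" by simp
  from Lim_null_comparison[OF le this]
  have "(\<lambda>n. esum k (?f n) (?C n) - sum (?f n) (?C n) ^ k / fact k) \<longlonglongrightarrow> 0" .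
  moreover have "(\<lambda>n. sum (?f n) (?C n) ^ k / fact k) \<longlonglongrightarrow> (\<Sum>l=3..L. u l * of_real (d ^ l / (2 * real l))) ^ k / fact k"
    by (intro tendsto_divide tendsto_power cycle_sum_lim tendsto_const) simp
  ultimately show ?thesis using tendsto_add by fastforce
qed

lemma ext_bound_lim: "(\<lambda>n. ext_bound L (real (card {1..n}) * p n) k) \<longlonglongrightarrow> ext_bound L d k"
  unfolding ext_bound_def using np_lim by (auto intro!: tendsto_intros)

lemma p_ext_bound_lim: "(\<lambda>n. c * p n * ext_bound L (real (card {1..n}) * p n) k ^ k) \<longlonglongrightarrow> 0"
proof -
  have "(\<lambda>n. c * p n * ext_bound L (real (card {1..n}) * p n) k ^ k) \<longlonglongrightarrow> c * 0 * ext_bound L d k ^ k"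
    by (intro tendsto_mult tendsto_power tendsto_const p_lim ext_bound_lim)
  then show ?thesis by simp
qed

abbreviation q :: "nat \<Rightarrow> nat \<Rightarrow> real" where "q n j \<equiv> incl_prob (n choose 2) (m n) j"

lemma disjoint_families_lim:
  fixes u :: "nat \<Rightarrow> 'c::real_normed_field"
  assumes u: "\<And>l. norm (u l) \<le> U"
  shows "(\<lambda>n. \<Sum>F | F \<subseteq> short_cycles {1..n} L \<and> card F = k \<and> disjoint_family_on Union F.
        (\<Prod>c\<in>F. u (card c)) * of_real (q n (card (\<Union>F))))
    \<longlonglongrightarrow> (\<Sum>l=3..L. u l * of_real (d ^ l / (2 * real l))) ^ k / fact k"
    (is "?D \<longlonglongrightarrow> ?s")
proof -
  have U: "U \<ge> 0" using u[of 0] norm_ge_zero order_trans by blast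
  let ?E = "\<lambda>n. esum k (\<lambda>c. u (card c) * of_real (p n ^ card c)) (short_cycles {1..n} L)"
  \<comment> \<open>A family of \<open>k\<close> cycles of length at most \<open>L\<close> has at
    most \<open>k * L\<close> edges; so a finite sum of relative errors bounds all of them at once
    and still tends to 0.\<close>
  define \<delta> where "\<delta> n = (\<Sum>j\<le>k * L. \<bar>q n j / p n ^ j - 1\<bar>)" for n
  have "(\<lambda>n. \<bar>q n j / p n ^ j - 1\<bar>) \<longlonglongrightarrow> \<bar>1 - 1\<bar>" for j
    unfolding p_def
    by (intro tendsto_rabs tendsto_diff tendsto_const tendsto_incl_prob_ratio m_at_top choose_two_at_top)
  then have \<delta>: "\<delta> \<longlonglongrightarrow> 0" unfolding \<delta>_def by (intro tendsto_null_sum) simp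
  have le: "\<forall>\<^sub>F n in sequentially. norm (?D n - ?E n) \<le>
      U ^ k * (\<delta> n + p n) * ext_bound L (real (card {1..n}) * p n) k ^ k"
    using ev_good
  proof eventually_elim
    case (elim n)
    show ?case
    proof (rule disjoint_families_approx)
      show "\<delta> n \<ge> 0" unfolding \<delta>_def by (intro sum_nonneg) auto
      fix j assume j: "j \<le> k * L"
      have "\<bar>q n j / p n ^ j - 1\<bar> \<le> \<delta> n"
        unfolding \<delta>_def using j by (intro member_le_sum) auto
      then have "\<bar>q n j / p n ^ j - 1\<bar> * p n ^ j \<le> \<delta> n * p n ^ j"
        using elim by (intro mult_right_mono) auto
      moreover have "\<bar>q n j / p n ^ j - 1\<bar> * p n ^ j = \<bar>(q n j / p n ^ j - 1) * p n ^ j\<bar>"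
        using elim by (simp add: abs_mult)
      moreover have "(q n j / p n ^ j - 1) * p n ^ j = q n j - p n ^ j"
        using elim by (simp add: field_simps)
      ultimately show "\<bar>q n j - p n ^ j\<bar> \<le> \<delta> n * p n ^ j" by simp
    qed (use elim u U in auto)
  qed
  have "(\<lambda>n. U ^ k * (\<delta> n + p n) * ext_bound L (real (card {1..n}) * p n) k ^ k)
      \<longlonglongrightarrow> U ^ k * (0 + 0) * ext_bound L d k ^ k"
    by (intro tendsto_mult tendsto_add tendsto_power tendsto_const \<delta> p_lim ext_bound_lim)
  then have "(\<lambda>n. U ^ k * (\<delta> n + p n) * ext_bound L (real (card {1..n}) * p n) k ^ k) \<longlonglongrightarrow> 0" by simp
  from tendsto_add[OF Lim_null_comparison[OF le this] esum_lim[where u = u, OF u, where k = k and L = L]]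
  show ?thesis by simp
qed

text \<open>For \<open>k = 2\<close> the sum is the expected number of pairs of short cycles that
  share a vertex.\<close>

lemma meeting_families_lim:
  "(\<lambda>n. \<Sum>F | F \<subseteq> short_cycles {1..n} L \<and> card F = k \<and> \<not> disjoint_family_on Union F.
      q n (card (\<Union>F))) \<longlonglongrightarrow> 0"
proof (rule Lim_null_comparison[OF _ p_ext_bound_lim[of 1 L k]])
  show "\<forall>\<^sub>F n in sequentially. norm (\<Sum>F | F \<subseteq> short_cycles {1..n} L \<and> card F = k \<and>
      \<not> disjoint_family_on Union F. q n (card (\<Union>F)))
      \<le> 1 * p n * ext_bound L (real (card {1..n}) * p n) k ^ k"
    using ev_good
  proof eventually_elim
    case (elim n)
    let ?N = "{F. F \<subseteq> short_cycles {1..n} L \<and> card F = k \<and> \<not> disjoint_family_on Union F}"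
    have "norm (\<Sum>F\<in>?N. q n (card (\<Union>F))) = (\<Sum>F\<in>?N. q n (card (\<Union>F)))"
      using elim by (simp add: sum_nonneg incl_prob_bounds)
    also have "\<dots> \<le> (\<Sum>F\<in>?N. p n ^ card (\<Union>F))"
      unfolding p_def using elim by (intro sum_mono incl_prob_bounds) auto
    also have "\<dots> \<le> p n * ext_bound L (real (card {1..n}) * p n) k ^ k"
      using elim by (intro sum_meeting_families_le) auto
    finally show ?case by simp
  qed
qed

text \<open>Expanding a product over the short cycles of the random graph involves every family, not
  only the disjoint ones; the meeting families add a vanishing amount.\<close>

lemma all_families_lim:
  fixes u :: "nat \<Rightarrow> 'c::real_normed_field"
  assumes u: "\<And>l. norm (u l) \<le> U"
  shows "(\<lambda>n. \<Sum>F | F \<subseteq> short_cycles {1..n} L \<and> card F = k.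
        (\<Prod>c\<in>F. u (card c)) * of_real (q n (card (\<Union>F))))
    \<longlonglongrightarrow> (\<Sum>l=3..L. u l * of_real (d ^ l / (2 * real l))) ^ k / fact k"
proof -
  let ?g = "\<lambda>n F. (\<Prod>c\<in>F. u (card c)) * of_real (q n (card (\<Union>F)))"
  let ?A = "\<lambda>n. {F. F \<subseteq> short_cycles {1..n} L \<and> card F = k}"
  let ?D = "\<lambda>n. {F. F \<subseteq> short_cycles {1..n} L \<and> card F = k \<and> disjoint_family_on Union F}"
  let ?N = "\<lambda>n. {F. F \<subseteq> short_cycles {1..n} L \<and> card F = k \<and> \<not> disjoint_family_on Union F}"
  have split: "sum (?g n) (?A n) = sum (?g n) (?D n) + sum (?g n) (?N n)" for n
  proof -
    have fA: "finite (?A n)" by (simp add: finite_subsets_card finite_short_cycles)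
    have "finite (?D n)" "finite (?N n)" by (rule finite_subset[OF _ fA], auto)+
    moreover have "?A n = ?D n \<union> ?N n" "?D n \<inter> ?N n = {}" by auto
    ultimately show ?thesis by (metis (no_types, lifting) sum.union_disjoint)
  qed
  have "(\<lambda>n. sum (?g n) (?N n)) \<longlonglongrightarrow> 0"
  proof (rule Lim_null_comparison)
    show "(\<lambda>n. U ^ k * (\<Sum>F\<in>?N n. q n (card (\<Union>F)))) \<longlonglongrightarrow> 0"
      using tendsto_mult_right_zero[OF meeting_families_lim[of L k]] by simp
    show "\<forall>\<^sub>F n in sequentially. norm (sum (?g n) (?N n)) \<le> U ^ k * (\<Sum>F\<in>?N n. q n (card (\<Union>F)))"
      using ev_good
    proof eventually_elim
      case (elim n)
      show ?case unfolding sum_distrib_left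
      proof (rule sum_norm_le)
        fix F assume F: "F \<in> ?N n"
        have "norm (\<Prod>c\<in>F. u (card c)) \<le> (\<Prod>c\<in>F. U)"
          unfolding prod_norm[symmetric] using u by (intro prod_mono) auto
        then have "norm (\<Prod>c\<in>F. u (card c)) \<le> U ^ k" using F by simp
        moreover have "q n (card (\<Union>F)) \<ge> 0" using elim by (simp add: incl_prob_bounds)
        ultimately show "norm (?g n F) \<le> U ^ k * q n (card (\<Union>F))"
          by (simp add: norm_mult mult_right_mono)
      qed
    qed
  qed
  from tendsto_add[OF disjoint_families_lim[where u = u, OF u] this] show ?thesis unfolding split by simp
qed

end

section \<open>Convergence of characteristic functions\<close>

lemma norm_iexp_diff_le: "cmod (iexp a - iexp b) \<le> \<bar>a - b\<bar>"
proof -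
  have "iexp a - iexp b = iexp b * (iexp (a - b) - 1)"
    by (simp add: right_diff_distrib exp_add[symmetric] of_real_diff algebra_simps)
  then have "cmod (iexp a - iexp b) = cmod (iexp (a - b) - 1)"
    by (simp add: norm_mult)
  also have "\<dots> \<le> \<bar>a - b\<bar>" using iexp_approx1[of "a - b" 0] by simp
  finally show ?thesis .
qed

lemma exp_series_lim:
  fixes s :: "'c::{real_normed_field, banach}"
  shows "(\<lambda>r. \<Sum>k<r. s ^ k / fact k) \<longlonglongrightarrow> exp s" "(\<lambda>r. s ^ r / fact r) \<longlonglongrightarrow> 0"
proof -
  have "(\<lambda>k. s ^ k / fact k) sums exp s"
    using exp_converges[of s] by (simp add: scaleR_conv_of_real divide_inverse mult.commute)
  then show "(\<lambda>r. \<Sum>k<r. s ^ k / fact k) \<longlonglongrightarrow> exp s" "(\<lambda>r. s ^ r / fact r) \<longlonglongrightarrow> 0"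
    by (simp_all add: sums_def summable_LIMSEQ_zero sums_summable)
qed

lemma short_cycle_edges: "c \<in> short_cycles {1..n} L \<Longrightarrow> c \<subseteq> all_edges n"
  using short_cycle_facts(5,7)[of c "{1..n}" L] by (auto simp: all_edges_def)

lemma family_edges: "F \<subseteq> short_cycles {1..n} L \<Longrightarrow> \<Union>F \<subseteq> all_edges n"
  using short_cycle_edges by blast

context sparse_graph
begin

definition cyc :: "nat \<Rightarrow> nat \<Rightarrow> nat set set \<Rightarrow> nat set set set" where
  "cyc n L E = {c \<in> short_cycles {1..n} L. c \<subseteq> E}"

abbreviation "expect n f \<equiv> measure_pmf.expectation (random_graph n (m n)) f"

lemma integrable_rg:
  fixes f :: "nat graph \<Rightarrow> 'c::{banach, second_countable_topology}"
  assumes "m n \<le> n choose 2"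
  shows "integrable (measure_pmf (random_graph n (m n))) f"
  by (rule integrable_measure_pmf_finite) (simp add: set_pmf_random_graph assms finite_graphs_nm)

lemma finite_cyc: "finite (cyc n L E)"
  by (simp add: cyc_def finite_short_cycles)

text \<open>For \<open>u\<close> constantly 1 this is the convergence of factorial moments to
  Poisson ones, with l-cycles contributing the rate d^l / (2 l). A general weight \<open>u\<close>
  handles the joint law of all lengths up to \<open>L\<close> at once.\<close>

lemma expect_esum_lim:
  fixes u :: "nat \<Rightarrow> 'c::{real_normed_field, banach, second_countable_topology}"
  assumes u: "\<And>l. norm (u l) \<le> U"
  shows "(\<lambda>n. expect n (\<lambda>G. esum k (\<lambda>c. u (card c)) (cyc n L (snd G))))
    \<longlonglongrightarrow> (\<Sum>l=3..L. u l * of_real (d ^ l / (2 * real l))) ^ k / fact k"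
proof (rule Lim_transform_eventually[OF all_families_lim[where u = u, OF u, where k = k and L = L]])
  show "\<forall>\<^sub>F n in sequentially. (\<Sum>F | F \<subseteq> short_cycles {1..n} L \<and> card F = k.
      (\<Prod>c\<in>F. u (card c)) * of_real (q n (card (\<Union>F)))) =
      expect n (\<lambda>G. esum k (\<lambda>c. u (card c)) (cyc n L (snd G)))"
    using ev_good
  proof eventually_elim
    case (elim n)
    have fin: "finite {F. F \<subseteq> short_cycles {1..n} L \<and> card F = k}"
      by (intro finite_subsets_card finite_short_cycles) simp
    have "\<Union>F \<subseteq> all_edges n" if "F \<in> {F. F \<subseteq> short_cycles {1..n} L \<and> card F = k}" for F
      using that family_edges by blast
    note eq = expectation_subset_sum[where A = "\<lambda>F. \<Union>F", OF _ fin this]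
    show ?case
      unfolding cyc_def esum_eq_families[OF finite_short_cycles[OF finite_atLeastAtMost]]
      using elim by (subst eq) auto
  qed
qed

text \<open>The characteristic function is the expectation of a product over the short cycles of
  factors 1 + u with modulus 1. Truncating its expansion at \<open>r\<close> cycles leaves finitely
  many convergent expectations, and the error is bounded by a real symmetric sum of the same kind,
  as the norms of u are at most 2.\<close>

lemma char_short_cycles_lim:
  "(\<lambda>n. expect n (\<lambda>G. iexp (\<theta> * (\<Sum>c\<in>cyc n L (snd G). a (card c)))))
    \<longlonglongrightarrow> exp (\<Sum>l=3..L. (iexp (\<theta> * a l) - 1) * of_real (d ^ l / (2 * real l)))"
proof (rule tendstoI)
  fix e :: real assume e: "e > 0"
  define u where "u l = iexp (\<theta> * a l) - 1" for l
  define s where "s = (\<Sum>l=3..L. u l * of_real (d ^ l / (2 * real l)))"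
  \<comment> \<open>\<open>S ^ r / fact r\<close> is the limit in \<open>n\<close> of the expected
    remainder; it tends to 0 in \<open>r\<close>, so \<open>r\<close> can be fixed before
    \<open>n\<close>.\<close>
  define S where "S = (\<Sum>l=3..L. 2 * (d ^ l / (2 * real l)))"
  have u2: "norm (u l) \<le> 2" for l
    unfolding u_def using norm_triangle_ineq4[of "iexp (\<theta> * a l)" 1] by simp
  have "\<forall>\<^sub>F r in sequentially. dist (\<Sum>k<r. s ^ k / fact k) (exp s) < e / 4"
    using exp_series_lim(1)[of s] e by (intro tendstoD) auto
  moreover have "\<forall>\<^sub>F r in sequentially. S ^ r / fact r < e / 4"
    using exp_series_lim(2)[of S] e by (intro order_tendstoD(2)) auto
  ultimately have "\<forall>\<^sub>F r in sequentially. dist (\<Sum>k<r. s ^ k / fact k) (exp s) < e / 4 \<and> S ^ r / fact r < e / 4"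
    by (rule eventually_conj)
  then obtain r where r: "dist (\<Sum>k<r. s ^ k / fact k) (exp s) < e / 4" "S ^ r / fact r < e / 4"
    by (auto simp: eventually_sequentially)
  let ?Z = "\<lambda>n G. iexp (\<theta> * (\<Sum>c\<in>cyc n L (snd G). a (card c)))"
  let ?T = "\<lambda>n. \<Sum>k<r. expect n (\<lambda>G. esum k (\<lambda>c. u (card c)) (cyc n L (snd G)))"
  let ?R = "\<lambda>n. expect n (\<lambda>G. esum r (\<lambda>c. 2::real) (cyc n L (snd G)))"
  have "?T \<longlonglongrightarrow> (\<Sum>k<r. s ^ k / fact k)"
    unfolding s_def by (intro tendsto_sum expect_esum_lim[where u = u, OF u2])
  then have 1: "\<forall>\<^sub>F n in sequentially. dist (?T n) (\<Sum>k<r. s ^ k / fact k) < e / 4"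
    using e by (intro tendstoD) auto
  have "?R \<longlonglongrightarrow> S ^ r / fact r"
    using expect_esum_lim[of "\<lambda>_. 2::real" 2 r L] by (simp add: S_def)
  then have 2: "\<forall>\<^sub>F n in sequentially. ?R n < e / 4"
    using r(2) by (intro order_tendstoD(2))
  have 3: "\<forall>\<^sub>F n in sequentially. dist (expect n (?Z n)) (?T n) \<le> ?R n"
    using ev_good
  proof eventually_elim
    case (elim n)
    then have mn: "m n \<le> n choose 2" by simp
    note int = integrable_rg[OF mn]
    have pt: "norm (?Z n G - (\<Sum>k<r. esum k (\<lambda>c. u (card c)) (cyc n L (snd G))))
        \<le> esum r (\<lambda>c. 2::real) (cyc n L (snd G))" for G :: "nat graph"
    proof -
      have "?Z n G = (\<Prod>c\<in>cyc n L (snd G). 1 + u (card c))"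
        using finite_cyc by (simp add: u_def exp_sum[symmetric] sum_distrib_left)
      then have "norm (?Z n G - (\<Sum>k<r. esum k (\<lambda>c. u (card c)) (cyc n L (snd G))))
          \<le> esum r (\<lambda>c. norm (u (card c))) (cyc n L (snd G))"
        using prod_trunc_le_esum[OF finite_cyc, of n L "snd G" "\<lambda>c. u (card c)" r]
        by (simp add: u_def)
      also have "\<dots> \<le> esum r (\<lambda>c. 2) (cyc n L (snd G))"
        unfolding esum_def using u2 by (intro sum_mono prod_mono) auto
      finally show ?thesis .
    qed
    have "dist (expect n (?Z n)) (?T n) =
        norm (expect n (\<lambda>G. ?Z n G - (\<Sum>k<r. esum k (\<lambda>c. u (card c)) (cyc n L (snd G)))))"
      by (simp add: int dist_norm Bochner_Integration.integral_diff Bochner_Integration.integral_sum)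
    also have "\<dots> \<le> expect n (\<lambda>G. norm (?Z n G - (\<Sum>k<r. esum k (\<lambda>c. u (card c)) (cyc n L (snd G)))))"
      by (rule integral_norm_bound)
    also have "\<dots> \<le> ?R n"
      by (rule integral_mono_AE[OF int int]) (simp only: pt eventually_True)
    finally show ?case .
  qed
  from 1 2 3 have "\<forall>\<^sub>F n in sequentially. dist (expect n (?Z n)) (exp s) < e"
  proof eventually_elim
    case (elim n)
    have "dist (expect n (?Z n)) (exp s) \<le> dist (expect n (?Z n)) (?T n) + dist (?T n) (\<Sum>k<r. s ^ k / fact k)
        + dist (\<Sum>k<r. s ^ k / fact k) (exp s)"
      by (meson add_right_mono dist_triangle order_trans)
    also have "\<dots> < e" using elim r e by simp
    finally show ?case .
  qed
  then show "\<forall>\<^sub>F n in sequentially. dist (expect n (?Z n))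
      (exp (\<Sum>l=3..L. (iexp (\<theta> * a l) - 1) * of_real (d ^ l / (2 * real l)))) < e"
    by (simp only: s_def u_def)
qed

section \<open>First moments and the comparison of logarithms\<close>

definition first_moment_limit :: "real \<Rightarrow> real" where
  "first_moment_limit t = exp (- (d * t) / 2 - (d * t)\<^sup>2 / 4) / sqrt (1 - d * t)"

text \<open>The bound \<open>h\<close> is the Curie--Weiss estimate at weight x = t p. It converges
  because n x tends to d t, N x^2 to (d t)^2 / 2 and N x^3 to 0, where N is the number of possible
  edges.\<close>

lemma expectation_even_sum_bound:
  assumes "0 < t" "t < 1" "d * t < 1"
  obtains h where "h \<longlonglongrightarrow> first_moment_limit t"
    "\<forall>\<^sub>F n in sequentially. expect n (\<lambda>G. even_sum {1..n} (snd G) t) \<le> h n"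
proof
  let ?x = "\<lambda>n. t * p n"
  let ?h = "\<lambda>n. exp (- (real n * ?x n) / 2 - real (n choose 2) * (?x n)\<^sup>2 / 2
    + real (n choose 2) * ?x n ^ 3 / 3) / sqrt (1 - real n * ?x n)"
  have nx: "(\<lambda>n. real n * ?x n) \<longlonglongrightarrow> d * t"
    using tendsto_mult[OF tendsto_const[of t] np_lim] by (simp add: mult_ac)
  have Nx2: "(\<lambda>n. real (n choose 2) * (?x n)\<^sup>2) \<longlonglongrightarrow> t\<^sup>2 * (d\<^sup>2 / 2)"
    using tendsto_mult[OF tendsto_const[of "t\<^sup>2"] Np2_lim] by (simp add: power_mult_distrib mult_ac)
  have x: "?x \<longlonglongrightarrow> 0" using tendsto_mult_right_zero[OF p_lim, of t] by simp
  have Nx3: "(\<lambda>n. real (n choose 2) * ?x n ^ 3) \<longlonglongrightarrow> 0"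
    using tendsto_mult[OF Nx2 x] by (simp add: power2_eq_square power3_eq_cube mult_ac)
  have "?h \<longlonglongrightarrow> exp (- (d * t) / 2 - t\<^sup>2 * (d\<^sup>2 / 2) / 2 + 0 / 3) / sqrt (1 - d * t)"
    using assms by (intro tendsto_intros nx Nx2 Nx3) auto
  moreover have "- (d * t) / 2 - t\<^sup>2 * (d\<^sup>2 / 2) / 2 + 0 / 3 = - (d * t) / 2 - (d * t)\<^sup>2 / 4"
    by (simp add: power_mult_distrib)
  ultimately show "?h \<longlonglongrightarrow> first_moment_limit t" by (simp only: first_moment_limit_def)
  have "\<forall>\<^sub>F n in sequentially. real n * ?x n < 1" using nx assms(3) by (intro order_tendstoD(2))
  then show "\<forall>\<^sub>F n in sequentially. expect n (\<lambda>G. even_sum {1..n} (snd G) t) \<le> ?h n"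
    using ev_good
  proof eventually_elim
    case (elim n)
    have "t * p n \<le> t * 1" using elim assms by (intro mult_left_mono) auto
    then have "?x n < 1" using assms(2) by linarith
    have "expect n (\<lambda>G. even_sum {1..n} (snd G) t) \<le> even_sum {1..n} (all_edges n) (?x n)"
      unfolding p_def using elim assms by (intro expectation_even_sum_le) auto
    also have "\<dots> \<le> ?h n"
      using elim assms \<open>?x n < 1\<close> by (intro even_sum_complete_le) auto
    finally show ?case .
  qed
qed

abbreviation families :: "nat \<Rightarrow> nat \<Rightarrow> nat \<Rightarrow> nat set set set set" where
  "families n L k \<equiv> {F. F \<subseteq> short_cycles {1..n} L \<and> card F = k \<and> disjoint_family_on Union F}"

abbreviation meetings :: "nat \<Rightarrow> nat \<Rightarrow> nat set set set set" where
  "meetings n L \<equiv> {F. F \<subseteq> short_cycles {1..n} L \<and> card F = 2 \<and> \<not> disjoint_family_on Union F}"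

text \<open>The layer of families with exactly \<open>k\<close> cycles. Layers are kept apart
  because convergence in \<open>n\<close> is available for one \<open>k\<close> at a time.\<close>

definition disj_sum :: "nat \<Rightarrow> nat \<Rightarrow> real \<Rightarrow> nat \<Rightarrow> nat set set \<Rightarrow> real" where
  "disj_sum n L t k E = (\<Sum>F | F \<in> families n L k \<and> \<Union>F \<subseteq> E. \<Prod>c\<in>F. t ^ card c)"

text \<open>A count rather than an indicator, so that linearity of expectation applies; it is at
  least 1 whenever two short cycles of the graph meet.\<close>

definition meeting_count :: "nat \<Rightarrow> nat \<Rightarrow> nat set set \<Rightarrow> real" where
  "meeting_count n L E = (\<Sum>F | F \<in> meetings n L \<and> \<Union>F \<subseteq> E. 1)"

lemma finite_families: "finite (families n L k)" "finite (meetings n L)"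
  by (rule finite_subset[of _ "Pow (short_cycles {1..n} L)"]; auto simp: finite_short_cycles)+

lemma expect_disj_sum_lim:
  assumes "0 \<le> t" "t \<le> 1"
  shows "(\<lambda>n. expect n (\<lambda>G. disj_sum n L t k (snd G)))
    \<longlonglongrightarrow> (\<Sum>l=3..L. t ^ l * (d ^ l / (2 * real l))) ^ k / fact k"
proof -
  have "norm (t ^ l) \<le> 1" for l using assms by (simp add: power_le_one)
  from disjoint_families_lim[where u = "\<lambda>l. t ^ l", OF this, where k = k and L = L]
  have "(\<lambda>n. \<Sum>F\<in>families n L k. (\<Prod>c\<in>F. t ^ card c) * q n (card (\<Union>F)))
    \<longlonglongrightarrow> (\<Sum>l=3..L. t ^ l * (d ^ l / (2 * real l))) ^ k / fact k" by simp
  moreover have "\<forall>\<^sub>F n in sequentially. (\<Sum>F\<in>families n L k. (\<Prod>c\<in>F. t ^ card c) * q n (card (\<Union>F)))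
      = expect n (\<lambda>G. disj_sum n L t k (snd G))"
    using ev_good
  proof eventually_elim
    case (elim n)
    have "\<Union>F \<subseteq> all_edges n" if "F \<in> families n L k" for F
      using that family_edges by blast
    note eq = expectation_subset_sum[where A = "\<lambda>F. \<Union>F", OF _ finite_families(1) this]
    show ?case unfolding disj_sum_def using elim by (subst eq) auto
  qed
  ultimately show ?thesis by (rule Lim_transform_eventually)
qed

lemma expect_meeting_count_lim: "(\<lambda>n. expect n (\<lambda>G. meeting_count n L (snd G))) \<longlonglongrightarrow> 0"
proof (rule Lim_transform_eventually[OF meeting_families_lim[of L 2]])
  show "\<forall>\<^sub>F n in sequentially. (\<Sum>F\<in>meetings n L. q n (card (\<Union>F))) = expect n (\<lambda>G. meeting_count n L (snd G))"
    using ev_good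
  proof eventually_elim
    case (elim n)
    have "\<Union>F \<subseteq> all_edges n" if "F \<in> meetings n L" for F
      using that family_edges by blast
    note eq = expectation_subset_sum[where A = "\<lambda>F. \<Union>F", OF _ finite_families(2) this]
    show ?case unfolding meeting_count_def using elim by (subst eq) auto
  qed
qed

text \<open>Let D be the sum over all disjoint families in \<open>E\<close>. If no short cycles
  meet, every set of short cycles is a disjoint family, so D is the product of the factors 1 + t^l
  and ln D is the cycle sum; since D \<ge> 1, the difference of the logarithms is at most that of
  the sums. If two cycles meet, the trivial bound 2 is paid for by \<open>meeting_count\<close>.
  Keeping only the layers below \<open>r\<close> decreases D and thus weakens the bound.\<close>

lemma char_comparison:
  assumes E: "E \<subseteq> all_edges n" and t: "0 < t"
  shows "cmod (iexp (\<theta> * ln (even_sum {1..n} E t)) - iexp (\<theta> * (\<Sum>c\<in>cyc n L E. ln (1 + t ^ card c))))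
    \<le> \<bar>\<theta>\<bar> * (even_sum {1..n} E t - (\<Sum>k<r. disj_sum n L t k E)) + 2 * meeting_count n L E"
proof -
  let ?S = "even_sum {1..n} E t" and ?X = "\<Sum>c\<in>cyc n L E. ln (1 + t ^ card c)"
  let ?FD = "{F. F \<subseteq> short_cycles {1..n} L \<and> disjoint_family_on Union F \<and> \<Union>F \<subseteq> E}"
  let ?D = "\<Sum>F\<in>?FD. \<Prod>c\<in>F. t ^ card c"
  have fE: "finite E" using E finite_subset finite_all_edges by blast
  have fC: "finite (short_cycles {1..n} L)" by (simp add: finite_short_cycles)
  have fFD: "finite ?FD" by (rule finite_subset[of _ "Pow (short_cycles {1..n} L)"]) (use fC in auto)
  have "?D = (\<Sum>F\<in>?FD. t ^ card (\<Union>F))"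
  proof (rule sum.cong)
    fix F assume F: "F \<in> ?FD"
    then have "card (\<Union>F) = (\<Sum>c\<in>F. card c)"
      using fC finite_subset by (intro card_Union_disjoint_family(2)) auto
    then show "(\<Prod>c\<in>F. t ^ card c) = t ^ card (\<Union>F)" by (simp add: power_sum)
  qed simp
  also have "\<dots> \<le> ?S"
    using fE E t all_edges_subset by (intro disjoint_cycles_le_even_sum) auto
  finally have DS: "?D \<le> ?S" .
  have "(\<Sum>k<r. disj_sum n L t k E) = (\<Sum>k<r. \<Sum>F | F \<in> {F \<in> ?FD. card F < r} \<and> card F = k. \<Prod>c\<in>F. t ^ card c)"
    unfolding disj_sum_def by (intro sum.cong) auto
  also have "\<dots> = (\<Sum>F\<in>{F \<in> ?FD. card F < r}. \<Prod>c\<in>F. t ^ card c)"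
    by (rule sum.group[OF finite_subset[OF _ fFD]]) auto
  also have "\<dots> \<le> ?D"
    using fFD t by (intro sum_mono2) (auto intro: prod_nonneg)
  finally have RD: "(\<Sum>k<r. disj_sum n L t k E) \<le> ?D" .
  show ?thesis
  proof (cases "disjoint_family_on Union (cyc n L E)")
    case True
    have FD: "?FD = Pow (cyc n L E)"
      using disjoint_family_on_mono[OF _ True] by (auto simp: cyc_def)
    have D: "?D = (\<Prod>c\<in>cyc n L E. 1 + t ^ card c)"
      unfolding FD by (rule prod_one_plus[OF finite_cyc, symmetric])
    have D1: "?D \<ge> 1" unfolding D using t by (intro prod_ge_1) auto
    have X: "?X = ln ?D"
    proof -
      have "1 + t ^ card c > 0" for c :: "nat set set" using t by (simp add: add_pos_nonneg)
      then have "exp ?X = ?D" unfolding D by (simp add: exp_sum finite_cyc)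
      then show ?thesis by (metis ln_exp)
    qed
    have m0: "meeting_count n L E \<ge> 0" unfolding meeting_count_def by (intro sum_nonneg) auto
    have "cmod (iexp (\<theta> * ln ?S) - iexp (\<theta> * ?X)) \<le> \<bar>\<theta> * ln ?S - \<theta> * ?X\<bar>"
      by (rule norm_iexp_diff_le)
    also have "\<dots> = \<bar>\<theta>\<bar> * (ln ?S - ln ?D)"
      using DS D1 by (simp add: X abs_mult right_diff_distrib[symmetric] del: mult_minus_right)
    also have "\<dots> \<le> \<bar>\<theta>\<bar> * (?S - (\<Sum>k<r. disj_sum n L t k E))"
    proof (intro mult_left_mono)
      have "ln ?S - ln ?D \<le> (?S - ?D) / ?D" using DS D1 by (intro ln_diff_le) auto
      also have "\<dots> \<le> (?S - ?D) / 1" using DS D1 by (intro divide_left_mono) auto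
      finally show "ln ?S - ln ?D \<le> ?S - (\<Sum>k<r. disj_sum n L t k E)" using RD by simp
    qed simp
    finally show ?thesis using m0 by simp
  next
    case False
    then obtain c c' where c: "c \<in> cyc n L E" "c' \<in> cyc n L E" "c \<noteq> c'" "\<Union>c \<inter> \<Union>c' \<noteq> {}"
      unfolding disjoint_family_on_def by blast
    have nd: "\<not> disjoint_family_on Union {c, c'}"
      using c unfolding disjoint_family_on_def by blast
    have "{c, c'} \<in> {F. F \<in> meetings n L \<and> \<Union>F \<subseteq> E}"
      using c nd by (auto simp: cyc_def)
    then have "1 \<le> meeting_count n L E"
      unfolding meeting_count_def
      by (intro order_trans[OF _ member_le_sum[of "{c, c'}" _ "\<lambda>_. 1::real"]]
          finite_subset[OF _ finite_families(2)[of n L]]) auto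
    moreover have "cmod (iexp (\<theta> * ln ?S) - iexp (\<theta> * ?X)) \<le> 2"
      using norm_triangle_ineq4[of "iexp (\<theta> * ln ?S)" "iexp (\<theta> * ?X)"] by simp
    moreover have "0 \<le> \<bar>\<theta>\<bar> * (?S - (\<Sum>k<r. disj_sum n L t k E))" using RD DS by simp
    ultimately show ?thesis by linarith
  qed
qed

text \<open>The expected gap between the even sum and its disjoint-cycle layers is bounded in the
  limit by \<open>first_moment_limit t\<close> minus a partial sum of an exponential series.
  Hypothesis \<open>first\<close> makes this small for large \<open>L\<close>, after which
  \<open>r\<close> and \<open>n\<close> are chosen; \<open>char\<close> moves the limit law from
  cycles up to length \<open>L\<close> to all cycles.\<close>

lemma char_even_sum_lim:
  assumes t: "0 < t" "t < 1" "d * t < 1"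
    and first: "(\<lambda>L. exp (\<Sum>l=3..L. t ^ l * (d ^ l / (2 * real l)))) \<longlonglongrightarrow> first_moment_limit t"
    and char: "(\<lambda>L. exp (\<Sum>l=3..L. (iexp (\<theta> * ln (1 + t ^ l)) - 1) * of_real (d ^ l / (2 * real l)))) \<longlonglongrightarrow> z"
  shows "(\<lambda>n. expect n (\<lambda>G. iexp (\<theta> * ln (even_sum {1..n} (snd G) t)))) \<longlonglongrightarrow> z"
proof (rule tendstoI)
  fix e :: real assume e: "e > 0"
  let ?s = "\<lambda>L. \<Sum>l=3..L. t ^ l * (d ^ l / (2 * real l))"
  let ?chi = "\<lambda>L. exp (\<Sum>l=3..L. (iexp (\<theta> * ln (1 + t ^ l)) - 1) * of_real (d ^ l / (2 * real l)))"
  let ?\<Phi> = "first_moment_limit t"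
  have "(\<lambda>L. \<bar>\<theta>\<bar> * (?\<Phi> - exp (?s L))) \<longlonglongrightarrow> \<bar>\<theta>\<bar> * (?\<Phi> - ?\<Phi>)"
    by (intro tendsto_intros first)
  then have "\<forall>\<^sub>F L in sequentially. \<bar>\<theta>\<bar> * (?\<Phi> - exp (?s L)) < e / 4"
    using e by (intro order_tendstoD(2)) auto
  moreover have "\<forall>\<^sub>F L in sequentially. dist (?chi L) z < e / 4"
    using char e by (intro tendstoD) auto
  ultimately have "\<forall>\<^sub>F L in sequentially. \<bar>\<theta>\<bar> * (?\<Phi> - exp (?s L)) < e / 4 \<and> dist (?chi L) z < e / 4"
    by (rule eventually_conj)
  then obtain L where L: "\<bar>\<theta>\<bar> * (?\<Phi> - exp (?s L)) < e / 4" "dist (?chi L) z < e / 4"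
    by (auto simp: eventually_sequentially)
  have "(\<lambda>r. \<bar>\<theta>\<bar> * (?\<Phi> - (\<Sum>k<r. ?s L ^ k / fact k))) \<longlonglongrightarrow> \<bar>\<theta>\<bar> * (?\<Phi> - exp (?s L))"
    by (intro tendsto_intros exp_series_lim)
  then have "\<forall>\<^sub>F r in sequentially. \<bar>\<theta>\<bar> * (?\<Phi> - (\<Sum>k<r. ?s L ^ k / fact k)) < e / 4"
    using L(1) by (intro order_tendstoD(2))
  then obtain r where r: "\<bar>\<theta>\<bar> * (?\<Phi> - (\<Sum>k<r. ?s L ^ k / fact k)) < e / 4"
    by (auto simp: eventually_sequentially)
  obtain h where h: "h \<longlonglongrightarrow> ?\<Phi>"
    "\<forall>\<^sub>F n in sequentially. expect n (\<lambda>G. even_sum {1..n} (snd G) t) \<le> h n"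
    using expectation_even_sum_bound[OF t] by blast
  let ?S = "\<lambda>n G. even_sum {1..n} (snd G) t"
  let ?X = "\<lambda>n G. \<Sum>c\<in>cyc n L (snd G). ln (1 + t ^ card c)"
  let ?B = "\<lambda>n. \<bar>\<theta>\<bar> * (h n - (\<Sum>k<r. expect n (\<lambda>G. disj_sum n L t k (snd G)))) + 2 * expect n (\<lambda>G. meeting_count n L (snd G))"
  have "?B \<longlonglongrightarrow> \<bar>\<theta>\<bar> * (?\<Phi> - (\<Sum>k<r. ?s L ^ k / fact k)) + 2 * 0"
    by (intro tendsto_intros h expect_disj_sum_lim expect_meeting_count_lim) (use t in auto)
  then have 1: "\<forall>\<^sub>F n in sequentially. ?B n < e / 4"
    using r by (intro order_tendstoD(2)) auto
  have 2: "\<forall>\<^sub>F n in sequentially. dist (expect n (\<lambda>G. iexp (\<theta> * ?X n G))) (?chi L) < e / 4"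
    using char_short_cycles_lim[where \<theta> = \<theta> and L = L and a = "\<lambda>l. ln (1 + t ^ l)"] e by (intro tendstoD) auto
  have 3: "\<forall>\<^sub>F n in sequentially. dist (expect n (\<lambda>G. iexp (\<theta> * ln (?S n G)))) (expect n (\<lambda>G. iexp (\<theta> * ?X n G))) \<le> ?B n"
    using ev_good h(2)
  proof eventually_elim
    case (elim n)
    then have mn: "m n \<le> n choose 2" by simp
    note int = integrable_rg[OF mn]
    let ?b = "\<lambda>G. \<bar>\<theta>\<bar> * (?S n G - (\<Sum>k<r. disj_sum n L t k (snd G))) + 2 * meeting_count n L (snd G)"
    have "dist (expect n (\<lambda>G. iexp (\<theta> * ln (?S n G)))) (expect n (\<lambda>G. iexp (\<theta> * ?X n G)))
        = norm (expect n (\<lambda>G. iexp (\<theta> * ln (?S n G)) - iexp (\<theta> * ?X n G)))"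
      unfolding dist_norm by (subst Bochner_Integration.integral_diff[OF int int]) (rule refl)
    also have "\<dots> \<le> expect n (\<lambda>G. norm (iexp (\<theta> * ln (?S n G)) - iexp (\<theta> * ?X n G)))"
      by (rule integral_norm_bound)
    also have "\<dots> \<le> expect n ?b"
    proof (rule integral_mono_AE[OF int int])
      show "AE G in measure_pmf (random_graph n (m n)).
          norm (iexp (\<theta> * ln (?S n G)) - iexp (\<theta> * ?X n G)) \<le> ?b G"
        unfolding AE_measure_pmf_iff
        using char_comparison[OF random_graph_edges(2)[OF mn] t(1)] by blast
    qed
    also have "\<dots> = \<bar>\<theta>\<bar> * (expect n (?S n) - (\<Sum>k<r. expect n (\<lambda>G. disj_sum n L t k (snd G)))) + 2 * expect n (\<lambda>G. meeting_count n L (snd G))"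
      by (simp add: int Bochner_Integration.integral_diff Bochner_Integration.integral_add Bochner_Integration.integral_sum)
    also have "\<dots> \<le> ?B n" using elim by (intro add_right_mono mult_left_mono diff_right_mono) auto
    finally show ?case .
  qed
  from 1 2 3 show "\<forall>\<^sub>F n in sequentially. dist (expect n (\<lambda>G. iexp (\<theta> * ln (?S n G)))) z < e"
  proof eventually_elim
    case (elim n)
    have "dist (expect n (\<lambda>G. iexp (\<theta> * ln (?S n G)))) z \<le>
        dist (expect n (\<lambda>G. iexp (\<theta> * ln (?S n G)))) (expect n (\<lambda>G. iexp (\<theta> * ?X n G)))
        + dist (expect n (\<lambda>G. iexp (\<theta> * ?X n G))) (?chi L) + dist (?chi L) z"
      by (meson add_right_mono dist_triangle order_trans)
    also have "\<dots> < e" using elim L e by simp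
    finally show ?case .
  qed
qed

end

section \<open>The Poisson limit\<close>

lemma nn_integral_poisson:
  assumes "0 < r"
  shows "(\<integral>\<^sup>+k. ennreal (real k) \<partial>measure_pmf (poisson_pmf r)) = ennreal r"
proof -
  have "(\<lambda>k. r ^ k / fact k * exp (-r) * r) sums (exp r * exp (-r) * r)"
    using exp_converges[of r] by (intro sums_mult2) (simp add: divide_inverse mult.commute)
  then have "(\<lambda>k. r ^ Suc k / fact (Suc k) * exp (-r) * real (Suc k)) sums r"
    by (simp add: exp_minus field_simps del: of_nat_Suc)
  then have "(\<lambda>k. r ^ k / fact k * exp (-r) * real k) sums r"
    by (subst (asm) sums_Suc_iff) simp
  then have "(\<Sum>k. ennreal (r ^ k / fact k * exp (-r) * real k)) = ennreal r"
    using assms by (intro suminf_ennreal_eq) auto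
  then show ?thesis
    using assms by (simp add: nn_integral_measure_pmf nn_integral_count_space_nat ennreal_mult'[symmetric])
qed

lemma char_poisson:
  assumes "0 < r"
  shows "(\<integral>k. iexp (\<theta> * real k) \<partial>measure_pmf (poisson_pmf r)) = exp (of_real r * (iexp \<theta> - 1))"
proof -
  let ?z = "iexp \<theta>"
  let ?f = "\<lambda>k. pmf (poisson_pmf r) k *\<^sub>R iexp (\<theta> * real k)"
  have f: "?f k = (of_real r * ?z) ^ k /\<^sub>R fact k * of_real (exp (-r))" for k
  proof -
    have "iexp (\<theta> * real k) = ?z ^ k"
      by (simp add: exp_of_nat_mult[symmetric] mult_ac)
    then show ?thesis using assms
      by (simp add: scaleR_conv_of_real power_mult_distrib divide_inverse mult_ac)
  qed
  have "(\<lambda>k. r ^ k / fact k * exp (-r)) sums (exp r * exp (-r))"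
    using exp_converges[of r] by (intro sums_mult2) (simp add: divide_inverse mult.commute)
  then have "summable (\<lambda>k. norm (?f k))"
    using assms by (simp add: sums_iff)
  then have int: "integrable (count_space UNIV) ?f" by (simp add: integrable_count_space_nat_iff)
  have "(\<integral>k. iexp (\<theta> * real k) \<partial>measure_pmf (poisson_pmf r)) = (\<integral>k. ?f k \<partial>count_space UNIV)"
    by (simp add: measure_pmf_eq_density integral_density)
  also have "\<dots> = (\<Sum>k. ?f k)" by (rule integral_count_space_nat[OF int])
  also have "\<dots> = exp (of_real r * ?z) * of_real (exp (-r))"
    unfolding f by (rule sums_unique[symmetric, OF sums_mult2[OF exp_converges]])
  also have "\<dots> = exp (of_real r * (?z - 1))"
    by (simp add: exp_of_real[symmetric] exp_add[symmetric] right_diff_distrib)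
  finally show ?thesis .
qed

text \<open>The logarithmic series without its terms for l = 1 and l = 2, which reappear as - x / 2
  and - x^2 / 4.\<close>

lemma cycle_log_series:
  fixes x :: real assumes "0 < x" "x < 1"
  shows "(\<lambda>k. x ^ (k + 3) / (2 * real (k + 3))) sums (- ln (1 - x) / 2 - x / 2 - x\<^sup>2 / 4)"
proof -
  let ?g = "\<lambda>n. x ^ Suc n / real (n + 1)"
  have "summable (\<lambda>n. x ^ n)" using assms by (intro summable_geometric) simp
  then have sm: "summable ?g"
  proof (rule summable_comparison_test'[where N = 0])
    fix n :: nat
    have "x ^ Suc n / real (n + 1) \<le> x ^ Suc n / 1" using assms by (intro divide_left_mono) auto
    also have "\<dots> \<le> x ^ n" using assms by (simp add: mult_left_le_one_le)
    finally show "norm (?g n) \<le> x ^ n" using assms by simp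
  qed
  have "ln (1 - x) = (\<Sum>n. (-1) ^ n * (1 / real (n + 1)) * (- x) ^ Suc n)"
    using ln_series[of "1 - x"] assms by simp
  also have "(\<lambda>n. (-1) ^ n * (1 / real (n + 1)) * (- x) ^ Suc n) = (\<lambda>n. - ?g n)"
  proof
    fix n
    have "(-1) ^ n * (- x) ^ n = x ^ n" by (simp add: power_mult_distrib[symmetric])
    then show "(-1) ^ n * (1 / real (n + 1)) * (- x) ^ Suc n = - ?g n" by (simp add: field_simps)
  qed
  also have "(\<Sum>n. - ?g n) = - (\<Sum>n. ?g n)" using sm by (rule suminf_minus)
  finally have "?g sums (- ln (1 - x))" using sm by (simp add: sums_iff)
  then have "(\<lambda>n. ?g (n + 2)) sums (- ln (1 - x) - (\<Sum>i<2. ?g i))" by (rule sums_split_initial_segment)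
  then have "(\<lambda>n. ?g (n + 2) / 2) sums ((- ln (1 - x) - (\<Sum>i<2. ?g i)) / 2)" by (rule sums_divide)
  moreover have "?g (n + 2) / 2 = x ^ (n + 3) / (2 * real (n + 3))" for n
    by (simp add: numeral_3_eq_3)
  moreover have "(\<Sum>i<2. f i) = f 0 + f 1" for f :: "nat \<Rightarrow> real" by (simp add: numeral_2_eq_2)
  then have "(- ln (1 - x) - (\<Sum>i<2. ?g i)) / 2 = - ln (1 - x) / 2 - x / 2 - x\<^sup>2 / 4"
    by (simp add: power2_eq_square)
  ultimately show ?thesis by (simp only:)
qed

lemma tanh_artanh_real:
  fixes x :: real assumes "\<bar>x\<bar> < 1"
  shows "tanh (artanh x) = x"
proof -
  have x: "1 + x > 0" "1 - x > 0" using assms by auto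
  have "exp (- 2 * artanh x) = exp (- ln ((1 + x) / (1 - x)))" by (simp add: artanh_def)
  also have "\<dots> = (1 - x) / (1 + x)" using x by (simp add: exp_minus)
  finally have "tanh (artanh x) = (1 - (1 - x) / (1 + x)) / (1 + (1 - x) / (1 + x))"
    by (simp only: tanh_real_altdef)
  also have "\<dots> = x" using x by (simp add: field_simps)
  finally show ?thesis .
qed

text \<open>Matches cycle lengths, which start at 3, with series indexed from 0: \<open>K\<close>
  terms end at the length \<open>K + 2\<close>.\<close>

lemma sum_from_3: "(\<Sum>l=3..K+2. g l) = (\<Sum>k<K. g (k + 3))" for g :: "nat \<Rightarrow> 'b::comm_monoid_add"
  by (rule sum.reindex_bij_witness[of _ "\<lambda>k. k + 3" "\<lambda>l. l - 3"]) auto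

text \<open>With length bound 0 the empty family alone remains, and it contributes 1.\<close>

lemma even_sum_pos:
  assumes "finite V" "finite E" "\<And>e. e \<in> E \<Longrightarrow> e \<subseteq> V" "t \<ge> 0"
  shows "even_sum V E t > 0"
proof -
  have "short_cycles V 0 = {}" by (simp add: short_cycles_def)
  then have "{F. F \<subseteq> short_cycles V 0 \<and> disjoint_family_on Union F \<and> \<Union>F \<subseteq> E} = {{}}"
    by (auto simp: disjoint_family_on_def)
  then show ?thesis using disjoint_cycles_le_even_sum[OF assms, of 0] by simp
qed

text \<open>The limits of the upper and the lower bound are the same number: the logarithmic series
  at \<open>d * t\<close> supplies the square root, and its two missing terms supply the
  exponent.\<close>

lemma (in sparse_graph) first_moment_series:
  assumes "0 < t" "d * t < 1"
  shows "(\<lambda>L. exp (\<Sum>l=3..L. t ^ l * (d ^ l / (2 * real l)))) \<longlonglongrightarrow> first_moment_limit t"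
proof -
  have dt: "0 < d * t" using d_pos assms by simp
  have "(\<lambda>K. \<Sum>k<K. (d * t) ^ (k + 3) / (2 * real (k + 3)))
      \<longlonglongrightarrow> - ln (1 - d * t) / 2 - (d * t) / 2 - (d * t)\<^sup>2 / 4"
    using cycle_log_series[OF dt assms(2)] by (simp add: sums_def)
  then have "(\<lambda>K. exp (\<Sum>l=3..K+2. t ^ l * (d ^ l / (2 * real l))))
      \<longlonglongrightarrow> exp (- ln (1 - d * t) / 2 - (d * t) / 2 - (d * t)\<^sup>2 / 4)"
    unfolding sum_from_3 by (intro tendsto_exp) (simp add: power_mult_distrib mult_ac)
  moreover have "exp (- ln (1 - d * t) / 2 - (d * t) / 2 - (d * t)\<^sup>2 / 4) = first_moment_limit t"
  proof -
    have "exp (ln (1 - d * t) / 2) = sqrt (1 - d * t)"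
      using assms by (simp add: ln_sqrt[symmetric])
    then have "exp (- (ln (1 - d * t) / 2)) = 1 / sqrt (1 - d * t)" by (simp add: exp_minus inverse_eq_divide)
    moreover have "- ln (1 - d * t) / 2 - (d * t) / 2 - (d * t)\<^sup>2 / 4
        = (- (d * t) / 2 - (d * t)\<^sup>2 / 4) + - (ln (1 - d * t) / 2)" by simp
    ultimately show ?thesis unfolding first_moment_limit_def by (simp only: exp_add) simp
  qed
  ultimately have "(\<lambda>K. exp (\<Sum>l=3..K+2. t ^ l * (d ^ l / (2 * real l)))) \<longlonglongrightarrow> first_moment_limit t" by simp
  then show ?thesis by (rule LIMSEQ_offset)
qed

section \<open>Sums of independent Poisson variables\<close>

context prob_space
begin

lemma indep_vars_measurable:
  assumes "indep_vars (\<lambda>_. count_space UNIV) Y I" "i \<in> I"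
  shows "Y i \<in> measurable M (count_space UNIV)"
  using assms unfolding indep_vars_def by blast

lemma char_poisson_sum:
  fixes Y :: "nat \<Rightarrow> 'a \<Rightarrow> nat"
  assumes ind: "indep_vars (\<lambda>_. count_space UNIV) Y I" and J: "J \<subseteq> I" "finite J"
    and Y: "\<And>l. l \<in> J \<Longrightarrow> distr M (count_space UNIV) (Y l) = measure_pmf (poisson_pmf (r l))"
    and r: "\<And>l. l \<in> J \<Longrightarrow> 0 < r l"
  shows "char (distr M borel (\<lambda>\<omega>. \<Sum>l\<in>J. a l * real (Y l \<omega>))) \<theta>
    = exp (\<Sum>l\<in>J. (iexp (\<theta> * a l) - 1) * of_real (r l))"
proof -
  have meas: "Y l \<in> measurable M (count_space UNIV)" if "l \<in> J" for l
    using indep_vars_measurable[OF ind] J that by blast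
  have "indep_vars (\<lambda>_. borel) (\<lambda>l \<omega>. a l * real (Y l \<omega>)) J"
    by (rule indep_vars_compose2[OF indep_vars_subset[OF ind J(1)], where Y = "\<lambda>l y. a l * real y"]) simp
  then have "char (distr M borel (\<lambda>\<omega>. \<Sum>l\<in>J. a l * real (Y l \<omega>))) \<theta>
      = (\<Prod>l\<in>J. char (distr M borel (\<lambda>\<omega>. a l * real (Y l \<omega>))) \<theta>)"
    by (rule char_distr_sum)
  also have "\<dots> = (\<Prod>l\<in>J. exp ((iexp (\<theta> * a l) - 1) * of_real (r l)))"
  proof (rule prod.cong)
    fix l assume l: "l \<in> J"
    note [measurable] = meas[OF l]
    have "char (distr M borel (\<lambda>\<omega>. a l * real (Y l \<omega>))) \<theta> = (\<integral>\<omega>. iexp (\<theta> * a l * real (Y l \<omega>)) \<partial>M)"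
      by (simp add: char_def integral_distr mult.assoc)
    also have "\<dots> = (\<integral>k. iexp (\<theta> * a l * real k) \<partial>distr M (count_space UNIV) (Y l))"
      by (rule integral_distr[symmetric]) (auto intro: meas l)
    also have "\<dots> = exp (of_real (r l) * (iexp (\<theta> * a l) - 1))"
      unfolding Y[OF l] by (rule char_poisson[OF r[OF l]])
    finally show "char (distr M borel (\<lambda>\<omega>. a l * real (Y l \<omega>))) \<theta>
        = exp ((iexp (\<theta> * a l) - 1) * of_real (r l))" by (simp add: mult.commute)
  qed simp
  also have "\<dots> = exp (\<Sum>l\<in>J. (iexp (\<theta> * a l) - 1) * of_real (r l))"
    using J by (simp add: exp_sum)
  finally show ?thesis .
qed

text \<open>Nonnegative terms of finite total expectation have an almost surely finite sum: sum and
  integral are exchanged in the extended nonnegative reals, where no prior convergence is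
  required.\<close>

lemma AE_summable_poisson:
  fixes Y :: "nat \<Rightarrow> 'a \<Rightarrow> nat"
  assumes meas: "\<And>k. Y k \<in> measurable M (count_space UNIV)"
    and Y: "\<And>k. distr M (count_space UNIV) (Y k) = measure_pmf (poisson_pmf (r k))"
    and r: "\<And>k. 0 < r k" and a: "\<And>k. 0 \<le> a k" and sm: "summable (\<lambda>k. a k * r k)"
  shows "AE \<omega> in M. summable (\<lambda>k. a k * real (Y k \<omega>))"
proof -
  note [measurable] = meas
  have "(\<integral>\<^sup>+\<omega>. ennreal (a k * real (Y k \<omega>)) \<partial>M) = ennreal (a k * r k)" for k
  proof -
    have "(\<integral>\<^sup>+\<omega>. ennreal (a k * real (Y k \<omega>)) \<partial>M) = ennreal (a k) * (\<integral>\<^sup>+\<omega>. ennreal (real (Y k \<omega>)) \<partial>M)"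
      using a by (simp add: ennreal_mult nn_integral_cmult)
    also have "(\<integral>\<^sup>+\<omega>. ennreal (real (Y k \<omega>)) \<partial>M) = (\<integral>\<^sup>+j. ennreal (real j) \<partial>distr M (count_space UNIV) (Y k))"
      by (rule nn_integral_distr[symmetric]) auto
    also have "\<dots> = ennreal (r k)" unfolding Y by (rule nn_integral_poisson[OF r])
    finally show ?thesis using a r by (simp add: ennreal_mult less_imp_le)
  qed
  then have "(\<integral>\<^sup>+\<omega>. (\<Sum>k. ennreal (a k * real (Y k \<omega>))) \<partial>M) = (\<Sum>k. ennreal (a k * r k))"
    by (simp add: nn_integral_suminf)
  also have "\<dots> = ennreal (\<Sum>k. a k * r k)"
    using a r sm by (intro suminf_ennreal2) (auto intro: mult_nonneg_nonneg less_imp_le)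
  finally have "(\<integral>\<^sup>+\<omega>. (\<Sum>k. ennreal (a k * real (Y k \<omega>))) \<partial>M) \<noteq> \<infinity>" by simp
  then have "AE \<omega> in M. (\<Sum>k. ennreal (a k * real (Y k \<omega>))) \<noteq> \<infinity>"
    by (intro nn_integral_PInf_AE) auto
  then show ?thesis
  proof eventually_elim
    case (elim \<omega>)
    then show ?case using a by (intro summable_suminf_not_top) auto
  qed
qed

end

text \<open>Almost sure summability is asserted separately because \<open>suminf\<close> of a
  divergent series is an unspecified number; with it, the series in the limit law has its intended
  meaning. The shift \<open>l = k + 3\<close> starts the series at triangles.\<close>

theorem theorem1p2:
  fixes d \<beta> :: real and m :: "nat \<Rightarrow> nat"
    and M :: "'a measure" and Y :: "nat \<Rightarrow> 'a \<Rightarrow> nat"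
  assumes "d > 0" and "\<beta> > 0"
    and "(\<lambda>n. 2 * real (m n) / real n) \<longlonglongrightarrow> d"
    and "d \<le> 1 \<or> (d > 1 \<and> \<beta> < beta_f d)"
    and "prob_space M"
    and "prob_space.indep_vars M (\<lambda>_. count_space UNIV) Y {3..}"
    and "\<And>l. l \<ge> 3 \<Longrightarrow>
           distr M (count_space UNIV) (Y l) = measure_pmf (poisson_pmf (d ^ l / (2 * real l)))"
  shows "(AE \<omega> in M. summable (\<lambda>k. let l = k + 3 in
             real (Y l \<omega>) * ln (1 + tanh \<beta> ^ l) - d ^ l / (2 * real l) * tanh \<beta> ^ l))
     \<and> weak_conv_m
         (\<lambda>n. distr (measure_pmf (random_graph n (m n))) borel
            (\<lambda>G. ln (ising_Z G \<beta>)
                 - (real n * ln 2 + real (m n) * ln (cosh \<beta>) - 1 / 2 * ln (1 - d * tanh \<beta>))))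
         (distr M borel
            (\<lambda>\<omega>. (\<Sum>k. let l = k + 3 in
                     real (Y l \<omega>) * ln (1 + tanh \<beta> ^ l) - d ^ l / (2 * real l) * tanh \<beta> ^ l)
                 - d / 2 * tanh \<beta> - d\<^sup>2 / 4 * (tanh \<beta>)\<^sup>2))"
proof -
  interpret sparse_graph d m by unfold_locales (use assms in auto)
  interpret prob_space M by fact
  define t where "t = tanh \<beta>"
  have t: "0 < t" "t < 1" using assms(2) tanh_real_lt_1[of \<beta>] by (auto simp: t_def)
  \<comment> \<open>The subcritical condition in the form used throughout: for d \<le> 1 it follows
    from \<open>tanh \<beta> < 1\<close>, and otherwise \<open>beta_f d\<close> is the point at
    which \<open>d * tanh \<beta>\<close> reaches 1.\<close>
  have dt: "d * t < 1"
  proof (cases "d \<le> 1")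
    case True
    then have "d * t \<le> 1 * t" using t by (intro mult_right_mono) auto
    then show ?thesis using t(2) by linarith
  next
    case False
    then have d: "d > 1" "\<beta> < artanh (1 / d)" using assms(4) by (auto simp: beta_f_def)
    have "t < tanh (artanh (1 / d))" unfolding t_def using d(2) by simp
    also have "tanh (artanh (1 / d)) = 1 / d" using d(1) by (intro tanh_artanh_real) auto
    finally show ?thesis using d(1) by (simp add: field_simps)
  qed
  have dt0: "0 < d * t" using assms(1) t by simp
  define a where "a l = ln (1 + t ^ l)" for l :: nat
  define r where "r l = d ^ l / (2 * real l)" for l :: nat
  \<comment> \<open>Both laws are translates by \<open>\<kappa>\<close>: of the law of the logarithm
    of \<open>even_sum\<close> on the graph side, and of the law of the uncentred Poisson series on
    the other.\<close>
  define \<kappa> where "\<kappa> = 1 / 2 * ln (1 - d * t)"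
  have a0: "0 \<le> a l" for l using t by (simp add: a_def)
  have a1: "a l \<le> t ^ l" for l using t by (simp add: a_def ln_add_one_self_le_self)
  have r0: "0 < r l" if "l \<ge> 3" for l using that assms(1) by (simp add: r_def)
  have Ym: "Y (k + 3) \<in> measurable M (count_space UNIV)" for k
    using indep_vars_measurable[OF assms(6), of "k + 3"] by simp
  note [measurable] = Ym
  have Yd: "distr M (count_space UNIV) (Y (k + 3)) = measure_pmf (poisson_pmf (r (k + 3)))" for k
    using assms(7)[of "k + 3"] by (simp add: r_def)
  have rt: "r l * t ^ l = (d * t) ^ l / (2 * real l)" for l
    by (simp add: r_def power_mult_distrib)
  \<comment> \<open>The centring constants sum to \<open>- \<kappa>\<close> minus the two explicit
    correction terms, so centring and correction together amount to adding
    \<open>\<kappa>\<close>.\<close>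
  have rt_sums: "(\<lambda>k. r (k + 3) * t ^ (k + 3)) sums (- \<kappa> - d / 2 * t - d\<^sup>2 / 4 * t\<^sup>2)"
    using cycle_log_series[OF dt0 dt] unfolding rt
    by (simp add: \<kappa>_def power_mult_distrib)
  have "summable (\<lambda>k. a (k + 3) * r (k + 3))"
  proof (rule summable_comparison_test'[OF sums_summable[OF rt_sums], where N = 0])
    fix k :: nat
    have "a (k + 3) * r (k + 3) \<le> t ^ (k + 3) * r (k + 3)"
      using a1 r0[of "k + 3"] by (intro mult_right_mono) auto
    then show "norm (a (k + 3) * r (k + 3)) \<le> r (k + 3) * t ^ (k + 3)"
      using a0[of "k + 3"] r0[of "k + 3"] by (simp add: abs_mult mult.commute)
  qed
  then have AEs: "AE \<omega> in M. summable (\<lambda>k. a (k + 3) * real (Y (k + 3) \<omega>))"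
    using Ym Yd r0 a0 by (intro AE_summable_poisson[where r = "\<lambda>k. r (k + 3)"]) auto
  define W where "W \<omega> = (\<Sum>k. a (k + 3) * real (Y (k + 3) \<omega>))" for \<omega>
  have Wm [measurable]: "W \<in> borel_measurable M"
    unfolding W_def by measurable
  let ?term = "\<lambda>\<omega> k. let l = k + 3 in real (Y l \<omega>) * ln (1 + tanh \<beta> ^ l) - d ^ l / (2 * real l) * tanh \<beta> ^ l"
  let ?W' = "\<lambda>\<omega>. (\<Sum>k. ?term \<omega> k) - d / 2 * tanh \<beta> - d\<^sup>2 / 4 * (tanh \<beta>)\<^sup>2"
  have term_eq: "?term \<omega> k = a (k + 3) * real (Y (k + 3) \<omega>) - r (k + 3) * t ^ (k + 3)" for \<omega> k
    by (simp add: Let_def a_def r_def t_def)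
  have AE_summable: "AE \<omega> in M. summable (?term \<omega>)"
    using AEs unfolding term_eq by eventually_elim (intro summable_diff sums_summable[OF rt_sums])
  have W'm [measurable]: "?W' \<in> borel_measurable M"
    unfolding term_eq by measurable
  have W'_eq: "AE \<omega> in M. ?W' \<omega> = \<kappa> + W \<omega>"
    using AEs
  proof eventually_elim
    case (elim \<omega>)
    have "(\<Sum>k. ?term \<omega> k) = W \<omega> - (- \<kappa> - d / 2 * t - d\<^sup>2 / 4 * t\<^sup>2)"
      unfolding term_eq W_def using suminf_diff[OF elim sums_summable[OF rt_sums]] sums_unique[OF rt_sums]
      by simp
    then show ?case by (simp add: t_def)
  qed
  let ?X = "\<lambda>n G. ln (ising_Z G \<beta>) - (real n * ln 2 + real (m n) * ln (cosh \<beta>) - 1 / 2 * ln (1 - d * tanh \<beta>))"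
  let ?Mn = "\<lambda>n. distr (measure_pmf (random_graph n (m n))) borel (?X n)"
  have "weak_conv_m ?Mn (distr M borel ?W')"
  proof (rule levy_continuity)
    show "real_distribution (?Mn n)" for n
      by (intro prob_space.real_distribution_distr prob_space_measure_pmf) simp
    show "real_distribution (distr M borel ?W')" by (rule real_distribution_distr[OF W'm])
    fix \<theta> :: real
    let ?chi = "\<lambda>L. exp (\<Sum>l=3..L. (iexp (\<theta> * a l) - 1) * of_real (r l))"
    define z where "z = (\<integral>\<omega>. iexp (\<theta> * W \<omega>) \<partial>M)"
    \<comment> \<open>Characteristic functions of the partial sums converge by dominated
      convergence, their integrands having modulus 1; independence evaluates them in closed form,
      which identifies \<open>z\<close> as the limit of \<open>?chi\<close>.\<close>
    have "(\<lambda>K. \<integral>\<omega>. iexp (\<theta> * (\<Sum>k<K. a (k + 3) * real (Y (k + 3) \<omega>))) \<partial>M) \<longlonglongrightarrow> z"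
      unfolding z_def
    proof (rule integral_dominated_convergence[where w = "\<lambda>_. 1"])
      show "AE \<omega> in M. (\<lambda>K. iexp (\<theta> * (\<Sum>k<K. a (k + 3) * real (Y (k + 3) \<omega>)))) \<longlonglongrightarrow> iexp (\<theta> * W \<omega>)"
        using AEs
      proof eventually_elim
        case (elim \<omega>)
        then have "(\<lambda>K. \<Sum>k<K. a (k + 3) * real (Y (k + 3) \<omega>)) \<longlonglongrightarrow> W \<omega>"
          unfolding W_def by (rule summable_LIMSEQ)
        then show ?case by (intro tendsto_intros)
      qed
    qed auto
    moreover have "(\<integral>\<omega>. iexp (\<theta> * (\<Sum>k<K. a (k + 3) * real (Y (k + 3) \<omega>))) \<partial>M) = ?chi (K + 2)" for K
    proof -
      have "?chi (K + 2) = char (distr M borel (\<lambda>\<omega>. \<Sum>l=3..K+2. a l * real (Y l \<omega>))) \<theta>"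
        using assms(7) r0 by (intro char_poisson_sum[OF assms(6), symmetric]) (auto simp: r_def)
      also have "\<dots> = char (distr M borel (\<lambda>\<omega>. \<Sum>k<K. a (k + 3) * real (Y (k + 3) \<omega>))) \<theta>"
        unfolding sum_from_3 ..
      finally show ?thesis by (simp add: char_def integral_distr)
    qed
    ultimately have "(\<lambda>K. ?chi (K + 2)) \<longlonglongrightarrow> z" by simp
    then have "?chi \<longlonglongrightarrow> z" by (rule LIMSEQ_offset)
    then have "(\<lambda>n. expect n (\<lambda>G. iexp (\<theta> * ln (even_sum {1..n} (snd G) t)))) \<longlonglongrightarrow> z"
      unfolding a_def r_def by (intro char_even_sum_lim t dt first_moment_series)
    then have lim: "(\<lambda>n. iexp (\<theta> * \<kappa>) * expect n (\<lambda>G. iexp (\<theta> * ln (even_sum {1..n} (snd G) t)))) \<longlonglongrightarrow> iexp (\<theta> * \<kappa>) * z"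
      by (rule tendsto_mult_left)
    have "\<forall>\<^sub>F n in sequentially. iexp (\<theta> * \<kappa>) * expect n (\<lambda>G. iexp (\<theta> * ln (even_sum {1..n} (snd G) t))) = char (?Mn n) \<theta>"
      using ev_good
    proof eventually_elim
      case (elim n)
      \<comment> \<open>The expansion of the partition function is available for graphs in the
        support, so the integrands below are compared almost everywhere.\<close>
      have pt: "?X n G = \<kappa> + ln (even_sum {1..n} (snd G) t)" if "G \<in> set_pmf (random_graph n (m n))" for G
      proof -
        note G = random_graph_edges[OF _ that]
        have mn: "m n \<le> n choose 2" using elim by simp
        have sub: "\<And>e. e \<in> snd G \<Longrightarrow> e \<subseteq> {1..n}" using G(2)[OF mn] all_edges_subset by blast
        have "ising_Z G \<beta> = ising_Z ({1..n}, snd G) \<beta>" using G(1)[OF mn] by (metis prod.collapse)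
        also have "\<dots> = 2 ^ n * cosh \<beta> ^ m n * even_sum {1..n} (snd G) t"
          using ising_Z_eq_even_sum[OF G(4)[OF mn] sub] G(3)[OF mn] by (simp add: t_def)
        finally have "ising_Z G \<beta> = 2 ^ n * cosh \<beta> ^ m n * even_sum {1..n} (snd G) t" .
        moreover have "even_sum {1..n} (snd G) t > 0"
          using G(4)[OF mn] sub t by (intro even_sum_pos) auto
        ultimately have "ln (ising_Z G \<beta>) = real n * ln 2 + real (m n) * ln (cosh \<beta>) + ln (even_sum {1..n} (snd G) t)"
          by (simp add: ln_mult ln_realpow cosh_real_pos)
        then show ?thesis by (simp add: \<kappa>_def t_def)
      qed
      have "char (?Mn n) \<theta> = expect n (\<lambda>G. iexp (\<theta> * ?X n G))"
        by (simp add: char_def integral_distr)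
      also have "\<dots> = expect n (\<lambda>G. iexp (\<theta> * \<kappa>) * iexp (\<theta> * ln (even_sum {1..n} (snd G) t)))"
      proof (rule Bochner_Integration.integral_cong_AE)
        show "AE G in measure_pmf (random_graph n (m n)). iexp (\<theta> * ?X n G) = iexp (\<theta> * \<kappa>) * iexp (\<theta> * ln (even_sum {1..n} (snd G) t))"
          unfolding AE_measure_pmf_iff
          by (intro ballI) (simp only: pt exp_add[symmetric] of_real_add[symmetric] distrib_left[symmetric] of_real_mult[symmetric])
      qed auto
      finally show ?case by simp
    qed
    then have "(\<lambda>n. char (?Mn n) \<theta>) \<longlonglongrightarrow> iexp (\<theta> * \<kappa>) * z"
      using lim by (rule Lim_transform_eventually[rotated])
    moreover have "char (distr M borel ?W') \<theta> = iexp (\<theta> * \<kappa>) * z"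
    proof -
      have "char (distr M borel ?W') \<theta> = (\<integral>\<omega>. iexp (\<theta> * ?W' \<omega>) \<partial>M)"
        unfolding char_def by (rule integral_distr[OF W'm]) simp
      also have "\<dots> = (\<integral>\<omega>. iexp (\<theta> * \<kappa>) * iexp (\<theta> * W \<omega>) \<partial>M)"
      proof (rule Bochner_Integration.integral_cong_AE)
        show "AE \<omega> in M. iexp (\<theta> * ?W' \<omega>) = iexp (\<theta> * \<kappa>) * iexp (\<theta> * W \<omega>)"
          using W'_eq by eventually_elim
            (simp only: exp_add[symmetric] of_real_add[symmetric] distrib_left[symmetric] of_real_mult[symmetric])
      qed (use W'm in measurable)
      finally show ?thesis by (simp add: z_def)
    qed
    ultimately show "(\<lambda>n. char (?Mn n) \<theta>) \<longlonglongrightarrow> char (distr M borel ?W') \<theta>" by simp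
  qed
  then show ?thesis using AE_summable by blast
qed

end
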